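(* Let $\Omega\subset S^{n-1}$ be a closed set not contained in any closed hemisphere of $S^{n-1}$. Let $h_1,h_2\in C^+(\Omega)$ and let $\varphi_1,\varphi_2\in\mathcal{I}$ or $\varphi_1,\varphi_2\in\mathcal{D}$. Suppose that for $i=1,2$, $\varphi_i$ is continuously differentiable and such that $\varphi_i'$ is nonzero on $(0,\infty)$. If $G:(0,\infty)\times S^{n-1}\to(0,\infty)$ and $G_t=\partial G/\partial t$ are continuous on $(0,\infty)\times S^{n-1}$, then $$\lim_{\varepsilon\to0^+}\frac{\widetilde{V}_G([h_\varepsilon])-\widetilde{V}_G([h_1])}{\varepsilon}=\frac{n}{\varphi_1'(1)}\int_\Omega\varphi_2\!\left(\frac{h_2(u)}{h_1(u)}\right)d\widetilde{C}_G([h_1],u),$$ where, for $\varepsilon>0$, $h_\varepsilon\in C^+(\Omega)$ is defined (implicitly and uniquely) by $$\varphi_1\left(\frac{h_1(u)}{h_\varepsilon(u)}\right)+\varepsilon\,\varphi_2\left(\frac{h_2(u)}{h_\varepsilon(u)}\right)=1,\qquad u\in\Omega.$$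
   Context: $C^+(\Omega)$ is the set of strictly positive continuous functions on $\Omega$. $\mathcal{I}$ is the class of continuous strictly increasing functions $\varphi:(0,\infty)\to(0,\infty)$ with $\varphi(1)=1$, $\lim_{t\to0+}\varphi(t)=0$, $\lim_{t\to\infty}\varphi(t)=\infty$; $\mathcal{D}$ is the class of continuous strictly decreasing functions $\varphi:(0,\infty)\to(0,\infty)$ with $\varphi(1)=1$, $\lim_{t\to0+}\varphi(t)=\infty$, $\lim_{t\to\infty}\varphi(t)=0$. For $f\in C^+(\Omega)$, the Aleksandrov body of $f$ is $[f]=\bigcap_{u\in\Omega}\{x\in\mathbb{R}^n:\langle x,u\rangle\le f(u)\}$, which belongs to $\mathcal{K}_o^n$, the class of compact convex sets in $\mathbb{R}^n$ containing the origin in their interiors. Integration on $S^{n-1}$ is with respect to $du=d\mathcal{H}^{n-1}(u)$. For $K\in\mathcal{K}_o^n$: $h_K(u)=\sup_{x\in K}\langle u,x\rangle$; $\rho_K(u)=\sup\{\lambda>0:\lambda u\in K\}$; the general dual volume is $\widetilde{V}_G(K)=\int_{S^{n-1}}G(\rho_K(u),u)\,du$; $H(K,u)=\{x:\langle x,u\rangle=h_K(u)\}$; and for $E\subset S^{n-1}$, $\boldsymbol{\alpha}_K^*(E)=\{x/|x|:x\in\partial K\cap H(K,u)\text{ for some }u\in E\}$. The finite signed Borel measure $\widetilde{C}_G(K,\cdot)$ on $S^{n-1}$ is given by $$\widetilde{C}_G(K,E)=\frac1n\int_{\boldsymbol{\alpha}_K^*(E)}\rho_K(u)\,G_t(\rho_K(u),u)\,du$$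 for Borel sets $E\subset S^{n-1}$. *)

theory Defs
  imports "HOL-Analysis.Analysis"
begin

text \<open>
  The \<open>m\<close>-dimensional Hausdorff measure, normalized so that it agrees with Lebesgue measure
  in \<open>m\<close>-dimensional Euclidean space. The empty set gets size \<open>0\<close> also for \<open>m = 0\<close> (where
  \<open>0 ^ 0 = 1\<close>), so the case \<open>m = 0\<close> is counting measure. Covering sets have to be bounded
  because \<^const>\<open>diameter\<close> is unspecified on unbounded sets.
\<close>

definition hausdorff_size :: "nat \<Rightarrow> 'a::metric_space set \<Rightarrow> ennreal" where
  "hausdorff_size m C =
     (if C = {} then 0 else ennreal (unit_ball_vol (real m) / 2 ^ m * diameter C ^ m))"

definition hausdorff_outer :: "nat \<Rightarrow> 'a::metric_space set \<Rightarrow> ennreal" where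
  "hausdorff_outer m A =
     (SUP \<delta>\<in>{0<..}.
        INF C\<in>{C :: nat \<Rightarrow> 'a set. A \<subseteq> (\<Union>i. C i) \<and> (\<forall>i. bounded (C i) \<and> diameter (C i) \<le> \<delta>)}.
          \<Sum>i. hausdorff_size m (C i))"

text \<open>
  The measure lives on the Caratheodory-measurable sets, so it is complete. This is needed
  because the images of Borel sets under \<open>radial_gauss_image\<close> below are in general
  only measurable up to null sets.
\<close>

definition hausdorff_measure :: "nat \<Rightarrow> 'a::metric_space measure" where
  "hausdorff_measure m =
     measure_of UNIV (lambda_system UNIV UNIV (hausdorff_outer m)) (hausdorff_outer m)"


text \<open>
  A finite signed measure on a measurable space \<open>M\<close> is a real-valued set function \<open>\<nu>\<close>
  (only its values on \<^term>\<open>sets M\<close> matter). Integration is via the Jordan decomposition: the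
  positive part of \<open>\<nu>\<close> is \<open>E \<mapsto> sup {\<nu> F | F \<subseteq> E measurable}\<close>, the negative
  part of \<open>\<nu>\<close> is the positive part of \<open>- \<nu>\<close>. Since \<open>\<nu> {} = 0\<close>, it does not matter that
  \<^const>\<open>ennreal\<close> truncates negative values to \<open>0\<close>.
\<close>

definition jordan_pos :: "'a measure \<Rightarrow> ('a set \<Rightarrow> real) \<Rightarrow> 'a measure" where
  "jordan_pos M \<nu> =
     measure_of (space M) (sets M) (\<lambda>E. SUP F\<in>{F \<in> sets M. F \<subseteq> E}. ennreal (\<nu> F))"

definition jordan_neg :: "'a measure \<Rightarrow> ('a set \<Rightarrow> real) \<Rightarrow> 'a measure" where
  "jordan_neg M \<nu> = jordan_pos M (\<lambda>E. - \<nu> E)"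

definition signed_set_integral ::
    "'a measure \<Rightarrow> ('a set \<Rightarrow> real) \<Rightarrow> 'a set \<Rightarrow> ('a \<Rightarrow> real) \<Rightarrow> real" where
  "signed_set_integral M \<nu> A f =
     (LINT u:A|jordan_pos M \<nu>. f u) - (LINT u:A|jordan_neg M \<nu>. f u)"


definition support_fun :: "'a::euclidean_space set \<Rightarrow> 'a \<Rightarrow> real" where
  "support_fun K u = (SUP x\<in>K. u \<bullet> x)"

definition radial_fun :: "'a::euclidean_space set \<Rightarrow> 'a \<Rightarrow> real" where
  "radial_fun K u = Sup {r. r > 0 \<and> r *\<^sub>R u \<in> K}"

definition support_hyperplane :: "'a::euclidean_space set \<Rightarrow> 'a \<Rightarrow> 'a set" where
  "support_hyperplane K u = {x. x \<bullet> u = support_fun K u}"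

definition radial_gauss_image :: "'a::euclidean_space set \<Rightarrow> 'a set \<Rightarrow> 'a set" where
  "radial_gauss_image K E =
     {(1 / norm x) *\<^sub>R x |x. \<exists>u\<in>E. x \<in> frontier K \<inter> support_hyperplane K u}"

definition gen_dual_volume ::
    "(real \<Rightarrow> 'a \<Rightarrow> real) \<Rightarrow> 'a::euclidean_space set \<Rightarrow> real" where
  "gen_dual_volume G K = (LINT u:sphere 0 1|hausdorff_measure (DIM('a) - 1). G (radial_fun K u) u)"

definition partial_t :: "(real \<Rightarrow> 'a \<Rightarrow> real) \<Rightarrow> real \<Rightarrow> 'a \<Rightarrow> real" where
  "partial_t G t u = deriv (\<lambda>s. G s u) t"

definition gen_dual_curvature ::
    "(real \<Rightarrow> 'a \<Rightarrow> real) \<Rightarrow> 'a::euclidean_space set \<Rightarrow> 'a set \<Rightarrow> real" where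
  "gen_dual_curvature G K E =
     1 / real DIM('a) *
       (LINT u:radial_gauss_image K E|hausdorff_measure (DIM('a) - 1).
          radial_fun K u * partial_t G (radial_fun K u) u)"


definition pos_continuous :: "'a::topological_space set \<Rightarrow> ('a \<Rightarrow> real) set" where
  "pos_continuous \<Omega> = {f. continuous_on \<Omega> f \<and> (\<forall>u\<in>\<Omega>. f u > 0)}"

definition aleksandrov_body :: "'a::euclidean_space set \<Rightarrow> ('a \<Rightarrow> real) \<Rightarrow> 'a set" where
  "aleksandrov_body \<Omega> f = (\<Inter>u\<in>\<Omega>. {x. x \<bullet> u \<le> f u})"

definition class_I :: "(real \<Rightarrow> real) set" where
  "class_I = {\<phi>. \<phi> \<in> {0<..} \<rightarrow> {0<..} \<and> continuous_on {0<..} \<phi> \<and> strict_mono_on {0<..} \<phi> \<and>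
     \<phi> 1 = 1 \<and> (\<phi> \<longlongrightarrow> 0) (at_right 0) \<and> filterlim \<phi> at_top at_top}"

definition class_D :: "(real \<Rightarrow> real) set" where
  "class_D = {\<phi>. \<phi> \<in> {0<..} \<rightarrow> {0<..} \<and> continuous_on {0<..} \<phi> \<and> strict_antimono_on {0<..} \<phi> \<and>
     \<phi> 1 = 1 \<and> filterlim \<phi> at_top (at_right 0) \<and> (\<phi> \<longlongrightarrow> 0) at_top}"

text \<open>\<open>h\<close> is a member of \<^term>\<open>pos_continuous \<Omega>\<close> solving the equation that determines
  \<open>h\<^sub>\<epsilon>\<close>. Functions are total, so it is determined on \<open>\<Omega>\<close> only.\<close>

definition orlicz_perturbation ::
    "'a::euclidean_space set \<Rightarrow> (real \<Rightarrow> real) \<Rightarrow> (real \<Rightarrow> real) \<Rightarrow> ('a \<Rightarrow> real) \<Rightarrow> ('a \<Rightarrow> real) \<Rightarrow>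
     real \<Rightarrow> ('a \<Rightarrow> real) \<Rightarrow> bool" where
  "orlicz_perturbation \<Omega> \<phi>1 \<phi>2 h1 h2 \<epsilon> h \<longleftrightarrow>
     h \<in> pos_continuous \<Omega> \<and> (\<forall>u\<in>\<Omega>. \<phi>1 (h1 u / h u) + \<epsilon> * \<phi>2 (h2 u / h u) = 1)"

end

theory Submission
  imports Defs
begin

text \<open>
  By definition, the radial function of the Aleksandrov body of \<open>f\<close> is \<open>\<rho> = 1 / N\<close>, where the gauge
  function \<open>N u\<close> is the maximum of \<open>\<langle>u, v\<rangle> / f v\<close> over \<open>v \<in> \<Omega>\<close>. The dual volume is the integral of
  \<open>G (1 / N u) u\<close> over the sphere, so its derivative along a family of functions follows from the
  derivative of a maximum with respect to a parameter. Three facts make this work.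

  First, the reciprocals of the perturbed functions satisfy
  \<open>h1 / h\<^sub>\<epsilon> = 1 - \<epsilon> * \<phi>2 (h2 / h1) / deriv \<phi>1 1 + o(\<epsilon>)\<close> uniformly on \<open>\<Omega>\<close>
  (\<open>orlicz_perturbation_asymptotics\<close>). This comes from the mean value theorem.

  Second, for almost every direction \<open>u\<close> the maximum in \<open>N u\<close> is attained at a single \<open>v\<close>, and this
  \<open>v = \<alpha> u\<close> is the only outer normal of the body at its boundary point in the direction \<open>u\<close>. By
  Danskin's theorem (\<open>danskin_quotient\<close>) the derivative of \<open>log \<rho>\<close> at \<open>u\<close> is then the value of
  \<open>\<phi>2 (h2 / h1) / deriv \<phi>1 1\<close> at \<open>\<alpha> u\<close>. Dominated convergence yields the derivative of the dual
  volume as an integral over the sphere (\<open>gen_dual_volume_variation\<close>). The directions with several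
  maximizers are those where the convex function \<open>N\<close> is not differentiable. They form a cone that is
  Lebesgue null by a translation argument: a line contains a bounded number of kinks of a given size
  (\<open>negligible_kinks\<close>). An elementary averaging over concentric spheres transfers this to the Hausdorff
  measure of the sphere (\<open>hausdorff_outer_le_lborel_shell\<close>), and it also shows that the sphere has
  finite measure.

  Third, the dual curvature measure is the image of a signed measure on the sphere under \<open>\<alpha>\<close>,
  so that integral over the sphere is the integral of \<open>\<phi>2 (h2 / h1)\<close> with respect to it
  (\<open>signed_set_integral_gen_dual_curvature\<close>). The Jordan decomposition of such an image is computed with
  the Radon-Nikodym theorem (\<open>signed_set_integral_distr\<close>).
\<close>

section \<open>Hausdorff measure as a metric outer measure\<close>

definition hausdorff_premeasure :: "nat \<Rightarrow> real \<Rightarrow> 'a::metric_space set \<Rightarrow> ennreal" where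
  "hausdorff_premeasure m \<delta> A =
     (INF C\<in>{C :: nat \<Rightarrow> 'a set. A \<subseteq> (\<Union>i. C i) \<and> (\<forall>i. bounded (C i) \<and> diameter (C i) \<le> \<delta>)}.
        \<Sum>i. hausdorff_size m (C i))"

lemma hausdorff_outer_eq_SUP:
  "hausdorff_outer m A = (SUP \<delta>\<in>{0<..}. hausdorff_premeasure m \<delta> A)"
  by (simp add: hausdorff_outer_def hausdorff_premeasure_def)

lemma hausdorff_premeasure_le:
  assumes "A \<subseteq> (\<Union>i. C i)" "\<And>i. bounded (C i)" "\<And>i. diameter (C i) \<le> \<delta>"
  shows "hausdorff_premeasure m \<delta> A \<le> (\<Sum>i. hausdorff_size m (C i))"
  unfolding hausdorff_premeasure_def using assms by (intro INF_lower) auto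

lemma hausdorff_premeasure_mono:
  "A \<subseteq> B \<Longrightarrow> hausdorff_premeasure m \<delta> A \<le> hausdorff_premeasure m \<delta> B"
  unfolding hausdorff_premeasure_def by (rule INF_superset_mono) auto

lemma hausdorff_premeasure_antimono:
  "\<delta> \<le> \<delta>' \<Longrightarrow> hausdorff_premeasure m \<delta>' A \<le> hausdorff_premeasure m \<delta> A"
  unfolding hausdorff_premeasure_def by (rule INF_superset_mono) (auto intro: order_trans)

lemma hausdorff_premeasure_empty: "\<delta> > 0 \<Longrightarrow> hausdorff_premeasure m \<delta> {} = 0"
  using hausdorff_premeasure_le[of "{}" "\<lambda>_. {}" \<delta> m]
  by (simp add: hausdorff_size_def)

text \<open>
  Almost optimal covers of the \<open>A k\<close>, with errors \<open>e / 2 ^ (k + 1)\<close>, are merged into one sequence by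
  enumerating pairs.
\<close>

lemma hausdorff_premeasure_UN_le:
  fixes A :: "nat \<Rightarrow> 'a::metric_space set"
  assumes "\<delta> > 0"
  shows "hausdorff_premeasure m \<delta> (\<Union>k. A k) \<le> (\<Sum>k. hausdorff_premeasure m \<delta> (A k))"
proof (rule ennreal_le_epsilon)
  fix e :: real assume fin: "(\<Sum>k. hausdorff_premeasure m \<delta> (A k)) < top" and e: "0 < e"
  have "\<exists>C. A k \<subseteq> (\<Union>i. C i) \<and> (\<forall>i. bounded (C i) \<and> diameter (C i) \<le> \<delta>) \<and>
      (\<Sum>i. hausdorff_size m (C i)) \<le> hausdorff_premeasure m \<delta> (A k) + ennreal (e * (1/2) ^ Suc k)" for k
  proof -
    have "hausdorff_premeasure m \<delta> (A k) < top"
      using fin by (metis ennreal_suminf_lessD)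
    then have "hausdorff_premeasure m \<delta> (A k) <
        hausdorff_premeasure m \<delta> (A k) + ennreal (e * (1/2) ^ Suc k)"
      using e by (simp add: ennreal_less_zero_iff ennreal_zero_less_mult_iff)
    then show ?thesis
      unfolding hausdorff_premeasure_def INF_less_iff by (auto intro: less_imp_le)
  qed
  then obtain C where C: "\<And>k. A k \<subseteq> (\<Union>i. C k i)" "\<And>k i. bounded (C k i)"
      "\<And>k i. diameter (C k i) \<le> \<delta>"
      "\<And>k. (\<Sum>i. hausdorff_size m (C k i)) \<le>
         hausdorff_premeasure m \<delta> (A k) + ennreal (e * (1/2) ^ Suc k)"
    by metis
  have "(\<Union>k. A k) \<subseteq> (\<Union>j. case_prod C (prod_decode j))"
  proof
    fix x assume "x \<in> (\<Union>k. A k)"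
    then obtain k i where "x \<in> C k i" using C(1) by blast
    then have "x \<in> case_prod C (prod_decode (prod_encode (k, i)))" by simp
    then show "x \<in> (\<Union>j. case_prod C (prod_decode j))" by (rule UN_I[OF UNIV_I])
  qed
  then have "hausdorff_premeasure m \<delta> (\<Union>k. A k) \<le>
      (\<Sum>j. hausdorff_size m (case_prod C (prod_decode j)))"
    by (rule hausdorff_premeasure_le) (auto simp: C split: prod.split)
  also have "\<dots> = (\<Sum>k. \<Sum>i. hausdorff_size m (C k i))"
    using suminf_ennreal_2dimen[where f = "\<lambda>p. hausdorff_size m (case_prod C p)"] by simp
  also have "\<dots> \<le> (\<Sum>k. hausdorff_premeasure m \<delta> (A k) + ennreal (e * (1/2) ^ Suc k))"
    by (intro suminf_le C) auto
  also have "\<dots> = (\<Sum>k. hausdorff_premeasure m \<delta> (A k)) + (\<Sum>k. ennreal (e * (1/2) ^ Suc k))"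
    by (intro suminf_add[symmetric]) auto
  also have "(\<Sum>k. ennreal (e * (1/2) ^ Suc k)) = ennreal e"
    using e sums_mult[OF power_half_series, of e] by (intro suminf_ennreal_eq) auto
  finally show "hausdorff_premeasure m \<delta> (\<Union>k. A k) \<le>
      (\<Sum>k. hausdorff_premeasure m \<delta> (A k)) + ennreal e" .
qed

lemma hausdorff_outer_empty: "hausdorff_outer m {} = 0"
  unfolding hausdorff_outer_eq_SUP
  by (rule antisym) (auto intro!: SUP_least simp: hausdorff_premeasure_empty)

lemma hausdorff_outer_mono: "A \<subseteq> B \<Longrightarrow> hausdorff_outer m A \<le> hausdorff_outer m B"
  unfolding hausdorff_outer_eq_SUP
  by (intro SUP_mono) (auto intro: hausdorff_premeasure_mono)

lemma hausdorff_outer_UN_le: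
  fixes A :: "nat \<Rightarrow> 'a::metric_space set"
  shows "hausdorff_outer m (\<Union>k. A k) \<le> (\<Sum>k. hausdorff_outer m (A k))"
  unfolding hausdorff_outer_eq_SUP[of m "\<Union>k. A k"]
proof (rule SUP_least)
  fix \<delta> :: real assume "\<delta> \<in> {0<..}"
  then have "hausdorff_premeasure m \<delta> (\<Union>k. A k) \<le> (\<Sum>k. hausdorff_premeasure m \<delta> (A k))"
    by (intro hausdorff_premeasure_UN_le) auto
  also have "\<dots> \<le> (\<Sum>k. hausdorff_outer m (A k))"
    unfolding hausdorff_outer_eq_SUP using \<open>\<delta> \<in> {0<..}\<close>
    by (intro suminf_le SUP_upper) auto
  finally show "hausdorff_premeasure m \<delta> (\<Union>k. A k) \<le> (\<Sum>k. hausdorff_outer m (A k))" .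
qed

lemma hausdorff_outer_Un_le:
  "hausdorff_outer m (A \<union> B) \<le> hausdorff_outer m A + hausdorff_outer m B"
proof -
  let ?C = "\<lambda>k. if k = 0 then A else if k = Suc 0 then B else {}"
  have "A \<union> B \<subseteq> (\<Union>k. ?C k)"
    by (auto split: if_splits)
  then have "hausdorff_outer m (A \<union> B) \<le> hausdorff_outer m (\<Union>k. ?C k)"
    by (rule hausdorff_outer_mono)
  also have "\<dots> \<le> (\<Sum>k. hausdorff_outer m (?C k))"
    by (rule hausdorff_outer_UN_le)
  also have "\<dots> = (\<Sum>k\<in>{0,1}. hausdorff_outer m (?C k))"
    by (intro suminf_finite) (auto simp: hausdorff_outer_empty)
  finally show ?thesis by simp
qed

lemma outer_measure_space_hausdorff: "outer_measure_space UNIV (hausdorff_outer m)"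
  unfolding outer_measure_space_def positive_def increasing_def countably_subadditive_def
  using hausdorff_outer_empty hausdorff_outer_mono hausdorff_outer_UN_le by auto

lemma measure_space_hausdorff:
  "measure_space UNIV (lambda_system UNIV UNIV (hausdorff_outer m)) (hausdorff_outer m)"
proof -
  interpret sigma_algebra UNIV "UNIV :: 'a set set"
    by (metis Pow_UNIV sigma_algebra_Pow)
  show ?thesis
    by (rule caratheodory_lemma[OF outer_measure_space_hausdorff])
qed

lemma space_hausdorff_measure [simp]: "space (hausdorff_measure m) = UNIV"
  by (simp add: hausdorff_measure_def space_measure_of_conv)

lemma sets_hausdorff_measure:
  "sets (hausdorff_measure m :: 'a::metric_space measure) =
     lambda_system UNIV UNIV (hausdorff_outer m)" (is "_ = ?L")
proof -
  have sa: "sigma_algebra UNIV ?L"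
    using measure_space_hausdorff[of m, where 'a = 'a] by (simp add: measure_space_def)
  have "sets (hausdorff_measure m :: 'a measure) = sigma_sets UNIV ?L"
    unfolding hausdorff_measure_def by (simp add: sets_measure_of_conv)
  also have "\<dots> = ?L"
    by (rule sigma_algebra.sigma_sets_eq[OF sa])
  finally show ?thesis .
qed

lemma emeasure_hausdorff_measure:
  assumes "A \<in> sets (hausdorff_measure m)"
  shows "emeasure (hausdorff_measure m) A = hausdorff_outer m A"
proof -
  have "measure_space UNIV (lambda_system UNIV UNIV (hausdorff_outer m)) (hausdorff_outer m)"
    by (rule measure_space_hausdorff)
  then show ?thesis
    using assms[unfolded sets_hausdorff_measure] unfolding hausdorff_measure_def
    by (intro emeasure_measure_of_sigma) (auto simp: measure_space_def)
qed

lemma sets_hausdorff_measureI: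
  assumes "\<And>T. hausdorff_outer m (T \<inter> C) + hausdorff_outer m (T - C) \<le> hausdorff_outer m T"
  shows "C \<in> sets (hausdorff_measure m)"
proof -
  have "hausdorff_outer m (C \<inter> T) + hausdorff_outer m ((UNIV - C) \<inter> T) = hausdorff_outer m T" for T
  proof (rule antisym)
    show "hausdorff_outer m (C \<inter> T) + hausdorff_outer m ((UNIV - C) \<inter> T) \<le> hausdorff_outer m T"
      using assms[of T] by (simp add: Int_commute[of C T] Diff_eq Int_commute[of "- C" T])
    have "hausdorff_outer m T \<le> hausdorff_outer m ((C \<inter> T) \<union> ((UNIV - C) \<inter> T))"
      by (rule hausdorff_outer_mono) auto
    also have "\<dots> \<le> hausdorff_outer m (C \<inter> T) + hausdorff_outer m ((UNIV - C) \<inter> T)"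
      by (rule hausdorff_outer_Un_le)
    finally show "hausdorff_outer m T \<le> hausdorff_outer m (C \<inter> T) + hausdorff_outer m ((UNIV - C) \<inter> T)" .
  qed
  then show ?thesis
    by (simp add: sets_hausdorff_measure lambda_system_def)
qed

lemma hausdorff_outer_null_sets:
  assumes "hausdorff_outer m A = 0"
  shows "A \<in> null_sets (hausdorff_measure m)"
proof -
  have "hausdorff_outer m (T \<inter> A) = 0" for T
    using hausdorff_outer_mono[of "T \<inter> A" A m] assms by simp
  then have "A \<in> sets (hausdorff_measure m)"
    by (intro sets_hausdorff_measureI) (auto intro: hausdorff_outer_mono)
  then show ?thesis
    using assms by (auto simp: null_sets_def emeasure_hausdorff_measure)
qed

text \<open>
  A covering set of diameter below the distance of \<open>A\<close> and \<open>B\<close> meets at most one of the two, so a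
  fine cover of the union splits into a cover of \<open>A\<close> and a cover of \<open>B\<close>.
\<close>

lemma hausdorff_outer_Un_separated:
  assumes d: "d > 0" and AB: "\<And>a b. a \<in> A \<Longrightarrow> b \<in> B \<Longrightarrow> d \<le> dist a b"
  shows "hausdorff_outer m A + hausdorff_outer m B \<le> hausdorff_outer m (A \<union> B)"
proof -
  have *: "hausdorff_premeasure m \<delta> A + hausdorff_premeasure m \<delta> B \<le> hausdorff_outer m (A \<union> B)"
    if \<delta>: "\<delta> > 0" for \<delta>
  proof -
    define \<eta> where "\<eta> = min \<delta> (d/2)"
    have \<eta>: "\<eta> > 0" "\<eta> \<le> \<delta>" "\<eta> < d" using \<delta> d by (auto simp: \<eta>_def)
    have "hausdorff_premeasure m \<delta> A + hausdorff_premeasure m \<delta> B \<le>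
        hausdorff_premeasure m \<eta> (A \<union> B)"
      unfolding hausdorff_premeasure_def[of m \<eta>]
    proof (rule INF_greatest, safe)
      fix C :: "nat \<Rightarrow> 'a set"
      assume C: "A \<union> B \<subseteq> \<Union> (range C)" "\<forall>i. bounded (C i) \<and> diameter (C i) \<le> \<eta>"
      define CA where "CA = (\<lambda>i. if C i \<inter> A \<noteq> {} then C i else {})"
      define CB where "CB = (\<lambda>i. if C i \<inter> B \<noteq> {} then C i else {})"
      have sz: "hausdorff_size m (CA i) + hausdorff_size m (CB i) \<le> hausdorff_size m (C i)" for i
      proof (cases "C i \<inter> A \<noteq> {} \<and> C i \<inter> B \<noteq> {}")
        case True
        then obtain a b where "a \<in> C i" "a \<in> A" "b \<in> C i" "b \<in> B" by auto
        then have "d \<le> dist a b" "dist a b \<le> \<eta>"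
          using AB C diameter_bounded_bound[of "C i" a b] by (auto intro: order_trans)
        with \<eta> show ?thesis by simp
      qed (auto simp: CA_def CB_def hausdorff_size_def)
      have "hausdorff_premeasure m \<delta> A \<le> (\<Sum>i. hausdorff_size m (CA i))"
        using C \<eta> \<delta>
        by (intro hausdorff_premeasure_le) (fastforce simp: CA_def intro: order_trans)+
      moreover have "hausdorff_premeasure m \<delta> B \<le> (\<Sum>i. hausdorff_size m (CB i))"
        using C \<eta> \<delta>
        by (intro hausdorff_premeasure_le) (fastforce simp: CB_def intro: order_trans)+
      ultimately have "hausdorff_premeasure m \<delta> A + hausdorff_premeasure m \<delta> B \<le>
          (\<Sum>i. hausdorff_size m (CA i)) + (\<Sum>i. hausdorff_size m (CB i))"
        by (rule add_mono)
      also have "\<dots> = (\<Sum>i. hausdorff_size m (CA i) + hausdorff_size m (CB i))"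
        by (rule suminf_add) auto
      also have "\<dots> \<le> (\<Sum>i. hausdorff_size m (C i))"
        by (intro suminf_le sz) auto
      finally show "hausdorff_premeasure m \<delta> A + hausdorff_premeasure m \<delta> B \<le>
          (\<Sum>i. hausdorff_size m (C i))" .
    qed
    also have "\<dots> \<le> hausdorff_outer m (A \<union> B)"
      unfolding hausdorff_outer_eq_SUP using \<eta> by (intro SUP_upper) auto
    finally show ?thesis .
  qed
  have "(SUP \<delta>\<in>{0<..}. hausdorff_premeasure m \<delta> A + hausdorff_premeasure m \<delta> B) =
      hausdorff_outer m A + hausdorff_outer m B"
    unfolding hausdorff_outer_eq_SUP[of m A] hausdorff_outer_eq_SUP[of m B]
  proof (rule SUP_add_directed_ennreal)
    fix i j :: real assume "i \<in> {0<..}" "j \<in> {0<..}"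
    then show "\<exists>k\<in>{0<..}. hausdorff_premeasure m i A + hausdorff_premeasure m j B \<le>
        hausdorff_premeasure m k A + hausdorff_premeasure m k B"
      by (intro bexI[of _ "min i j"] add_mono hausdorff_premeasure_antimono) auto
  qed
  moreover have "(SUP \<delta>\<in>{0<..}. hausdorff_premeasure m \<delta> A + hausdorff_premeasure m \<delta> B) \<le>
      hausdorff_outer m (A \<union> B)"
    by (rule SUP_least) (use * in auto)
  ultimately show ?thesis by simp
qed

text \<open>
  Caratheodory's argument: the points of \<open>T - C\<close> are split into shells \<open>R k\<close> according to their
  distance to \<open>C\<close>. Shells of the same parity are at positive distance from each other, hence the
  measures of all shells have a finite sum, and the part of \<open>T - C\<close> within distance \<open>1 / (k + 1)\<close> of
  \<open>C\<close>, which is the union of a tail of the shells, has measure tending to zero.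
\<close>

lemma closed_in_sets_hausdorff_measure:
  fixes C :: "'a::metric_space set"
  assumes "closed C"
  shows "C \<in> sets (hausdorff_measure m)"
proof (cases "C = {}")
  case False
  show ?thesis
  proof (rule sets_hausdorff_measureI)
    fix T :: "'a set"
    let ?H = "hausdorff_outer m :: 'a set \<Rightarrow> ennreal"
    show "?H (T \<inter> C) + ?H (T - C) \<le> ?H T"
    proof (cases "?H T = top")
      case finT: False
      define R where "R = (\<lambda>k. {x\<in>T. 1 / real (k + 2) \<le> infdist x C \<and> infdist x C < 1 / real (k + 1)})"
      define T' where "T' = (\<lambda>k. {x\<in>T. 1 / real (k + 1) \<le> infdist x C})"
      have infdist_diff: "infdist x C - infdist y C \<le> dist x y" for x y
        using infdist_triangle[of x C y] by simp
      have parity: "(\<Sum>j<n. ?H (R (2 * j + e))) \<le> ?H (\<Union>j<n. R (2 * j + e))" for n e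
      proof (induction n)
        case 0 then show ?case by simp
      next
        case (Suc n)
        define d where "d = 1 / real (2 * n + e) - 1 / real (2 * n + e + 1)"
        have "?H (\<Union>j<n. R (2 * j + e)) + ?H (R (2 * n + e)) \<le>
            ?H ((\<Union>j<n. R (2 * j + e)) \<union> R (2 * n + e))"
        \<comment> \<open>for \<open>n = 0\<close> the union is empty, and \<open>d\<close> may involve a division by zero\<close>
        proof (cases "n = 0")
          case True then show ?thesis by (simp add: hausdorff_outer_empty)
        next
          case False
          have "1 / real (2 * n + e + 1) < 1 / real (2 * n + e)"
            using False by (intro divide_strict_left_mono mult_pos_pos) auto
          then have "d > 0" by (simp add: d_def)
          then show ?thesis
          proof (rule hausdorff_outer_Un_separated)
            fix a b assume "a \<in> (\<Union>j<n. R (2 * j + e))" "b \<in> R (2 * n + e)"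
            then obtain j where j: "j < n" "1 / real (2 * j + e + 2) \<le> infdist a C"
              "infdist b C < 1 / real (2 * n + e + 1)"
              by (auto simp: R_def)
            have "1 / real (2 * n + e) \<le> 1 / real (2 * j + e + 2)"
              using j(1) by (intro divide_left_mono) auto
            then show "d \<le> dist a b"
              using j infdist_diff[of a b] by (simp add: d_def)
          qed
        qed
        then show ?case
          using Suc by (simp add: lessThan_Suc Un_commute add.commute) (meson add_left_mono order_trans)
      qed
      have parity_le: "(\<Sum>j<n. ?H (R (2 * j + e))) \<le> ?H T" for n e
        by (rule order_trans[OF parity hausdorff_outer_mono]) (auto simp: R_def)
      have "(\<Sum>k<n. ?H (R k)) \<le> 2 * ?H T" for n
      proof -
        have "(\<Sum>k<n. ?H (R k)) \<le> (\<Sum>k<2*n. ?H (R k))"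
          by (rule sum_mono2) auto
        also have "\<dots> = (\<Sum>j<n. ?H (R (2 * j + 0))) + (\<Sum>j<n. ?H (R (2 * j + 1)))"
          by (induction n) (simp_all add: ac_simps)
        also have "\<dots> \<le> ?H T + ?H T"
          by (intro add_mono parity_le)
        finally show ?thesis by (simp add: mult_2)
      qed
      then have "(\<Sum>k. ?H (R k)) \<le> 2 * ?H T"
        by (intro suminf_le_const) auto
      also have "\<dots> < top"
        using finT by (simp add: ennreal_mult_less_top less_top)
      finally have fin: "(\<Sum>k. ?H (R k)) < top" .
      define r where "r = (\<lambda>k. enn2real (?H (R k)))"
      have r: "?H (R k) = ennreal (r k)" "r k \<ge> 0" for k
        using ennreal_suminf_lessD[OF fin, of k] by (auto simp: r_def)
      have "summable r"
        using fin by (intro summable_suminf_not_top) (auto simp: r)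
      have sep: "?H (T \<inter> C) + ?H (T' k) \<le> ?H T" for k
      proof -
        have "?H (T \<inter> C) + ?H (T' k) \<le> ?H ((T \<inter> C) \<union> T' k)"
        proof (rule hausdorff_outer_Un_separated[of "1 / real (k + 1)"])
          fix a b assume "a \<in> T \<inter> C" "b \<in> T' k"
          then show "1 / real (k + 1) \<le> dist a b"
            using infdist_diff[of b a] by (auto simp: T'_def dist_commute)
        qed auto
        also have "\<dots> \<le> ?H T"
          by (rule hausdorff_outer_mono) (auto simp: T'_def)
        finally show ?thesis .
      qed
      show ?thesis
      proof (rule ennreal_le_epsilon)
        fix e :: real assume "e > 0"
        obtain k where "norm (\<Sum>j. r (j + k)) < e"
          using suminf_exist_split[OF \<open>e > 0\<close> \<open>summable r\<close>] by blast
        moreover have "summable (\<lambda>j. r (j + k))"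
          using \<open>summable r\<close> by (simp add: summable_iff_shift)
        ultimately have tail: "(\<Sum>j. ?H (R (j + k))) \<le> ennreal e"
          by (simp add: r suminf_ennreal2 suminf_nonneg ennreal_leI)
        have "T - C \<subseteq> T' k \<union> (\<Union>j. R (j + k))"
        proof
          fix x assume x: "x \<in> T - C"
          then have pos: "infdist x C > 0"
            using assms False in_closed_iff_infdist_zero[of C x] infdist_nonneg[of x C] by force
          show "x \<in> T' k \<union> (\<Union>j. R (j + k))"
          proof (cases "x \<in> T' k")
            case notT': False
            define n where "n = (LEAST n. 1 / real (n + 1) \<le> infdist x C)"
            have "\<exists>n. 1 / real (n + 1) \<le> infdist x C"
              using reals_Archimedean[OF pos] by (auto simp: field_simps intro!: less_imp_le)
            then have n: "1 / real (n + 1) \<le> infdist x C" "\<And>i. i < n \<Longrightarrow> infdist x C < 1 / real (i + 1)"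
              unfolding n_def by (rule LeastI_ex) (use not_less_Least not_le in blast)
            have "k < n"
            proof (rule ccontr)
              assume "\<not> k < n"
              then have "1 / real (k + 1) \<le> 1 / real (n + 1)" by (intro divide_left_mono) auto
              with n(1) notT' x show False by (auto simp: T'_def)
            qed
            then have "x \<in> R (n - 1)"
              using n(1) n(2)[of "n - 1"] x by (simp add: R_def)
            moreover have "n - 1 = (n - 1 - k) + k" using \<open>k < n\<close> by simp
            ultimately show ?thesis by (metis UN_I UNIV_I UnI2)
          qed simp
        qed
        then have "?H (T - C) \<le> ?H (T' k \<union> (\<Union>j. R (j + k)))"
          by (rule hausdorff_outer_mono)
        also have "\<dots> \<le> ?H (T' k) + ?H (\<Union>j. R (j + k))"
          by (rule hausdorff_outer_Un_le)
        also have "\<dots> \<le> ?H (T' k) + ennreal e"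
          by (intro add_left_mono order_trans[OF hausdorff_outer_UN_le tail])
        finally have "?H (T \<inter> C) + ?H (T - C) \<le> ?H (T \<inter> C) + (?H (T' k) + ennreal e)"
          by (rule add_left_mono)
        also have "\<dots> \<le> ?H T + ennreal e"
          using sep[of k] by (metis add.assoc add_right_mono)
        finally show "?H (T \<inter> C) + ?H (T - C) \<le> ?H T + ennreal e" .
      qed
    qed simp
  qed
qed simp

lemma sets_borel_subset_hausdorff: "sets borel \<subseteq> sets (hausdorff_measure m)"
proof -
  have "sigma_sets UNIV {C. closed C} \<subseteq> sets (hausdorff_measure m)"
    by (rule sets.sigma_sets_subset[where M = "hausdorff_measure m", simplified])
       (auto intro: closed_in_sets_hausdorff_measure)
  then show ?thesis
    by (simp add: borel_eq_closed)
qed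

section \<open>Spherical measure and volumes of shells\<close>

text \<open>
  The shell over \<open>A\<close> between the radii \<open>1\<close> and \<open>2\<close> is covered by small dyadic cubes inside \<open>U\<close> with
  total volume at most that of \<open>U\<close>. For every radius \<open>t\<close> the cubes, intersected with the sphere of
  radius \<open>t\<close> and scaled back to the unit sphere, form a cover of \<open>A\<close>. A cube of diameter \<open>d\<close> costs at
  most a constant times \<open>d ^ (n - 1)\<close> in this cover, and only for radii in an interval of length
  \<open>2 * d\<close>. Averaging the total cost over \<open>t\<close> therefore gives a multiple of the sum of the \<open>d ^ n\<close>,
  which is comparable to the total volume. The finiteness of the measure of the sphere and the null
  sets on it are both obtained from this estimate.
\<close>

lemma hausdorff_outer_le_lborel_shell:
  fixes A U :: "'a::euclidean_space set"
  assumes A: "A \<subseteq> sphere 0 1" and "open U"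
    and shell: "\<And>t u. t \<in> {1..2} \<Longrightarrow> u \<in> A \<Longrightarrow> t *\<^sub>R u \<in> U"
  shows "hausdorff_outer (DIM('a) - 1) A \<le>
    ennreal (2 * unit_ball_vol (real (DIM('a) - 1)) / 2 ^ (DIM('a) - 1) * real DIM('a) ^ DIM('a)) * emeasure lborel U"
  (is "_ \<le> ?c * _")
  unfolding hausdorff_outer_eq_SUP
proof (rule SUP_least)
  fix \<delta> :: real assume "\<delta> \<in> {0<..}"
  then have \<delta>: "\<delta> > 0" by simp
  define m where "m = DIM('a) - 1"
  have m: "Suc m = DIM('a)" by (simp add: m_def)
  define \<kappa> where "\<kappa> = unit_ball_vol (real m) / 2 ^ m"
  have \<kappa>: "\<kappa> \<ge> 0" by (simp add: \<kappa>_def)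
  define T where "T = {t *\<^sub>R u |t u. t \<in> {1..2} \<and> u \<in> A}"
  define g where "g = (\<lambda>x. if x \<in> U then ball x (\<delta>/2) \<inter> U else ball x 1)"
  define a :: 'a where "a = (-3) *\<^sub>R One"
  define b :: 'a where "b = 3 *\<^sub>R One"
  have ab: "a \<bullet> i = -3" "b \<bullet> i = 3" if "i \<in> Basis" for i
    using that by (simp_all add: a_def b_def)
  have Tab: "T \<subseteq> cbox a b"
  proof
    fix x assume "x \<in> T"
    then have "norm x \<le> 2" using A by (auto simp: T_def)
    then have "\<bar>x \<bullet> i\<bar> \<le> 2" if "i \<in> Basis" for i
      using Basis_le_norm[OF that, of x] by simp
    then show "x \<in> cbox a b"
      by (force simp: mem_box ab abs_le_iff)
  qed
  have box: "box a b \<noteq> {}" by (simp add: box_ne_empty ab)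
  have gauge: "gauge g"
    using \<delta> \<open>open U\<close> by (auto simp: gauge_def g_def)
  obtain D where D: "countable D" "\<Union>D \<subseteq> cbox a b"
    "\<And>K. K \<in> D \<Longrightarrow> interior K \<noteq> {} \<and> (\<exists>c d. K = cbox c d)"
    "pairwise (\<lambda>A B. interior A \<inter> interior B = {}) D"
    "\<And>K. K \<in> D \<Longrightarrow> \<exists>x\<in>T \<inter> K. K \<subseteq> g x"
    "\<And>u v. cbox u v \<in> D \<Longrightarrow> \<exists>n. \<forall>i\<in>Basis. v \<bullet> i - u \<bullet> i = (b \<bullet> i - a \<bullet> i) / 2 ^ n"
    "T \<subseteq> \<Union>D"
    by (rule covering_lemma[OF Tab box gauge], rule that)
  have DU: "K \<subseteq> U" "diameter K \<le> \<delta>" if K: "K \<in> D" for K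
  proof -
    obtain x where x: "x \<in> T" "K \<subseteq> g x" using D(5)[OF K] by auto
    have "x \<in> U" using x shell by (auto simp: T_def)
    then have "K \<subseteq> U" "K \<subseteq> ball x (\<delta>/2)" using x by (auto simp: g_def)
    moreover have "diameter K \<le> diameter (ball x (\<delta>/2))"
      using calculation by (intro diameter_subset) auto
    ultimately show "K \<subseteq> U" "diameter K \<le> \<delta>" using \<delta> by auto
  qed
  \<comment> \<open>an enumeration of the cubes without repetitions, padded with empty sets, so that volumes can be added\<close>
  define C where "C = (\<lambda>i. if i \<in> to_nat_on D ` D then from_nat_into D i else {})"
  have C_cases: "C i = {} \<or> C i \<in> D" for i
    using D(1) by (auto simp: C_def)
  have C_cover: "\<exists>i. C i = K" if "K \<in> D" for K
    using that D(1) by (intro exI[of _ "to_nat_on D K"]) (auto simp: C_def)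
  have C_disj: "disjoint_family (\<lambda>i. interior (C i))"
    unfolding disjoint_family_on_def
  proof safe
    fix i j x assume "i \<noteq> j" and x: "x \<in> interior (C i)" "x \<in> interior (C j)"
    then have ij: "i \<in> to_nat_on D ` D" "j \<in> to_nat_on D ` D"
      by (auto simp: C_def split: if_splits)
    then have "C i \<in> D" "C j \<in> D" "C i \<noteq> C j"
      using \<open>i \<noteq> j\<close> D(1) by (auto simp: C_def)
    then show "x \<in> {}" using D(4) x by (auto simp: pairwise_def)
  qed
  have bounded_C: "bounded (C i)" for i
    using C_cases[of i] D(3)[of "C i"] by auto
  define d where "d = (\<lambda>i. diameter (C i))"
  have d_nonneg: "d i \<ge> 0" for i
    using diameter_ge_0[OF bounded_C] by (simp add: d_def)
  have vol: "C i \<in> sets lborel \<and> emeasure lborel (C i) = emeasure lborel (interior (C i)) \<and>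
      ennreal (d i ^ Suc m) \<le> ennreal (real DIM('a) ^ DIM('a)) * emeasure lborel (C i)" for i
  proof (cases "C i = {}")
    case True
    then show ?thesis by (simp add: d_def)
  next
    case False
    then have "C i \<in> D" using C_cases by auto
    then obtain p q where pq: "C i = cbox p q" using D(3) by blast
    obtain n where "\<forall>i\<in>Basis. q \<bullet> i - p \<bullet> i = (b \<bullet> i - a \<bullet> i) / 2 ^ n"
      using D(6)[of p q] pq \<open>C i \<in> D\<close> by auto
    then have side: "(q - p) \<bullet> j = 6 / 2 ^ n" if "j \<in> Basis" for j
      using that by (simp add: ab inner_diff_left)
    define s :: real where "s = 6 / 2 ^ n"
    have "s > 0" by (simp add: s_def)
    have le: "\<forall>j\<in>Basis. p \<bullet> j \<le> q \<bullet> j"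
    proof
      fix j :: 'a assume "j \<in> Basis"
      then show "p \<bullet> j \<le> q \<bullet> j" using side[of j] \<open>s > 0\<close> unfolding s_def[symmetric]
        by (simp add: inner_diff_left)
    qed
    have "(\<Prod>j\<in>Basis. (q - p) \<bullet> j) = s ^ DIM('a)"
      using side by (simp add: s_def)
    then have v: "emeasure lborel (C i) = ennreal (s ^ DIM('a))"
        "emeasure lborel (interior (C i)) = ennreal (s ^ DIM('a))"
      using le by (simp_all add: pq interior_cbox emeasure_lborel_cbox_eq emeasure_lborel_box_eq)
    have "d i \<le> real DIM('a) * s"
      unfolding d_def
    proof (rule diameter_le)
      show "C i \<noteq> {} \<or> 0 \<le> real DIM('a) * s" using False by simp
      fix x y assume "x \<in> C i" "y \<in> C i"
      then have *: "\<bar>(x - y) \<bullet> j\<bar> \<le> s" if "j \<in> Basis" for j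
        using side[OF that] that unfolding pq mem_box s_def[symmetric]
        by (force simp: inner_diff_left abs_le_iff)
      have "norm (x - y) \<le> (\<Sum>j\<in>Basis. \<bar>(x - y) \<bullet> j\<bar>)" by (rule norm_le_l1)
      also have "\<dots> \<le> (\<Sum>j\<in>(Basis::'a set). s)" by (intro sum_mono *)
      finally show "norm (x - y) \<le> real DIM('a) * s" by simp
    qed
    then have "d i ^ Suc m \<le> (real DIM('a) * s) ^ DIM('a)"
      unfolding m by (intro power_mono d_nonneg)
    then have "ennreal (d i ^ Suc m) \<le> ennreal (real DIM('a) ^ DIM('a) * s ^ DIM('a))"
      by (intro ennreal_leI) (simp add: power_mult_distrib)
    moreover have "C i \<in> sets lborel" by (simp add: pq)
    ultimately show ?thesis
      using \<open>s > 0\<close> by (simp add: v ennreal_mult)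
  qed
  have sum_vol: "(\<Sum>i. emeasure lborel (C i)) \<le> emeasure lborel U"
  proof -
    have "(\<Sum>i. emeasure lborel (C i)) = (\<Sum>i. emeasure lborel (interior (C i)))"
      using vol by simp
    also have "\<dots> = emeasure lborel (\<Union>i. interior (C i))"
      by (rule suminf_emeasure[OF _ C_disj]) auto
    also have "\<dots> \<le> emeasure lborel U"
    proof (rule emeasure_mono)
      show "(\<Union>i. interior (C i)) \<subseteq> U"
        using DU(1) C_cases interior_subset by blast
    qed (use \<open>open U\<close> in auto)
    finally show ?thesis .
  qed
  \<comment> \<open>the radii at which a cube is met lie within its diameter of the norm of any of its points\<close>
  define p where "p = (\<lambda>i. SOME x. x \<in> C i)"
  have p: "p i \<in> C i" if "C i \<noteq> {}" for i
    using that unfolding p_def by (simp add: some_in_eq)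
  let ?F = "\<lambda>i t. ennreal (\<kappa> * d i ^ m) * indicator (cball (norm (p i)) (d i)) t"
  have slice: "hausdorff_premeasure m \<delta> A \<le> (\<Sum>i. ?F i t)" if t: "t \<in> {1..2}" for t :: real
  proof -
    define E where "E = (\<lambda>i. {u \<in> sphere 0 1. t *\<^sub>R u \<in> C i})"
    have dE: "dist u v \<le> d i" if "u \<in> E i" "v \<in> E i" for i u v
    proof -
      have "dist u v \<le> t * dist u v" using t mult_right_mono[of 1 t "dist u v"] by simp
      also have "\<dots> = dist (t *\<^sub>R u) (t *\<^sub>R v)"
        using t by (simp add: dist_norm flip: scaleR_diff_right)
      also have "\<dots> \<le> d i"
        using that diameter_bounded_bound[OF bounded_C, of "t *\<^sub>R u" i "t *\<^sub>R v"]
        by (auto simp: E_def d_def)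
      finally show ?thesis .
    qed
    have dE': "diameter (E i) \<le> d i" for i
      using dE[of _ i] d_nonneg by (intro diameter_le) (auto simp: dist_norm)
    have bE: "bounded (E i)" for i
      by (rule bounded_subset[OF bounded_sphere[of 0 1]]) (auto simp: E_def)
    have "A \<subseteq> (\<Union>i. E i)"
    proof
      fix u assume u: "u \<in> A"
      then have "t *\<^sub>R u \<in> T" using t by (auto simp: T_def)
      then obtain K where "K \<in> D" "t *\<^sub>R u \<in> K" using D(7) by blast
      then obtain i where "t *\<^sub>R u \<in> C i" using C_cover by metis
      then show "u \<in> (\<Union>i. E i)" using u A by (auto simp: E_def)
    qed
    moreover have "diameter (E i) \<le> \<delta>" for i
      using dE'[of i] C_cases[of i] DU(2)[of "C i"] \<delta> by (auto simp: d_def intro: order_trans)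
    ultimately have "hausdorff_premeasure m \<delta> A \<le> (\<Sum>i. hausdorff_size m (E i))"
      using bE by (intro hausdorff_premeasure_le) auto
    also have "\<dots> \<le> (\<Sum>i. ?F i t)"
    proof (rule suminf_le)
      fix i
      show "hausdorff_size m (E i) \<le> ?F i t"
      proof (cases "E i = {}")
        case False
        then obtain u where u: "norm u = 1" "t *\<^sub>R u \<in> C i" by (auto simp: E_def)
        then have "p i \<in> C i" using p by auto
        have "\<bar>norm (p i) - norm (t *\<^sub>R u)\<bar> \<le> dist (p i) (t *\<^sub>R u)"
          unfolding dist_norm by (rule norm_triangle_ineq3)
        also have "\<dots> \<le> d i"
          unfolding d_def by (rule diameter_bounded_bound[OF bounded_C]) fact+
        finally have "t \<in> cball (norm (p i)) (d i)"
          using t u by (simp add: dist_real_def)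
        moreover have "hausdorff_size m (E i) \<le> ennreal (\<kappa> * d i ^ m)"
          unfolding hausdorff_size_def \<kappa>_def using False dE' diameter_ge_0[OF bE]
          by (auto intro!: ennreal_leI divide_right_mono mult_left_mono power_mono)
        ultimately show ?thesis by simp
      qed (simp add: hausdorff_size_def)
    qed auto
    finally show ?thesis .
  qed
  have "hausdorff_premeasure m \<delta> A = (\<integral>\<^sup>+t. hausdorff_premeasure m \<delta> A * indicator {1..2::real} t \<partial>lborel)"
    by (simp add: nn_integral_cmult_indicator)
  also have "\<dots> \<le> (\<integral>\<^sup>+t. (\<Sum>i. ?F i t) \<partial>lborel)"
    using slice by (intro nn_integral_mono) (auto simp: indicator_def)
  also have "\<dots> = (\<Sum>i. \<integral>\<^sup>+t. ?F i t \<partial>lborel)"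
    by (rule nn_integral_suminf) (auto intro!: borel_measurable_times_ennreal borel_measurable_indicator)
  also have "\<dots> \<le> (\<Sum>i. ?c * emeasure lborel (C i))"
  proof (rule suminf_le)
    fix i
    have "(\<integral>\<^sup>+t. ?F i t \<partial>lborel) = ennreal (\<kappa> * d i ^ m) * ennreal (2 * d i)"
      using d_nonneg by (simp add: nn_integral_cmult_indicator cball_eq_atLeastAtMost)
    also have "\<dots> = ennreal (2 * \<kappa>) * ennreal (d i ^ Suc m)"
      using d_nonneg \<kappa> by (simp add: ac_simps flip: ennreal_mult)
    also have "\<dots> \<le> ennreal (2 * \<kappa>) * (ennreal (real DIM('a) ^ DIM('a)) * emeasure lborel (C i))"
      by (rule mult_left_mono[OF conjunct2[OF conjunct2[OF vol]]]) simp
    also have "\<dots> = ?c * emeasure lborel (C i)"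
    proof -
      have "?c = ennreal (2 * \<kappa> * real DIM('a) ^ DIM('a))"
        unfolding \<kappa>_def m_def by simp
      also have "\<dots> = ennreal (2 * \<kappa>) * ennreal (real DIM('a) ^ DIM('a))"
        using \<kappa> by (intro ennreal_mult) auto
      finally show ?thesis by (simp add: mult.assoc)
    qed
    finally show "(\<integral>\<^sup>+t. ?F i t \<partial>lborel) \<le> ?c * emeasure lborel (C i)" .
  qed auto
  also have "\<dots> = ?c * (\<Sum>i. emeasure lborel (C i))"
    by simp
  also have "\<dots> \<le> ?c * emeasure lborel U"
    by (intro mult_left_mono sum_vol) auto
  finally show "hausdorff_premeasure (DIM('a) - 1) \<delta> A \<le> ?c * emeasure lborel U"
    unfolding m_def .
qed

lemma hausdorff_outer_sphere_finite:
  "hausdorff_outer (DIM('a) - 1) (sphere (0::'a::euclidean_space) 1) < top"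
proof -
  let ?c = "ennreal (2 * unit_ball_vol (real (DIM('a) - 1)) / 2 ^ (DIM('a) - 1) * real DIM('a) ^ DIM('a))"
  have "hausdorff_outer (DIM('a) - 1) (sphere (0::'a) 1) \<le> ?c * emeasure lborel (ball (0::'a) 3)"
    by (rule hausdorff_outer_le_lborel_shell) auto
  also have "\<dots> < top"
    using emeasure_lborel_ball_finite[of "0::'a" 3] by (simp add: ennreal_mult_less_top)
  finally show ?thesis .
qed

text \<open>
  A cone is Lebesgue null only if its trace on the sphere is null for the spherical measure: apply the
  previous estimate to open sets of small volume around the cone.
\<close>

lemma hausdorff_outer_null_cone:
  fixes A :: "'a::euclidean_space set"
  assumes "A \<subseteq> sphere 0 1" and "negligible Z"
    and cone: "\<And>t u. t \<in> {1..2} \<Longrightarrow> u \<in> A \<Longrightarrow> t *\<^sub>R u \<in> Z"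
  shows "hausdorff_outer (DIM('a) - 1) A = 0"
proof -
  define c where "c = 2 * unit_ball_vol (real (DIM('a) - 1)) / 2 ^ (DIM('a) - 1) * real DIM('a) ^ DIM('a)"
  have "unit_ball_vol (real (DIM('a) - 1)) > 0"
    by (rule unit_ball_vol_pos) simp
  then have c: "c > 0"
    unfolding c_def by (intro mult_pos_pos divide_pos_pos) auto
  have "hausdorff_outer (DIM('a) - 1) A \<le> 0 + ennreal e" if "e > 0" for e
  proof -
    have "e / c > 0" using \<open>e > 0\<close> c by simp
    moreover have "Z \<in> sets lebesgue" "emeasure lebesgue Z = 0"
      using \<open>negligible Z\<close> by (auto simp: negligible_iff_null_sets)
    ultimately obtain U where U: "open U" "Z \<subseteq> U" "emeasure lebesgue (U - Z) < ennreal (e / c)"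
      by (metis sets_lebesgue_outer_open)
    have "emeasure lborel U = emeasure lebesgue U"
      using U(1) by simp
    also have "\<dots> \<le> emeasure lebesgue (U - Z) + emeasure lebesgue Z"
      using U \<open>Z \<in> sets lebesgue\<close> by (intro emeasure_subadditive[THEN order_trans[rotated]] emeasure_mono) auto
    finally have "emeasure lborel U \<le> ennreal (e / c)"
      using U(3) \<open>emeasure lebesgue Z = 0\<close> by simp
    have "hausdorff_outer (DIM('a) - 1) A \<le> ennreal c * emeasure lborel U"
      unfolding c_def using assms U by (intro hausdorff_outer_le_lborel_shell) auto
    also have "\<dots> \<le> ennreal c * ennreal (e / c)"
      by (intro mult_left_mono) (fact, simp)
    also have "\<dots> = ennreal e"
      using c \<open>e > 0\<close> by (subst ennreal_mult[symmetric]) auto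
    finally show ?thesis by simp
  qed
  then have "hausdorff_outer (DIM('a) - 1) A \<le> 0"
    by (rule ennreal_le_epsilon)
  then show ?thesis by simp
qed

section \<open>Differentiability of support functions almost everywhere\<close>

lemma support_fun_attained:
  assumes "compact W" "W \<noteq> {}"
  obtains w where "w \<in> W" "x \<bullet> w = support_fun W x" "\<And>v. v \<in> W \<Longrightarrow> x \<bullet> v \<le> support_fun W x"
proof -
  obtain w where w: "w \<in> W" "\<And>v. v \<in> W \<Longrightarrow> x \<bullet> v \<le> x \<bullet> w"
    using continuous_attains_sup[OF assms, of "\<lambda>v. x \<bullet> v"] continuous_on_inner[OF continuous_on_const continuous_on_id]
    by blast
  then have "support_fun W x = x \<bullet> w"
    unfolding support_fun_def by (intro cSup_eq_maximum) auto
  with w that show ?thesis by auto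
qed

lemma support_fun_upper: "compact W \<Longrightarrow> v \<in> W \<Longrightarrow> x \<bullet> v \<le> support_fun W x"
  by (metis support_fun_attained empty_iff)

lemma support_fun_le_iff:
  "compact W \<Longrightarrow> W \<noteq> {} \<Longrightarrow> support_fun W x \<le> c \<longleftrightarrow> (\<forall>v\<in>W. x \<bullet> v \<le> c)"
  by (metis support_fun_attained order_trans)

lemma support_fun_scaleR:
  assumes "compact W" "W \<noteq> {}" "t \<ge> 0"
  shows "support_fun W (t *\<^sub>R x) = t * support_fun W x"
proof -
  obtain w where w: "w \<in> W" "x \<bullet> w = support_fun W x" "\<And>v. v \<in> W \<Longrightarrow> x \<bullet> v \<le> support_fun W x"
    using support_fun_attained[OF assms(1,2), of x] by blast
  then show ?thesis
    unfolding support_fun_def[of W "t *\<^sub>R x"] using \<open>t \<ge> 0\<close>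
    by (intro cSup_eq_maximum) (force intro: mult_left_mono)+
qed

lemma continuous_on_support_fun:
  fixes W :: "'a::euclidean_space set"
  assumes "compact W" "W \<noteq> {}"
  shows "continuous_on A (support_fun W)"
proof -
  obtain L where L: "L > 0" "\<And>w. w \<in> W \<Longrightarrow> norm w \<le> L"
    using compact_imp_bounded[OF assms(1)] bounded_pos by blast
  have *: "support_fun W x - support_fun W y \<le> L * dist x y" for x y
  proof -
    obtain w where w: "w \<in> W" "x \<bullet> w = support_fun W x"
      using support_fun_attained[OF assms, of x] by blast
    have "support_fun W x - support_fun W y \<le> (x - y) \<bullet> w"
      using support_fun_upper[OF assms(1) w(1), of y] w by (simp add: inner_diff_left)
    also have "\<dots> \<le> norm (x - y) * norm w" by (rule norm_cauchy_schwarz)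
    also have "\<dots> \<le> L * dist x y"
      using L(2)[OF w(1)] by (simp add: dist_norm mult.commute[of "norm (x - y)"] mult_right_mono)
    finally show ?thesis .
  qed
  have "dist (support_fun W x) (support_fun W y) \<le> L * dist x y" for x y
    using *[of x y] *[of y x] by (simp add: dist_real_def dist_commute abs_le_iff)
  then have "L-lipschitz_on A (support_fun W)"
    using L(1) by (intro lipschitz_onI) auto
  then show ?thesis by (rule lipschitz_on_continuous_on)
qed

text \<open>
  If the maximum that defines the support function at \<open>x\<close> is attained at two points, both are
  subgradients, so the support function is not differentiable at \<open>x\<close>. That this happens on a null set
  only is the part of Rademacher's theorem that is needed for convex bodies.
\<close>

definition multiple_maximizers :: "'a::euclidean_space set \<Rightarrow> 'a set" where
  "multiple_maximizers W =
     {x. \<exists>v\<in>W. \<exists>w\<in>W. v \<noteq> w \<and> x \<bullet> v = support_fun W x \<and> x \<bullet> w = support_fun W x}"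

text \<open>
  The points where the slope in the direction \<open>i\<close> jumps by at least \<open>1 / (k + 1)\<close>. In contrast to
  \<^const>\<open>multiple_maximizers\<close> this set is closed, since the inequality for the jump survives limits.
\<close>

definition kinks :: "'a::euclidean_space set \<Rightarrow> 'a \<Rightarrow> nat \<Rightarrow> 'a set" where
  "kinks W i k =
     {x. \<exists>v\<in>W. \<exists>w\<in>W. x \<bullet> v = support_fun W x \<and> x \<bullet> w = support_fun W x \<and>
        1 / real (Suc k) \<le> (v - w) \<bullet> i}"

lemma closed_kinks:
  assumes "compact W" "W \<noteq> {}"
  shows "closed (kinks W i k)"
proof -
  let ?T = "{p. snd p \<bullet> fst (fst p) = support_fun W (snd p) \<and>
      snd p \<bullet> snd (fst p) = support_fun W (snd p) \<and> 1 / real (Suc k) \<le> (fst (fst p) - snd (fst p)) \<bullet> i}"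
  have c: "continuous_on UNIV (\<lambda>p::('a \<times> 'a) \<times> 'a. support_fun W (snd p))"
    by (rule continuous_on_compose2[OF continuous_on_support_fun[OF assms, of UNIV]])
       (auto intro: continuous_intros)
  have "closed ?T"
    by (intro closed_Collect_conj closed_Collect_eq closed_Collect_le continuous_intros c)
  then have "closed {x. \<exists>p. p \<in> W \<times> W \<and> (p, x) \<in> ?T}"
    by (intro closed_compact_projection compact_Times assms)
  also have "{x. \<exists>p. p \<in> W \<times> W \<and> (p, x) \<in> ?T} = kinks W i k"
    by (auto simp: kinks_def)
  finally show ?thesis .
qed

lemma multiple_maximizers_eq_UN_kinks:
  "multiple_maximizers W = (\<Union>i\<in>Basis. \<Union>k. kinks W i k)"
proof
  show "multiple_maximizers W \<subseteq> (\<Union>i\<in>Basis. \<Union>k. kinks W i k)"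
  proof
    fix x assume "x \<in> multiple_maximizers W"
    then obtain v w where vw: "v \<in> W" "w \<in> W" "v \<noteq> w" "x \<bullet> v = support_fun W x" "x \<bullet> w = support_fun W x"
      by (auto simp: multiple_maximizers_def)
    then obtain i where i: "i \<in> Basis" "v \<bullet> i \<noteq> w \<bullet> i"
      by (metis euclidean_eqI)
    then have "0 < \<bar>(v - w) \<bullet> i\<bar>" by (simp add: inner_diff_left)
    then obtain k where k: "1 / real (Suc k) \<le> \<bar>(v - w) \<bullet> i\<bar>"
      using reals_Archimedean[of "\<bar>(v - w) \<bullet> i\<bar>"] by (auto simp: inverse_eq_divide intro: less_imp_le)
    have "x \<in> kinks W i k"
    proof (cases "(v - w) \<bullet> i \<ge> 0")
      case True
      with k have "1 / real (Suc k) \<le> (v - w) \<bullet> i" by simp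
      with vw show ?thesis unfolding kinks_def by blast
    next
      case False
      with k have "1 / real (Suc k) \<le> (w - v) \<bullet> i" by (simp add: inner_diff_left)
      with vw show ?thesis unfolding kinks_def by blast
    qed
    with i show "x \<in> (\<Union>i\<in>Basis. \<Union>k. kinks W i k)" by auto
  qed
  show "(\<Union>i\<in>Basis. \<Union>k. kinks W i k) \<subseteq> multiple_maximizers W"
  proof safe
    fix x i k assume "x \<in> kinks W i k"
    then obtain v w where vw: "v \<in> W" "w \<in> W" "x \<bullet> v = support_fun W x" "x \<bullet> w = support_fun W x"
      "1 / real (Suc k) \<le> (v - w) \<bullet> i"
      by (auto simp: kinks_def)
    have "0 < 1 / real (Suc k)" by simp
    then have "v \<noteq> w" using vw(5) by auto
    with vw show "x \<in> multiple_maximizers W" unfolding multiple_maximizers_def by blast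
  qed
qed

text \<open>
  The slopes of a convex function increase along a line. Here they jump by at least a fixed amount at
  every kink and stay in a bounded interval, so the number of kinks on a line is bounded by a number
  that does not depend on the line.
\<close>

lemma kinks_on_line:
  fixes W :: "'a::euclidean_space set"
  assumes "compact W"
  obtains M :: nat where
    "\<And>x T. finite T \<Longrightarrow> card {t \<in> T. x - t *\<^sub>R i \<in> kinks W i k} \<le> M"
proof -
  obtain L where L: "\<And>w. w \<in> W \<Longrightarrow> \<bar>w \<bullet> i\<bar> \<le> L"
  proof -
    obtain B where "\<And>w. w \<in> W \<Longrightarrow> norm w \<le> B"
      using compact_imp_bounded[OF assms] by (auto simp: bounded_iff)
    then have "\<bar>w \<bullet> i\<bar> \<le> B * norm i" if "w \<in> W" for w
      using that Cauchy_Schwarz_ineq2[of w i] by (meson mult_right_mono norm_ge_zero order_trans)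
    then show ?thesis by (rule that)
  qed
  define n where "n = real (Suc k)"
  have n: "n > 0" by (simp add: n_def)
  define I where "I = {\<lfloor>- (n * L)\<rfloor>..\<lfloor>n * L\<rfloor>}"
  have "card {t \<in> T. x - t *\<^sub>R i \<in> kinks W i k} \<le> card I" if "finite T" for x T
  proof -
    let ?T = "{t \<in> T. x - t *\<^sub>R i \<in> kinks W i k}"
    have "\<forall>t\<in>?T. \<exists>p. fst p \<in> W \<and> snd p \<in> W \<and>
        (x - t *\<^sub>R i) \<bullet> fst p = support_fun W (x - t *\<^sub>R i) \<and>
        (x - t *\<^sub>R i) \<bullet> snd p = support_fun W (x - t *\<^sub>R i) \<and> 1 / n \<le> (fst p - snd p) \<bullet> i"
      unfolding kinks_def n_def by fastforce
    then obtain p where p: "\<forall>t\<in>?T. fst (p t) \<in> W \<and> snd (p t) \<in> W \<and>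
        (x - t *\<^sub>R i) \<bullet> fst (p t) = support_fun W (x - t *\<^sub>R i) \<and>
        (x - t *\<^sub>R i) \<bullet> snd (p t) = support_fun W (x - t *\<^sub>R i) \<and> 1 / n \<le> (fst (p t) - snd (p t)) \<bullet> i"
      by (rule exE[OF bchoice])
    define v w where "v = (\<lambda>t. fst (p t))" and "w = (\<lambda>t. snd (p t))"
    have vw: "v t \<in> W" "w t \<in> W" "(x - t *\<^sub>R i) \<bullet> v t = support_fun W (x - t *\<^sub>R i)"
      "(x - t *\<^sub>R i) \<bullet> w t = support_fun W (x - t *\<^sub>R i)" "1 / n \<le> (v t - w t) \<bullet> i"
      if "t \<in> ?T" for t
      using bspec[OF p that] by (simp_all add: v_def w_def)
    \<comment> \<open>the slopes in units of the minimal jump; rounding down keeps them distinct\<close>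
    define c where "c = (\<lambda>t. \<lfloor>n * (v t \<bullet> i)\<rfloor>)"
    have step: "c t + 1 \<le> c s" if st: "s \<in> ?T" "t \<in> ?T" "s < t" for s t
    proof -
      have "(x - s *\<^sub>R i) \<bullet> v t \<le> (x - s *\<^sub>R i) \<bullet> w s"
        using vw(4)[OF st(1)] support_fun_upper[OF assms vw(1)[OF st(2)]] by simp
      moreover have "(x - t *\<^sub>R i) \<bullet> w s \<le> (x - t *\<^sub>R i) \<bullet> v t"
        using vw(3)[OF st(2)] support_fun_upper[OF assms vw(2)[OF st(1)]] by simp
      ultimately have "(t - s) * (i \<bullet> v t) \<le> (t - s) * (i \<bullet> w s)"
        by (simp add: inner_diff_left algebra_simps)
      then have "v t \<bullet> i \<le> w s \<bullet> i" using \<open>s < t\<close> by (simp add: inner_commute)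
      moreover have "w s \<bullet> i + 1 / n \<le> v s \<bullet> i"
        using vw(5)[OF st(1)] by (simp add: inner_diff_left)
      ultimately have "v t \<bullet> i + 1 / n \<le> v s \<bullet> i" by simp
      then have "n * (v t \<bullet> i + 1 / n) \<le> n * (v s \<bullet> i)" using n by (intro mult_left_mono) auto
      then have "n * (v t \<bullet> i) + 1 \<le> n * (v s \<bullet> i)" using n by (simp add: distrib_left)
      then show ?thesis unfolding c_def by linarith
    qed
    have "inj_on c ?T"
    proof (rule inj_onI)
      fix s t assume "s \<in> ?T" "t \<in> ?T" "c s = c t"
      then show "s = t" using step[of s t] step[of t s] by (cases s t rule: linorder_cases) auto
    qed
    moreover have "c ` ?T \<subseteq> I"
    proof
      fix y assume "y \<in> c ` ?T"
      then obtain t where t: "t \<in> ?T" "y = c t" by auto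
      have "- L \<le> v t \<bullet> i" "v t \<bullet> i \<le> L" using L[OF vw(1)[OF t(1)]] by auto
      then have "n * (- L) \<le> n * (v t \<bullet> i)" "n * (v t \<bullet> i) \<le> n * L"
        using n by (intro mult_left_mono; simp)+
      then show "y \<in> I" by (auto simp: t I_def c_def intro: floor_mono)
    qed
    ultimately show ?thesis
      by (intro card_inj_on_le[of c]) (auto simp: I_def)
  qed
  then show ?thesis by (rule that)
qed

text \<open>
  Consider \<open>J\<close> different translates, by lengths in \<open>{0..1}\<close> along \<open>i\<close>, of a bounded piece of the set.
  They lie in a fixed ball and, by the bound for lines, cover every point at most \<open>M\<close> times. Hence
  \<open>J\<close> times the volume of the piece is bounded independently of \<open>J\<close>.
\<close>

lemma negligible_kinks:
  fixes W :: "'a::euclidean_space set"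
  assumes W: "compact W" "W \<noteq> {}" and i: "i \<in> Basis"
  shows "negligible (kinks W i k)"
proof -
  obtain M where M: "\<And>x T. finite T \<Longrightarrow> card {t \<in> T. x - t *\<^sub>R i \<in> kinks W i k} \<le> M"
    using kinks_on_line[OF W(1), of i k] by blast
  have "emeasure lebesgue (kinks W i k \<inter> cball 0 r) = 0" for r
  proof -
    define B where "B = kinks W i k \<inter> cball 0 r"
    have B: "B \<in> sets lebesgue"
      using closed_kinks[OF W, of i k] by (auto simp: B_def)
    define V where "V = emeasure lebesgue (cball (0::'a) (r + 1))"
    have V: "V < top" unfolding V_def using emeasure_lborel_cball_finite by auto
    have "ennreal (real J) * emeasure lebesgue B \<le> ennreal (real M) * V" for J
    proof -
      define T where "T = (\<lambda>j. 1 / real (Suc j)) ` {..<J}"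
      have T: "finite T" "T \<subseteq> {0..1}" by (auto simp: T_def)
      have "card T = J"
        unfolding T_def by (subst card_image) (auto intro!: inj_onI)
      let ?B = "\<lambda>t. (\<lambda>x. 1 *\<^sub>R x + t *\<^sub>R i) ` B"
      have meas: "?B t \<in> sets lebesgue" for t
      proof -
        have "compact B"
          unfolding B_def using closed_kinks[OF W] compact_cball by (rule closed_Int_compact)
        then have "compact (?B t)"
          by (intro compact_continuous_image continuous_intros)
        then show ?thesis by (simp add: borel_compact)
      qed
      have "ennreal (real J) * emeasure lebesgue B = (\<Sum>t\<in>T. emeasure lebesgue B)"
        by (simp add: \<open>card T = J\<close> ennreal_of_nat_eq_real_of_nat)
      also have "\<dots> = (\<Sum>t\<in>T. emeasure lebesgue (?B t))"
        by (subst emeasure_lebesgue_affine) simp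
      also have "\<dots> = (\<Sum>t\<in>T. \<integral>\<^sup>+x. indicator (?B t) x \<partial>lebesgue)"
        using meas by simp
      also have "\<dots> = (\<integral>\<^sup>+x. (\<Sum>t\<in>T. indicator (?B t) x) \<partial>lebesgue)"
        using meas by (intro nn_integral_sum[symmetric]) auto
      also have "\<dots> \<le> (\<integral>\<^sup>+x. ennreal (real M) * indicator (cball (0::'a) (r + 1)) x \<partial>lebesgue)"
      proof (rule nn_integral_mono)
        fix x :: 'a
        have eq: "x \<in> ?B t \<longleftrightarrow> x - t *\<^sub>R i \<in> B" for t
          by (auto simp: image_iff intro!: bexI[of _ "x - t *\<^sub>R i"])
        have "(\<Sum>t\<in>T. indicator (?B t) x :: ennreal) = (\<Sum>t\<in>T. if x - t *\<^sub>R i \<in> B then 1 else 0)"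
          by (intro sum.cong refl) (simp only: indicator_def eq of_bool_def)
        also have "\<dots> = (\<Sum>t\<in>{t\<in>T. x - t *\<^sub>R i \<in> B}. 1)"
          using T(1) by (rule sum.inter_filter[symmetric])
        also have "\<dots> = ennreal (real (card {t\<in>T. x - t *\<^sub>R i \<in> B}))"
          by (simp add: ennreal_of_nat_eq_real_of_nat)
        also have "\<dots> \<le> ennreal (real M) * indicator (cball 0 (r + 1)) x"
        proof (cases "x \<in> cball 0 (r + 1)")
          case True
          have "card {t\<in>T. x - t *\<^sub>R i \<in> B} \<le> card {t \<in> T. x - t *\<^sub>R i \<in> kinks W i k}"
            using T(1) by (intro card_mono) (auto simp: B_def)
          with M[OF T(1), of x] True show ?thesis by (auto intro!: ennreal_leI)
        next
          case False
          have "x - t *\<^sub>R i \<notin> B" if "t \<in> T" for t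
          proof
            assume "x - t *\<^sub>R i \<in> B"
            then have "norm (x - t *\<^sub>R i) \<le> r" by (simp add: B_def)
            moreover have "norm (t *\<^sub>R i) \<le> 1" using that T(2) i by auto
            ultimately have "norm x \<le> r + 1" using norm_triangle_sub[of x "t *\<^sub>R i"] by simp
            with False show False by simp
          qed
          then have none: "{t\<in>T. x - t *\<^sub>R i \<in> B} = {}" by auto
          show ?thesis unfolding none by simp
        qed
        finally show "(\<Sum>t\<in>T. indicator (?B t) x) \<le> ennreal (real M) * indicator (cball 0 (r + 1)) x" .
      qed
      also have "\<dots> = ennreal (real M) * V"
        by (simp add: V_def nn_integral_cmult_indicator)
      finally show ?thesis .
    qed note bound = this
    have "emeasure lebesgue B \<le> V"
      unfolding V_def by (rule emeasure_mono) (auto simp: B_def)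
    then have fin: "emeasure lebesgue B = ennreal (measure lebesgue B)"
      using V by (intro emeasure_eq_ennreal_measure) (auto simp: less_top top_unique)
    obtain V' where V': "V = ennreal V'" "V' \<ge> 0" using V by (cases V) auto
    have "real J * measure lebesgue B \<le> real M * V'" for J
      using bound[of J] V'(2) unfolding fin V'(1) by (simp flip: ennreal_mult)
    then have "measure lebesgue B \<le> 0"
      by (metis ex_less_of_nat_mult not_le)
    then show ?thesis
      unfolding B_def[symmetric] fin by (simp add: ennreal_neg)
  qed
  then have "negligible (kinks W i k \<inter> cball 0 (real m))" for m
    using closed_kinks[OF W] by (auto simp: negligible_iff_null_sets null_sets_def)
  then have "negligible (\<Union>m. kinks W i k \<inter> cball 0 (real m))"
    by (rule negligible_Union_nat)
  also have "(\<Union>m. kinks W i k \<inter> cball 0 (real m)) = kinks W i k"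
    by (auto intro: real_arch_simple)
  finally show ?thesis .
qed

lemma negligible_multiple_maximizers:
  fixes W :: "'a::euclidean_space set"
  assumes "compact W" "W \<noteq> {}"
  shows "negligible (multiple_maximizers W)"
  unfolding multiple_maximizers_eq_UN_kinks
proof (rule negligible_Union)
  fix T assume "T \<in> (\<lambda>i. \<Union>k. kinks W i k) ` Basis"
  then obtain i where "i \<in> Basis" and T: "T = (\<Union>k. kinks W i k)" by blast
  then show "negligible T"
    unfolding T by (intro negligible_Union_nat negligible_kinks assms)
qed simp

lemma borel_multiple_maximizers:
  assumes "compact W" "W \<noteq> {}"
  shows "multiple_maximizers W \<in> sets borel"
  unfolding multiple_maximizers_eq_UN_kinks
  by (intro sets.finite_UN sets.countable_UN) (auto intro!: borel_closed closed_kinks assms)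

section \<open>Gauge functions, radial functions and normals\<close>

definition the_maximizer :: "'a::euclidean_space set \<Rightarrow> 'a \<Rightarrow> 'a" where
  "the_maximizer W x = (SOME w. w \<in> W \<and> x \<bullet> w = support_fun W x)"

lemma the_maximizer:
  assumes "compact W" "W \<noteq> {}"
  shows "the_maximizer W x \<in> W" "x \<bullet> the_maximizer W x = support_fun W x"
proof -
  have "\<exists>w. w \<in> W \<and> x \<bullet> w = support_fun W x"
    using support_fun_attained[OF assms, of x] by metis
  from someI_ex[OF this] show "the_maximizer W x \<in> W" "x \<bullet> the_maximizer W x = support_fun W x"
    by (simp_all add: the_maximizer_def)
qed

lemma the_maximizer_unique:
  assumes "compact W" "w \<in> W" "x \<bullet> w = support_fun W x" "x \<notin> multiple_maximizers W"
  shows "the_maximizer W x = w"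
proof -
  have "W \<noteq> {}" using assms(2) by blast
  note m = the_maximizer[OF assms(1) this, of x]
  show ?thesis
    using m assms(2-4) unfolding multiple_maximizers_def by blast
qed

text \<open>
  A closed graph argument: the points at which some element of \<open>W \<inter> C\<close> is a maximizer form a closed
  set, because \<open>W \<inter> C\<close> is compact, and where the maximizer is unique this is the preimage of \<open>C\<close>.
\<close>

lemma continuous_on_the_maximizer:
  fixes W :: "'a::euclidean_space set"
  assumes "compact W" "W \<noteq> {}"
  shows "continuous_on (- multiple_maximizers W) (the_maximizer W)"
  unfolding continuous_on_closed
proof (intro allI impI)
  let ?S = "- multiple_maximizers W"
  fix T assume "closedin (top_of_set (the_maximizer W ` ?S)) T"
  then obtain C where C: "closed C" "T = the_maximizer W ` ?S \<inter> C"
    by (auto simp: closedin_closed)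
  have c: "continuous_on UNIV (\<lambda>p::'a \<times> 'a. support_fun W (snd p))"
    by (rule continuous_on_compose2[OF continuous_on_support_fun[OF assms, of UNIV]])
       (auto intro: continuous_intros)
  have "closed {x. \<exists>w. w \<in> W \<inter> C \<and> (w, x) \<in> {p. snd p \<bullet> fst p = support_fun W (snd p)}}"
    using assms C by (intro closed_compact_projection compact_Int_closed closed_Collect_eq continuous_intros c)
  then have "closedin (top_of_set ?S)
      (?S \<inter> {x. \<exists>w. w \<in> W \<inter> C \<and> (w, x) \<in> {p. snd p \<bullet> fst p = support_fun W (snd p)}})"
    by (rule closedin_closed_Int)
  also have "?S \<inter> {x. \<exists>w. w \<in> W \<inter> C \<and> (w, x) \<in> {p. snd p \<bullet> fst p = support_fun W (snd p)}} =
      ?S \<inter> the_maximizer W -` T" (is "?L = ?R")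
  proof
    show "?L \<subseteq> ?R"
      using the_maximizer_unique[OF assms(1)] by (fastforce simp: C(2))
    show "?R \<subseteq> ?L"
      using the_maximizer[OF assms] by (force simp: C(2))
  qed
  finally show "closedin (top_of_set ?S) (?S \<inter> the_maximizer W -` T)" .
qed

text \<open>
  The convex body \<open>K\<close> with gauge function \<open>N\<close>, where \<open>N\<close> is the support function of a compact set
  \<open>W\<close> that meets every open half-space bounded by a hyperplane through the origin. For an Aleksandrov
  body, \<open>W\<close> consists of the points \<open>v / f v\<close> with \<open>v \<in> \<Omega>\<close>. The set \<open>W_hull\<close> is the polar body of \<open>K\<close>.
  It has the same support function as \<open>W\<close>, but it sees the normals of \<open>K\<close> in all directions, not
  only those from \<open>\<Omega>\<close>. Off the null cone \<open>Z\<close> the normal is unique, and then it comes from \<open>W\<close>.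
\<close>

locale gauge_body =
  fixes W :: "'a::euclidean_space set"
  assumes compact_W: "compact W"
    and pos_W: "\<And>x. x \<noteq> 0 \<Longrightarrow> \<exists>w\<in>W. x \<bullet> w > 0"
begin

abbreviation N :: "'a \<Rightarrow> real" where "N \<equiv> support_fun W"

definition K :: "'a set" where "K = {x. N x \<le> 1}"

definition W_hull :: "'a set" where "W_hull = {w. \<forall>x. x \<bullet> w \<le> N x}"

definition Z :: "'a set" where "Z = multiple_maximizers W_hull"

lemma W_nonempty: "W \<noteq> {}"
proof -
  obtain i :: 'a where "i \<in> Basis" using nonempty_Basis by blast
  then have "i \<noteq> 0" by (rule nonzero_Basis)
  then show ?thesis using pos_W[of i] by blast
qed

lemma N_pos: "x \<noteq> 0 \<Longrightarrow> N x > 0"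
proof -
  assume "x \<noteq> 0"
  then obtain w where w: "w \<in> W" "x \<bullet> w > 0" using pos_W by blast
  with support_fun_upper[OF compact_W w(1), of x] show ?thesis by simp
qed

lemma N_0 [simp]: "N 0 = 0"
  using W_nonempty by (simp add: support_fun_def)

lemma N_nonneg: "N x \<ge> 0"
  using N_pos[of x] by (cases "x = 0") auto

lemma N_scaleR: "t \<ge> 0 \<Longrightarrow> N (t *\<^sub>R x) = t * N x"
  by (rule support_fun_scaleR[OF compact_W W_nonempty])

lemma continuous_on_N: "continuous_on A N"
  by (rule continuous_on_support_fun[OF compact_W W_nonempty])

lemma N_bounds:
  obtains c L where "0 < c" "0 < L" "\<And>x. c * norm x \<le> N x" "\<And>x. N x \<le> L * norm x"
proof -
  have ne: "sphere (0::'a) 1 \<noteq> {}" by simp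
  obtain a where a: "a \<in> sphere 0 1" "\<And>x. x \<in> sphere 0 1 \<Longrightarrow> N a \<le> N x"
    using continuous_attains_inf[OF compact_sphere ne continuous_on_N] by blast
  obtain b where b: "b \<in> sphere 0 1" "\<And>x. x \<in> sphere 0 1 \<Longrightarrow> N x \<le> N b"
    using continuous_attains_sup[OF compact_sphere ne continuous_on_N] by blast
  have "N a > 0" "N b > 0" using a b by (auto intro!: N_pos)
  moreover have "N a * norm x \<le> N x" "N x \<le> N b * norm x" for x
  proof -
    have "N x = norm x * N (sgn x)"
      by (cases "x = 0") (simp_all flip: N_scaleR add: sgn_div_norm)
    moreover have "N a \<le> N (sgn x) \<and> N (sgn x) \<le> N b" if "x \<noteq> 0"
      using a(2)[of "sgn x"] b(2)[of "sgn x"] that by (simp add: norm_sgn)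
    ultimately show "N a * norm x \<le> N x" "N x \<le> N b * norm x"
      by (cases "x = 0"; simp add: mult.commute mult_left_mono)+
  qed
  ultimately show ?thesis by (rule that)
qed

lemma radial_fun_K:
  assumes "x \<noteq> 0"
  shows "radial_fun K x = 1 / N x"
proof -
  have "{r. r > 0 \<and> r *\<^sub>R x \<in> K} = {0 <.. 1 / N x}"
    using N_pos[OF assms] by (auto simp: K_def N_scaleR field_simps)
  then show ?thesis
    using N_pos[OF assms] by (simp add: radial_fun_def)
qed

lemma frontier_K: "frontier K = {x. N x = 1}"
proof
  have closed: "closed K"
    unfolding K_def by (intro closed_Collect_le continuous_on_N continuous_intros)
  have interior: "{x. N x < 1} \<subseteq> interior K"
    by (intro interior_maximal open_Collect_less continuous_on_N continuous_intros) (auto simp: K_def)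
  show "frontier K \<subseteq> {x. N x = 1}"
  proof safe
    fix x assume "x \<in> frontier K"
    then have "x \<in> K" "x \<notin> interior K"
      using closed by (auto simp: frontier_def)
    then have "N x \<le> 1" by (simp add: K_def)
    moreover have "\<not> N x < 1"
      using interior \<open>x \<notin> interior K\<close> by blast
    ultimately show "N x = 1" by simp
  qed
  show "{x. N x = 1} \<subseteq> frontier K"
  proof safe
    fix x assume x: "N x = 1"
    then have "x \<noteq> 0" by auto
    have "x \<notin> interior K"
    proof
      assume "x \<in> interior K"
      then obtain e where e: "e > 0" "cball x e \<subseteq> K" by (auto simp: mem_interior_cball)
      define t where "t = 1 + e / norm x"
      have "t *\<^sub>R x = x + (e / norm x) *\<^sub>R x" by (simp add: t_def scaleR_left_distrib)
      then have "t *\<^sub>R x \<in> K" using e \<open>x \<noteq> 0\<close> by (intro subsetD[OF e(2)]) (simp add: dist_norm)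
      moreover have "t > 1" using e \<open>x \<noteq> 0\<close> by (simp add: t_def)
      ultimately show False using x by (simp add: K_def N_scaleR)
    qed
    moreover have "x \<in> closure K" using x closure_subset[of K] by (auto simp: K_def)
    ultimately show "x \<in> frontier K" by (simp add: frontier_def)
  qed
qed

text \<open>
  The boundary point of \<open>K\<close> in the direction \<open>u\<close> is \<open>u / N u\<close>.
\<close>

lemma mem_radial_gauss_image_iff:
  assumes u: "norm u = 1"
  shows "u \<in> radial_gauss_image K E \<longleftrightarrow> (\<exists>v\<in>E. (u /\<^sub>R N u) \<bullet> v = support_fun K v)"
proof
  have Nu: "N u > 0" using u by (intro N_pos) auto
  show "\<exists>v\<in>E. (u /\<^sub>R N u) \<bullet> v = support_fun K v" if image: "u \<in> radial_gauss_image K E"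
  proof -
    obtain x v where x: "u = (1 / norm x) *\<^sub>R x" "v \<in> E" "N x = 1" "x \<bullet> v = support_fun K v"
      using image unfolding radial_gauss_image_def frontier_K support_hyperplane_def by blast
    then have "x \<noteq> 0" by auto
    then have "N u = 1 / norm x" using x by (simp add: N_scaleR)
    then have "u /\<^sub>R N u = x" using x \<open>x \<noteq> 0\<close> by simp
    with x show ?thesis by auto
  qed
  show "u \<in> radial_gauss_image K E" if "\<exists>v\<in>E. (u /\<^sub>R N u) \<bullet> v = support_fun K v"
  proof -
    have "N (u /\<^sub>R N u) = 1" using Nu by (subst N_scaleR) auto
    moreover have "u = (1 / norm (u /\<^sub>R N u)) *\<^sub>R (u /\<^sub>R N u)"
      using Nu u by simp
    ultimately show ?thesis
      using that unfolding radial_gauss_image_def frontier_K support_hyperplane_def by blast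
  qed
qed

lemma radial_gauss_image_subset_sphere: "radial_gauss_image K E \<subseteq> sphere 0 1"
proof
  fix u assume "u \<in> radial_gauss_image K E"
  then obtain x where "u = (1 / norm x) *\<^sub>R x" "N x = 1"
    by (auto simp: radial_gauss_image_def frontier_K)
  moreover from this have "x \<noteq> 0" by auto
  ultimately show "u \<in> sphere 0 1" by simp
qed

lemma scaled_in_K: "x \<noteq> 0 \<Longrightarrow> x /\<^sub>R N x \<in> K"
  using N_pos[of x] by (simp add: K_def N_scaleR)

lemma support_fun_K_upper: "x \<in> K \<Longrightarrow> x \<bullet> v \<le> support_fun K v"
proof -
  assume "x \<in> K"
  obtain c where c: "0 < c" "\<And>x. c * norm x \<le> N x" using N_bounds by metis
  have "v \<bullet> y \<le> norm v / c" if "y \<in> K" for y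
  proof -
    have "c * norm y \<le> 1" using c(2)[of y] that by (simp add: K_def)
    then have "norm y \<le> 1 / c" using c(1) by (simp add: field_simps)
    then have "norm v * norm y \<le> norm v * (1 / c)" by (rule mult_left_mono) simp
    then show ?thesis using norm_cauchy_schwarz[of v y] by simp
  qed
  then have "bdd_above ((\<bullet>) v ` K)" by (auto simp: bdd_above_def)
  then show ?thesis
    unfolding support_fun_def using \<open>x \<in> K\<close> by (subst inner_commute) (rule cSUP_upper)
qed

lemma support_fun_K_pos: "v \<noteq> 0 \<Longrightarrow> support_fun K v > 0"
proof -
  assume "v \<noteq> 0"
  then have "0 < (v /\<^sub>R N v) \<bullet> v" using N_pos[of v] by simp
  also have "\<dots> \<le> support_fun K v" using \<open>v \<noteq> 0\<close> by (intro support_fun_K_upper scaled_in_K)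
  finally show ?thesis .
qed

lemma W_subset_hull: "W \<subseteq> W_hull"
  using support_fun_upper[OF compact_W] by (auto simp: W_hull_def)

lemma compact_W_hull: "compact W_hull"
proof -
  obtain L where L: "\<And>x. N x \<le> L * norm x" using N_bounds by metis
  have "norm w \<le> L" if "w \<in> W_hull" for w
  proof (cases "w = 0")
    case False
    have "norm w * norm w = w \<bullet> w" by (simp add: power2_norm_eq_inner flip: power2_eq_square)
    also have "\<dots> \<le> L * norm w" using that L[of w] by (auto simp: W_hull_def intro: order_trans)
    finally show ?thesis using False by simp
  next
    case True
    obtain i :: 'a where "i \<in> Basis" using nonempty_Basis by blast
    then show ?thesis using True L[of i] N_nonneg[of i] by simp
  qed
  then have "bounded W_hull" by (auto simp: bounded_iff)
  moreover have "closed W_hull"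
    unfolding W_hull_def by (intro closed_Collect_all closed_Collect_le continuous_intros)
  ultimately show ?thesis by (simp add: compact_eq_bounded_closed)
qed

lemma W_hull_nonempty: "W_hull \<noteq> {}"
  using W_subset_hull W_nonempty by auto

lemma support_fun_W_hull: "support_fun W_hull x = N x"
proof (rule antisym)
  show "support_fun W_hull x \<le> N x"
    unfolding support_fun_le_iff[OF compact_W_hull W_hull_nonempty] by (auto simp: W_hull_def)
  show "N x \<le> support_fun W_hull x"
    unfolding support_fun_le_iff[OF compact_W W_nonempty]
    using W_subset_hull support_fun_upper[OF compact_W_hull] by auto
qed

lemma negligible_Z: "negligible Z"
  unfolding Z_def by (rule negligible_multiple_maximizers[OF compact_W_hull W_hull_nonempty])

lemma borel_Z: "Z \<in> sets borel"
  unfolding Z_def by (rule borel_multiple_maximizers[OF compact_W_hull W_hull_nonempty])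

lemma Z_cone:
  assumes "u \<in> Z" "t > 0"
  shows "t *\<^sub>R u \<in> Z"
proof -
  obtain v w where "v \<in> W_hull" "w \<in> W_hull" "v \<noteq> w" "u \<bullet> v = N u" "u \<bullet> w = N u"
    using assms(1) unfolding Z_def multiple_maximizers_def support_fun_W_hull by blast
  moreover from this have "(t *\<^sub>R u) \<bullet> v = N (t *\<^sub>R u)" "(t *\<^sub>R u) \<bullet> w = N (t *\<^sub>R u)"
    using assms(2) by (simp_all add: N_scaleR)
  ultimately show ?thesis
    unfolding Z_def multiple_maximizers_def support_fun_W_hull by blast
qed

text \<open>
  Off \<open>Z\<close> this is the gradient of the gauge function, that is, the point of the polar body that is dual
  to the direction \<open>u\<close>.
\<close>

definition \<omega> :: "'a \<Rightarrow> 'a" where "\<omega> = the_maximizer W_hull"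

lemma \<omega>_unique: "u \<notin> Z \<Longrightarrow> w \<in> W_hull \<Longrightarrow> u \<bullet> w = N u \<Longrightarrow> \<omega> u = w"
  unfolding \<omega>_def Z_def by (rule the_maximizer_unique[OF compact_W_hull]) (simp_all add: support_fun_W_hull)

text \<open>
  A maximizer in \<open>W\<close> exists and is also a maximizer in \<open>W_hull\<close>, where there is only one.
\<close>

lemma \<omega>_in_W:
  assumes "u \<notin> Z"
  shows "\<omega> u \<in> W"
proof -
  have w: "the_maximizer W u \<in> W" "u \<bullet> the_maximizer W u = N u"
    by (rule the_maximizer[OF compact_W W_nonempty])+
  then have "\<omega> u = the_maximizer W u"
    using W_subset_hull assms by (intro \<omega>_unique) auto
  with w show ?thesis by simp
qed

lemma inner_\<omega>: "u \<bullet> \<omega> u = N u"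
  unfolding \<omega>_def using the_maximizer[OF compact_W_hull W_hull_nonempty, of u]
  by (simp add: support_fun_W_hull)

lemma \<omega>_nonzero:
  assumes "u \<noteq> 0"
  shows "\<omega> u \<noteq> 0"
proof
  assume "\<omega> u = 0"
  then have "N u = 0" using inner_\<omega>[of u] by simp
  with N_pos[OF assms] show False by simp
qed

lemma continuous_on_\<omega>: "continuous_on (- Z) \<omega>"
  unfolding Z_def \<omega>_def by (rule continuous_on_the_maximizer[OF compact_W_hull W_hull_nonempty])

text \<open>
  If \<open>v\<close> is a normal at \<open>u / N u\<close>, then \<open>v\<close> divided by the value of the support function of \<open>K\<close> lies in
  the polar body and is a maximizer there, so it is \<open>\<omega> u\<close>. Conversely, \<open>\<omega> u\<close> bounds \<open>K\<close> by a supporting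
  hyperplane through \<open>u / N u\<close>.
\<close>

lemma normal_iff:
  assumes u: "norm u = 1" "u \<notin> Z" and v: "norm v = 1"
  shows "(u /\<^sub>R N u) \<bullet> v = support_fun K v \<longleftrightarrow> v = sgn (\<omega> u)"
proof
  have Nu: "N u > 0" using u by (intro N_pos) auto
  show "v = sgn (\<omega> u)" if eq: "(u /\<^sub>R N u) \<bullet> v = support_fun K v"
  proof -
    define s where "s = support_fun K v"
    have "v \<noteq> 0" using v by auto
    then have s: "s > 0" unfolding s_def by (rule support_fun_K_pos)
    have "x \<bullet> (v /\<^sub>R s) \<le> N x" for x
    proof (cases "x = 0")
      case False
      have "(x /\<^sub>R N x) \<bullet> v \<le> s"
        unfolding s_def by (rule support_fun_K_upper[OF scaled_in_K[OF False]])
      then show ?thesis using s N_pos[OF False] by (simp add: field_simps)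
    qed simp
    then have "v /\<^sub>R s \<in> W_hull" by (simp add: W_hull_def)
    moreover have "u \<bullet> (v /\<^sub>R s) = N u"
      using eq s Nu unfolding s_def[symmetric] by (simp add: field_simps)
    ultimately have "\<omega> u = v /\<^sub>R s" using u by (intro \<omega>_unique) auto
    then show "v = sgn (\<omega> u)" using s v by (simp add: sgn_div_norm)
  qed
  show "(u /\<^sub>R N u) \<bullet> v = support_fun K v" if eq: "v = sgn (\<omega> u)"
  proof -
    have "u \<noteq> 0" using u by auto
    then have w: "norm (\<omega> u) > 0" using \<omega>_nonzero[of u] by simp
    have "support_fun K v \<le> 1 / norm (\<omega> u)"
      unfolding support_fun_def
    proof (rule cSUP_least)
      have "0 \<in> K" by (simp add: K_def)
      then show "K \<noteq> {}" by blast
      fix x assume "x \<in> K"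
      then have "x \<bullet> \<omega> u \<le> 1"
        using u \<omega>_in_W[of u] support_fun_upper[OF compact_W, of "\<omega> u" x] by (simp add: K_def)
      then show "v \<bullet> x \<le> 1 / norm (\<omega> u)"
        using w by (simp add: eq sgn_div_norm inner_commute[of _ x] field_simps)
    qed
    moreover have "(u /\<^sub>R N u) \<bullet> v = 1 / norm (\<omega> u)"
      using w Nu by (simp add: eq sgn_div_norm inner_\<omega> field_simps)
    moreover have "(u /\<^sub>R N u) \<bullet> v \<le> support_fun K v"
      using u by (intro support_fun_K_upper scaled_in_K) auto
    ultimately show ?thesis by simp
  qed
qed

end

section \<open>Images of signed measures\<close>

text \<open>
  The supremum over the measurable subsets \<open>F\<close> of \<open>E\<close> is attained at the part of \<open>E\<close> on which the
  density \<open>c\<close> is positive.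
\<close>

lemma jordan_pos_eq_density:
  fixes c :: "'a \<Rightarrow> real"
  assumes sets: "sets M' = sets M" and c: "integrable M c"
    and \<nu>: "\<And>E. E \<in> sets M \<Longrightarrow> \<nu> E = (LINT x|M. indicator E x * c x)"
  shows "jordan_pos M' \<nu> = density M (\<lambda>x. ennreal (max 0 (c x)))"
proof -
  have [measurable]: "c \<in> borel_measurable M" using c by auto
  have int: "integrable M (\<lambda>x. indicator E x * c x)" "integrable M (\<lambda>x. indicator E x * max 0 (c x))"
    if "E \<in> sets M" for E
    using integrable_mult_indicator[OF that c] integrable_mult_indicator[OF that, of "\<lambda>x. max 0 (c x)"] c
    by simp_all
  have nn: "(\<integral>\<^sup>+x. ennreal (max 0 (c x)) * indicator E x \<partial>M) =
      ennreal (LINT x|M. indicator E x * max 0 (c x))" if "E \<in> sets M" for E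
    using int(2)[OF that]
    by (subst nn_integral_eq_integral[symmetric])
       (auto intro!: nn_integral_cong simp: indicator_def)
  have sup: "(SUP F\<in>{F \<in> sets M. F \<subseteq> E}. ennreal (\<nu> F)) =
      emeasure (density M (\<lambda>x. ennreal (max 0 (c x)))) E" if E: "E \<in> sets M" for E
  proof (rule antisym)
    show "(SUP F\<in>{F \<in> sets M. F \<subseteq> E}. ennreal (\<nu> F)) \<le> emeasure (density M (\<lambda>x. ennreal (max 0 (c x)))) E"
    proof (rule SUP_least)
      fix F assume F: "F \<in> {F \<in> sets M. F \<subseteq> E}"
      have "\<nu> F = (LINT x|M. indicator F x * c x)" using F \<nu> by auto
      also have "\<dots> \<le> (LINT x|M. indicator F x * max 0 (c x))"
        using F by (intro integral_mono int) (auto simp: indicator_def)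
      also have "\<dots> \<le> (LINT x|M. indicator E x * max 0 (c x))"
        using F E by (intro integral_mono int) (auto simp: indicator_def)
      finally show "ennreal (\<nu> F) \<le> emeasure (density M (\<lambda>x. ennreal (max 0 (c x)))) E"
        using E by (simp add: emeasure_density nn ennreal_leI)
    qed
    define F where "F = E \<inter> {x \<in> space M. c x > 0}"
    have F: "F \<in> sets M" unfolding F_def using E by measurable
    have "emeasure (density M (\<lambda>x. ennreal (max 0 (c x)))) E = ennreal (LINT x|M. indicator E x * max 0 (c x))"
      using E by (simp add: emeasure_density nn)
    also have "(LINT x|M. indicator E x * max 0 (c x)) = (LINT x|M. indicator F x * c x)"
      by (intro Bochner_Integration.integral_cong) (auto simp: F_def indicator_def)
    also have "\<dots> = \<nu> F" using F \<nu> by simp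
    also have "ennreal (\<nu> F) \<le> (SUP F\<in>{F \<in> sets M. F \<subseteq> E}. ennreal (\<nu> F))"
      using F by (intro SUP_upper) (auto simp: F_def)
    finally show "emeasure (density M (\<lambda>x. ennreal (max 0 (c x)))) E \<le>
        (SUP F\<in>{F \<in> sets M. F \<subseteq> E}. ennreal (\<nu> F))" .
  qed
  let ?D = "density M (\<lambda>x. ennreal (max 0 (c x)))"
  have space: "space M' = space M" using sets by (rule sets_eq_imp_space_eq)
  have "jordan_pos M' \<nu> = measure_of (space ?D) (sets ?D) (emeasure ?D)"
    unfolding jordan_pos_def sets space space_density sets_density
    by (rule measure_of_eq) (simp_all add: sets.space_closed sets.sigma_sets_eq sup)
  then show ?thesis by (simp only: measure_of_of_measure)
qed

lemma signed_set_integral_density: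
  fixes c f :: "'a \<Rightarrow> real"
  assumes sets: "sets M' = sets M" and c: "integrable M c"
    and \<nu>: "\<And>E. E \<in> sets M \<Longrightarrow> \<nu> E = (LINT x|M. indicator E x * c x)"
    and f: "(\<lambda>x. indicator A x * f x) \<in> borel_measurable M"
    and bounded: "\<And>x. x \<in> space M \<Longrightarrow> \<bar>indicator A x * f x\<bar> \<le> B"
  shows "signed_set_integral M' \<nu> A f = (LINT x|M. (indicator A x * f x) * c x)"
proof -
  have [measurable]: "c \<in> borel_measurable M" using c by auto
  note [measurable] = f
  have neg: "jordan_neg M' \<nu> = density M (\<lambda>x. ennreal (max 0 (- c x)))"
    unfolding jordan_neg_def by (rule jordan_pos_eq_density[OF sets]) (use c \<nu> in auto)
  have pos: "jordan_pos M' \<nu> = density M (\<lambda>x. ennreal (max 0 (c x)))"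
    by (rule jordan_pos_eq_density[OF sets c]) (rule \<nu>)
  have int: "integrable M (\<lambda>x. max 0 (d x) * (indicator A x * f x))" if "integrable M d" for d :: "'a \<Rightarrow> real"
  proof (rule Bochner_Integration.integrable_bound)
    show "integrable M (\<lambda>x. \<bar>B\<bar> * \<bar>d x\<bar>)" using that by auto
    have [measurable]: "d \<in> borel_measurable M" using that by auto
    show "(\<lambda>x. max 0 (d x) * (indicator A x * f x)) \<in> borel_measurable M" by measurable
    show "AE x in M. norm (max 0 (d x) * (indicator A x * f x)) \<le> norm (\<bar>B\<bar> * \<bar>d x\<bar>)"
    proof (rule AE_I2)
      fix x assume "x \<in> space M"
      then have "\<bar>max 0 (d x)\<bar> * \<bar>indicator A x * f x\<bar> \<le> \<bar>d x\<bar> * \<bar>B\<bar>"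
        using bounded[of x] by (intro mult_mono) auto
      then show "norm (max 0 (d x) * (indicator A x * f x)) \<le> norm (\<bar>B\<bar> * \<bar>d x\<bar>)"
        by (simp add: abs_mult mult.commute)
    qed
  qed
  have "signed_set_integral M' \<nu> A f =
      (LINT x|M. max 0 (c x) * (indicator A x * f x)) - (LINT x|M. max 0 (- c x) * (indicator A x * f x))"
    unfolding signed_set_integral_def pos neg set_lebesgue_integral_def
    by (simp add: integral_density)
  also have "\<dots> = (LINT x|M. max 0 (c x) * (indicator A x * f x) - max 0 (- c x) * (indicator A x * f x))"
    using c by (intro Bochner_Integration.integral_diff[symmetric] int) auto
  also have "\<dots> = (LINT x|M. (indicator A x * f x) * c x)"
    by (intro Bochner_Integration.integral_cong) (auto simp: max_def)
  finally show ?thesis .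
qed

text \<open>
  The image under \<open>\<alpha>\<close> of the measure with density \<open>w\<close> is absolutely continuous with respect to the
  image of the measure itself; \<open>p\<close> is the Radon-Nikodym derivative.
\<close>

lemma (in finite_measure) distr_density_Radon_Nikodym:
  fixes w :: "'a \<Rightarrow> real"
  assumes \<alpha>[measurable]: "\<alpha> \<in> measurable M M'" and w[measurable]: "w \<in> borel_measurable M"
    and nonneg: "\<And>x. 0 \<le> w x" and int: "integrable M w"
  obtains p where "integrable (distr M M' \<alpha>) p"
    "\<And>g::_ \<Rightarrow> real. g \<in> borel_measurable M' \<Longrightarrow>
       (LINT x|M. g (\<alpha> x) * w x) = (LINT y|distr M M' \<alpha>. g y * p y)"
proof -
  let ?\<mu> = "distr M M' \<alpha>"
  let ?D = "density M (\<lambda>x. ennreal (w x))"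
  let ?P = "distr ?D M' \<alpha>"
  interpret \<mu>: finite_measure ?\<mu> by (rule finite_measure_distr) fact
  have "emeasure ?D (space M) < top"
    using int nonneg by (simp add: emeasure_density nn_integral_eq_integral cong: nn_integral_cong)
  then interpret D: finite_measure ?D by (intro finite_measureI) (auto simp: less_top)
  have P: "finite_measure ?P" by (rule D.finite_measure_distr) simp
  have ac: "absolutely_continuous ?\<mu> ?P"
    unfolding absolutely_continuous_def
  proof
    fix E assume E: "E \<in> null_sets ?\<mu>"
    then have "\<alpha> -` E \<inter> space M \<in> null_sets M"
      by (auto simp: null_sets_def emeasure_distr)
    moreover have "absolutely_continuous M ?D" by (rule absolutely_continuousI_density) simp
    ultimately have "\<alpha> -` E \<inter> space M \<in> null_sets ?D" by (auto simp: absolutely_continuous_def)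
    then show "E \<in> null_sets ?P" using E by (auto simp: null_sets_def emeasure_distr)
  qed
  obtain p where p: "p \<in> borel_measurable ?\<mu>" "AE x in ?\<mu>. RN_deriv ?\<mu> ?P x = ennreal (p x)" "\<And>x. 0 \<le> p x"
    using \<mu>.real_RN_deriv[OF P ac] by auto
  have dens: "density ?\<mu> (\<lambda>x. ennreal (p x)) = ?P"
  proof -
    have "density ?\<mu> (\<lambda>x. ennreal (p x)) = density ?\<mu> (RN_deriv ?\<mu> ?P)"
      using p(1,2) by (intro density_cong) auto
    also have "\<dots> = ?P" by (rule \<mu>.density_RN_deriv[OF ac]) simp
    finally show ?thesis .
  qed
  have "(\<integral>\<^sup>+x. ennreal (p x) \<partial>?\<mu>) = emeasure ?P (space ?\<mu>)"
    unfolding dens[symmetric] using p(1)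
    by (subst emeasure_density) (auto intro!: nn_integral_cong simp: indicator_def)
  also have "\<dots> < top" using finite_measure.emeasure_finite[OF P] by (simp add: less_top)
  finally have "integrable ?\<mu> p"
    using p by (intro integrableI_nonneg) auto
  then show ?thesis
  proof (rule that)
    fix g :: "_ \<Rightarrow> real" assume g[measurable]: "g \<in> borel_measurable M'"
    have "(LINT x|M. g (\<alpha> x) * w x) = (LINT x|?D. g (\<alpha> x))"
      using nonneg by (subst integral_density) (auto simp: mult.commute)
    also have "\<dots> = (LINT y|?P. g y)"
      by (rule integral_distr[symmetric]) simp_all
    also have "\<dots> = (LINT y|?\<mu>. g y * p y)"
      unfolding dens[symmetric] using p by (subst integral_density) (auto simp: mult.commute)
    finally show "(LINT x|M. g (\<alpha> x) * w x) = (LINT y|?\<mu>. g y * p y)" .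
  qed
qed

text \<open>
  Integration with respect to the image of a signed measure is integration of the composition. This
  needs an argument because \<open>\<alpha>\<close> may identify points at which \<open>w\<close> has different signs: the
  Jordan decomposition of the image is then not the image of the Jordan decomposition. Both
  parts of \<open>w\<close> are therefore first replaced by densities \<open>p\<close> and \<open>q\<close> on the image, where the signed
  measure has the density \<open>p - q\<close>.
\<close>

lemma (in finite_measure) signed_set_integral_distr:
  fixes w f :: "_ \<Rightarrow> real"
  assumes \<alpha>[measurable]: "\<alpha> \<in> measurable M M'" and w: "integrable M w"
    and \<nu>: "\<And>E. E \<in> sets M' \<Longrightarrow> \<nu> E = (LINT x|M. indicator E (\<alpha> x) * w x)"
    and f: "(\<lambda>y. indicator A y * f y) \<in> borel_measurable M'"
    and bounded: "\<And>y. y \<in> space M' \<Longrightarrow> \<bar>indicator A y * f y\<bar> \<le> B"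
  shows "signed_set_integral M' \<nu> A f = (LINT x|M. (indicator A (\<alpha> x) * f (\<alpha> x)) * w x)"
proof -
  let ?\<mu> = "distr M M' \<alpha>"
  have [measurable]: "w \<in> borel_measurable M" using w by auto
  obtain p where p: "integrable ?\<mu> p" "\<And>g::_ \<Rightarrow> real. g \<in> borel_measurable M' \<Longrightarrow>
      (LINT x|M. g (\<alpha> x) * max 0 (w x)) = (LINT y|?\<mu>. g y * p y)"
    using distr_density_Radon_Nikodym[OF \<alpha>, of "\<lambda>x. max 0 (w x)"] w by auto
  obtain q where q: "integrable ?\<mu> q" "\<And>g::_ \<Rightarrow> real. g \<in> borel_measurable M' \<Longrightarrow>
      (LINT x|M. g (\<alpha> x) * max 0 (- w x)) = (LINT y|?\<mu>. g y * q y)"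
    using distr_density_Radon_Nikodym[OF \<alpha>, of "\<lambda>x. max 0 (- w x)"] w by auto
  have bint: "integrable N (\<lambda>x. g x * d x)"
    if "g \<in> borel_measurable N" "\<And>x. x \<in> space N \<Longrightarrow> \<bar>g x\<bar> \<le> b" "integrable N d"
    for N and g d :: "_ \<Rightarrow> real" and b
  proof (rule Bochner_Integration.integrable_bound)
    show "integrable N (\<lambda>x. b * \<bar>d x\<bar>)" using that by auto
    show "(\<lambda>x. g x * d x) \<in> borel_measurable N" using that by (intro borel_measurable_times) auto
    show "AE x in N. norm (g x * d x) \<le> norm (b * \<bar>d x\<bar>)"
      using that(2) by (intro AE_I2) (force simp: abs_mult intro!: mult_mono)
  qed
  have key: "(LINT x|M. g (\<alpha> x) * w x) = (LINT y|?\<mu>. g y * (p y - q y))"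
    if g[measurable]: "g \<in> borel_measurable M'" and b: "\<And>y. y \<in> space M' \<Longrightarrow> \<bar>g y\<bar> \<le> b"
    for g :: "_ \<Rightarrow> real" and b
  proof -
    have g\<alpha>: "(\<lambda>x. g (\<alpha> x)) \<in> borel_measurable M" by measurable
    have b\<alpha>: "\<bar>g (\<alpha> x)\<bar> \<le> b" if "x \<in> space M" for x
      using b measurable_space[OF \<alpha> that] by auto
    have "(LINT x|M. g (\<alpha> x) * w x) =
        (LINT x|M. g (\<alpha> x) * max 0 (w x) - g (\<alpha> x) * max 0 (- w x))"
      by (intro Bochner_Integration.integral_cong) (auto simp: max_def)
    also have "\<dots> = (LINT x|M. g (\<alpha> x) * max 0 (w x)) - (LINT x|M. g (\<alpha> x) * max 0 (- w x))"
      using w by (intro Bochner_Integration.integral_diff bint[OF g\<alpha> b\<alpha>]) auto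
    also have "\<dots> = (LINT y|?\<mu>. g y * p y) - (LINT y|?\<mu>. g y * q y)"
      using p(2)[OF g] q(2)[OF g] by simp
    also have "\<dots> = (LINT y|?\<mu>. g y * p y - g y * q y)"
      using p(1) q(1) b by (intro Bochner_Integration.integral_diff[symmetric] bint) auto
    finally show ?thesis by (simp add: right_diff_distrib)
  qed
  have "signed_set_integral M' \<nu> A f = (LINT y|?\<mu>. (indicator A y * f y) * (p y - q y))"
  proof (rule signed_set_integral_density)
    show "integrable ?\<mu> (\<lambda>y. p y - q y)" using p(1) q(1) by auto
    fix E assume "E \<in> sets ?\<mu>"
    then show "\<nu> E = (LINT y|?\<mu>. indicator E y * (p y - q y))"
      using \<nu>[of E] by (subst key[symmetric, where b = 1]) (auto simp: indicator_def)
  qed (use f bounded in auto)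
  also have "\<dots> = (LINT x|M. (indicator A (\<alpha> x) * f (\<alpha> x)) * w x)"
    by (rule key[symmetric, OF f bounded])
  finally show ?thesis .
qed

section \<open>The implicit equation and its solution\<close>

text \<open>
  The solution \<open>\<tau> u\<close> exceeds \<open>a\<close> if and only if \<open>F u a < c\<close>, and this condition on \<open>u\<close> is open. So
  continuity in each variable separately suffices, thanks to monotonicity.
\<close>

lemma ex_continuous_implicit_solution:
  fixes F :: "'a::metric_space \<Rightarrow> real \<Rightarrow> real"
  assumes mono: "\<And>u. u \<in> \<Omega> \<Longrightarrow> strict_mono_on {0<..} (F u)"
    and cont: "\<And>u. u \<in> \<Omega> \<Longrightarrow> continuous_on {0<..} (F u)"
    and cont': "\<And>t. t > 0 \<Longrightarrow> continuous_on \<Omega> (\<lambda>u. F u t)"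
    and lo: "\<And>u. u \<in> \<Omega> \<Longrightarrow> \<exists>t>0. F u t < c" and hi: "\<And>u. u \<in> \<Omega> \<Longrightarrow> \<exists>t>0. F u t > c"
  obtains \<tau> where "continuous_on \<Omega> \<tau>" "\<And>u. u \<in> \<Omega> \<Longrightarrow> \<tau> u > 0" "\<And>u. u \<in> \<Omega> \<Longrightarrow> F u (\<tau> u) = c"
proof -
  have less: "F u s < F u t \<longleftrightarrow> s < t" if "u \<in> \<Omega>" "s > 0" "t > 0" for u s t
    using strict_mono_onD[OF mono[OF that(1)], of s t] strict_mono_onD[OF mono[OF that(1)], of t s] that
    by (cases s t rule: linorder_cases) auto
  have "\<exists>t>0. F u t = c" if u: "u \<in> \<Omega>" for u
  proof -
    obtain a b where ab: "a > 0" "F u a < c" "b > 0" "F u b > c" using lo hi u by blast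
    then have "a < b" using less[OF u, of a b] by simp
    have "continuous_on {a..b} (F u)"
      by (rule continuous_on_subset[OF cont[OF u]]) (use ab in auto)
    then obtain t where "a \<le> t" "F u t = c"
      using IVT'[of "F u" a c b] ab \<open>a < b\<close> by auto
    with ab show ?thesis by (auto intro!: exI[of _ t])
  qed
  then obtain \<tau> where \<tau>: "\<And>u. u \<in> \<Omega> \<Longrightarrow> \<tau> u > 0" "\<And>u. u \<in> \<Omega> \<Longrightarrow> F u (\<tau> u) = c"
    by metis
  have "continuous_on \<Omega> \<tau>"
    unfolding continuous_on_def
  proof (intro ballI order_tendstoI)
    fix u a assume u: "u \<in> \<Omega>" and a: "a < \<tau> u"
    show "\<forall>\<^sub>F v in at u within \<Omega>. a < \<tau> v"
    proof (cases "a > 0")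
      case True
      have "((\<lambda>v. F v a) \<longlongrightarrow> F u a) (at u within \<Omega>)"
        using cont'[OF True] u by (simp add: continuous_on_def)
      moreover have "F u a < c" using less[OF u True \<tau>(1)[OF u]] a \<tau>(2)[OF u] by simp
      ultimately have "\<forall>\<^sub>F v in at u within \<Omega>. F v a < c" by (rule order_tendstoD)
      then show ?thesis
        unfolding eventually_at_filter
      proof (rule eventually_mono)
        fix v assume v: "v \<noteq> u \<longrightarrow> v \<in> \<Omega> \<longrightarrow> F v a < c"
        then show "v \<noteq> u \<longrightarrow> v \<in> \<Omega> \<longrightarrow> a < \<tau> v"
          using less[OF _ True \<tau>(1)] \<tau>(2) by metis
      qed
    next
      case False
      then show ?thesis
        unfolding eventually_at_filter using \<tau>(1) by (intro always_eventually) force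
    qed
  next
    fix u a assume u: "u \<in> \<Omega>" and a: "\<tau> u < a"
    then have "a > 0" using \<tau>(1)[OF u] by simp
    have "((\<lambda>v. F v a) \<longlongrightarrow> F u a) (at u within \<Omega>)"
      using cont'[OF \<open>a > 0\<close>] u by (simp add: continuous_on_def)
    moreover have "c < F u a" using less[OF u \<tau>(1)[OF u] \<open>a > 0\<close>] a \<tau>(2)[OF u] by simp
    ultimately have "\<forall>\<^sub>F v in at u within \<Omega>. c < F v a" by (rule order_tendstoD)
    then show "\<forall>\<^sub>F v in at u within \<Omega>. \<tau> v < a"
      unfolding eventually_at_filter
    proof (rule eventually_mono)
      fix v assume v: "v \<noteq> u \<longrightarrow> v \<in> \<Omega> \<longrightarrow> c < F v a"
      then show "v \<noteq> u \<longrightarrow> v \<in> \<Omega> \<longrightarrow> \<tau> v < a"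
        using less[OF _ \<tau>(1) \<open>a > 0\<close>] \<tau>(2) by metis
    qed
  qed
  with \<tau> show ?thesis using that by blast
qed

lemma class_ID_pos: "\<phi> \<in> class_I \<or> \<phi> \<in> class_D \<Longrightarrow> t > 0 \<Longrightarrow> \<phi> t > 0"
  by (auto simp: class_I_def class_D_def)

lemma class_I_less_iff: "\<phi> \<in> class_I \<Longrightarrow> s > 0 \<Longrightarrow> t > 0 \<Longrightarrow> \<phi> s < \<phi> t \<longleftrightarrow> s < t"
  using strict_mono_onD[of "{0<..}" \<phi> s t] strict_mono_onD[of "{0<..}" \<phi> t s]
  by (cases s t rule: linorder_cases) (auto simp: class_I_def)

lemma class_D_less_iff: "\<phi> \<in> class_D \<Longrightarrow> s > 0 \<Longrightarrow> t > 0 \<Longrightarrow> \<phi> s < \<phi> t \<longleftrightarrow> t < s"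
  using monotone_onD[of "{0<..}" "(<)" "(>)" \<phi> s t] monotone_onD[of "{0<..}" "(<)" "(>)" \<phi> t s]
  by (cases s t rule: linorder_cases) (auto simp: class_D_def)

lemma class_D_reciprocal:
  assumes "\<phi> \<in> class_D"
  shows "(\<lambda>t. \<phi> (1 / t)) \<in> class_I"
proof -
  have cont: "continuous_on {0<..} \<phi>" using assms by (simp add: class_D_def)
  have "continuous_on {0<..} (\<lambda>t. \<phi> (1 / t))"
    by (rule continuous_on_compose2[OF cont]) (auto intro!: continuous_intros)
  moreover have "strict_mono_on {0<..} (\<lambda>t. \<phi> (1 / t))"
    by (rule strict_mono_onI) (simp add: class_D_less_iff[OF assms] divide_strict_left_mono)
  moreover have "((\<lambda>t. \<phi> (1 / t)) \<longlongrightarrow> 0) (at_right 0)"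
    using assms filterlim_inverse_at_top_right
    by (auto simp: class_D_def inverse_eq_divide intro: filterlim_compose)
  moreover have "filterlim (\<lambda>t. \<phi> (1 / t)) at_top at_top"
    using assms filterlim_inverse_at_right_top
    by (auto simp: class_D_def inverse_eq_divide intro: filterlim_compose)
  moreover have "(\<lambda>t. \<phi> (1 / t)) \<in> {0<..} \<rightarrow> {0<..}" "\<phi> (1 / 1) = 1"
    using assms by (auto simp: class_D_def)
  ultimately show ?thesis by (simp add: class_I_def)
qed

text \<open>
  Passing to reciprocals of all functions and arguments turns the equation for decreasing \<open>\<phi>1\<close> and
  \<open>\<phi>2\<close> into one for increasing functions, by the previous lemma.
\<close>

lemma orlicz_perturbation_reciprocal:
  "orlicz_perturbation \<Omega> \<phi>1 \<phi>2 h1 h2 \<epsilon> h \<longleftrightarrow>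
   orlicz_perturbation \<Omega> (\<lambda>t. \<phi>1 (1 / t)) (\<lambda>t. \<phi>2 (1 / t)) (\<lambda>u. 1 / h1 u) (\<lambda>u. 1 / h2 u) \<epsilon> (\<lambda>u. 1 / h u)"
proof -
  have "(\<lambda>u. 1 / h u) \<in> pos_continuous \<Omega> \<longleftrightarrow> h \<in> pos_continuous \<Omega>" for h :: "'a \<Rightarrow> real"
  proof -
    have imp: "(\<lambda>u. 1 / k u) \<in> pos_continuous \<Omega>" if "k \<in> pos_continuous \<Omega>" for k :: "'a \<Rightarrow> real"
      using that by (force simp: pos_continuous_def intro!: continuous_intros)
    show ?thesis using imp[of h] imp[of "\<lambda>u. 1 / h u"] by auto
  qed
  then show ?thesis by (simp add: orlicz_perturbation_def)
qed

lemma ex1_orlicz_perturbation_I: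
  assumes \<phi>: "\<phi>1 \<in> class_I" "\<phi>2 \<in> class_I" and h: "h1 \<in> pos_continuous \<Omega>" "h2 \<in> pos_continuous \<Omega>"
    and "\<epsilon> > 0"
  shows "\<exists>h. orlicz_perturbation \<Omega> \<phi>1 \<phi>2 h1 h2 \<epsilon> h \<and>
    (\<forall>k. orlicz_perturbation \<Omega> \<phi>1 \<phi>2 h1 h2 \<epsilon> k \<longrightarrow> (\<forall>u\<in>\<Omega>. k u = h u))"
proof -
  \<comment> \<open>the unknown is \<open>t = 1 / h u\<close>, in which the left-hand side increases\<close>
  define F where "F = (\<lambda>u t. \<phi>1 (h1 u * t) + \<epsilon> * \<phi>2 (h2 u * t))"
  have pos: "h1 u > 0" "h2 u > 0" if "u \<in> \<Omega>" for u using h that by (auto simp: pos_continuous_def)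
  have cont: "continuous_on \<Omega> h1" "continuous_on \<Omega> h2" using h by (auto simp: pos_continuous_def)
  have cont\<phi>: "continuous_on {0<..} \<phi>1" "continuous_on {0<..} \<phi>2" using \<phi> by (auto simp: class_I_def)
  have mono: "strict_mono_on {0<..} (F u)" if "u \<in> \<Omega>" for u
  proof (rule strict_mono_onI)
    fix s t :: real assume st: "s \<in> {0<..}" "t \<in> {0<..}" "s < t"
    then have "\<phi>1 (h1 u * s) < \<phi>1 (h1 u * t)" "\<phi>2 (h2 u * s) < \<phi>2 (h2 u * t)"
      using pos[OF that] by (simp_all add: class_I_less_iff[OF \<phi>(1)] class_I_less_iff[OF \<phi>(2)])
    then show "F u s < F u t" unfolding F_def using \<open>\<epsilon> > 0\<close> by (intro add_strict_mono) auto
  qed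
  have c1: "continuous_on {0<..} (F u)" if "u \<in> \<Omega>" for u
    unfolding F_def using pos[OF that]
    by (intro continuous_intros continuous_on_compose2[OF cont\<phi>(1)] continuous_on_compose2[OF cont\<phi>(2)]) auto
  have c2: "continuous_on \<Omega> (\<lambda>u. F u t)" if "t > 0" for t
    unfolding F_def using pos that
    by (intro continuous_intros cont continuous_on_compose2[OF cont\<phi>(1)] continuous_on_compose2[OF cont\<phi>(2)]) auto
  have lim0: "((\<lambda>t. \<phi> (a * t)) \<longlongrightarrow> 0) (at_right 0)" and
       limtop: "filterlim (\<lambda>t. \<phi> (a * t)) at_top at_top" if "a > 0" "\<phi> \<in> class_I" for a and \<phi> :: "real \<Rightarrow> real"
  proof -
    have "filterlim (\<lambda>t. a * t) (at_right 0) (at_right 0)"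
      using \<open>a > 0\<close> unfolding filterlim_at_right_to_0[symmetric]
      by (auto simp: filterlim_at eventually_at_filter intro!: tendsto_eq_intros)
    then show "((\<lambda>t. \<phi> (a * t)) \<longlongrightarrow> 0) (at_right 0)"
      using that(2) by (auto simp: class_I_def intro: filterlim_compose)
    have "filterlim (\<lambda>t. a * t) at_top at_top"
      using \<open>a > 0\<close> by (intro filterlim_tendsto_pos_mult_at_top[OF tendsto_const] filterlim_ident)
    then show "filterlim (\<lambda>t. \<phi> (a * t)) at_top at_top"
      using that(2) by (auto simp: class_I_def intro: filterlim_compose)
  qed
  have lo: "\<exists>t>0. F u t < 1" if u: "u \<in> \<Omega>" for u
  proof -
    have "(F u \<longlongrightarrow> 0 + \<epsilon> * 0) (at_right 0)"
      unfolding F_def using pos[OF u] \<phi> by (intro tendsto_intros lim0)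
    then have "\<forall>\<^sub>F t in at_right 0. F u t < 1" by (rule order_tendstoD) simp
    moreover have "\<forall>\<^sub>F t in at_right 0. t > (0::real)" by (rule eventually_at_right_less)
    ultimately have "\<forall>\<^sub>F t in at_right 0. t > 0 \<and> F u t < 1" by eventually_elim simp
    then show ?thesis using eventually_happens'[OF trivial_limit_at_right_real] by blast
  qed
  have hi: "\<exists>t>0. F u t > 1" if u: "u \<in> \<Omega>" for u
  proof -
    have "\<forall>\<^sub>F t in at_top. \<phi>1 (h1 u * t) > 1"
      using limtop[OF pos(1)[OF u] \<phi>(1)] by (simp add: filterlim_at_top_dense)
    moreover have "\<forall>\<^sub>F t in at_top. t > (0::real)" by (rule eventually_gt_at_top)
    ultimately have "\<forall>\<^sub>F t in at_top. t > 0 \<and> F u t > 1"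
    proof eventually_elim
      case (elim t)
      have "h2 u * t > 0" using pos(2)[OF u] elim(2) by (rule mult_pos_pos)
      then have "\<phi>2 (h2 u * t) > 0" by (rule class_ID_pos[OF disjI1[OF \<phi>(2)]])
      then have "\<epsilon> * \<phi>2 (h2 u * t) > 0" using \<open>\<epsilon> > 0\<close> by simp
      with elim show ?case by (simp add: F_def)
    qed
    then show ?thesis using eventually_happens'[OF trivial_limit_at_top_linorder] by blast
  qed
  obtain \<tau> where \<tau>: "continuous_on \<Omega> \<tau>" "\<And>u. u \<in> \<Omega> \<Longrightarrow> \<tau> u > 0" "\<And>u. u \<in> \<Omega> \<Longrightarrow> F u (\<tau> u) = 1"
    using ex_continuous_implicit_solution[of \<Omega> F 1, OF mono c1 c2 lo hi] by blast
  show ?thesis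
  proof (intro exI[of _ "\<lambda>u. 1 / \<tau> u"] conjI allI impI ballI)
    have "continuous_on \<Omega> (\<lambda>u. 1 / \<tau> u)" using \<tau>(1,2) by (intro continuous_intros) force+
    then show "orlicz_perturbation \<Omega> \<phi>1 \<phi>2 h1 h2 \<epsilon> (\<lambda>u. 1 / \<tau> u)"
      using \<tau> by (simp add: orlicz_perturbation_def pos_continuous_def F_def)
    fix k u assume k: "orlicz_perturbation \<Omega> \<phi>1 \<phi>2 h1 h2 \<epsilon> k" and u: "u \<in> \<Omega>"
    then have "k u > 0" "F u (1 / k u) = 1"
      by (auto simp: orlicz_perturbation_def pos_continuous_def F_def)
    moreover have "inj_on (F u) {0<..}" using mono[OF u] by (rule strict_mono_on_imp_inj_on)
    ultimately have "1 / k u = \<tau> u" using \<tau>(2,3)[OF u] by (auto simp: inj_on_def)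
    from this[symmetric] show "k u = 1 / \<tau> u" by simp
  qed
qed

lemma ex1_orlicz_perturbation:
  assumes \<phi>: "(\<phi>1 \<in> class_I \<and> \<phi>2 \<in> class_I) \<or> (\<phi>1 \<in> class_D \<and> \<phi>2 \<in> class_D)"
    and h: "h1 \<in> pos_continuous \<Omega>" "h2 \<in> pos_continuous \<Omega>" and "\<epsilon> > 0"
  shows "\<exists>h. orlicz_perturbation \<Omega> \<phi>1 \<phi>2 h1 h2 \<epsilon> h \<and>
    (\<forall>k. orlicz_perturbation \<Omega> \<phi>1 \<phi>2 h1 h2 \<epsilon> k \<longrightarrow> (\<forall>u\<in>\<Omega>. k u = h u))"
  using \<phi>
proof
  assume "\<phi>1 \<in> class_I \<and> \<phi>2 \<in> class_I"
  then show ?thesis using ex1_orlicz_perturbation_I h \<open>\<epsilon> > 0\<close> by blast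
next
  assume D: "\<phi>1 \<in> class_D \<and> \<phi>2 \<in> class_D"
  let ?P = "orlicz_perturbation \<Omega> (\<lambda>t. \<phi>1 (1 / t)) (\<lambda>t. \<phi>2 (1 / t)) (\<lambda>u. 1 / h1 u) (\<lambda>u. 1 / h2 u) \<epsilon>"
  have "(\<lambda>u. 1 / h1 u) \<in> pos_continuous \<Omega>" "(\<lambda>u. 1 / h2 u) \<in> pos_continuous \<Omega>"
    using h by (force simp: pos_continuous_def intro!: continuous_intros)+
  then have "\<exists>h. ?P h \<and> (\<forall>k. ?P k \<longrightarrow> (\<forall>u\<in>\<Omega>. k u = h u))"
    using D \<open>\<epsilon> > 0\<close> by (intro ex1_orlicz_perturbation_I class_D_reciprocal) auto
  then obtain h where h: "?P h" "\<And>k u. ?P k \<Longrightarrow> u \<in> \<Omega> \<Longrightarrow> k u = h u" by blast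
  show ?thesis
  proof (intro exI[of _ "\<lambda>u. 1 / h u"] conjI allI impI ballI)
    show "orlicz_perturbation \<Omega> \<phi>1 \<phi>2 h1 h2 \<epsilon> (\<lambda>u. 1 / h u)"
      by (subst orlicz_perturbation_reciprocal) (simp add: h(1))
    fix k u assume "orlicz_perturbation \<Omega> \<phi>1 \<phi>2 h1 h2 \<epsilon> k" "u \<in> \<Omega>"
    then have "1 / k u = h u" by (subst (asm) orlicz_perturbation_reciprocal) (rule h(2))
    from this[symmetric] show "k u = 1 / h u" by simp
  qed
qed

section \<open>Asymptotics of the perturbation\<close>

lemma deriv_C1:
  assumes "\<phi> C1_differentiable_on {0<..}"
  shows "\<And>t. t > (0::real) \<Longrightarrow> (\<phi> has_real_derivative deriv \<phi> t) (at t)" "continuous_on {0<..} (deriv \<phi>)"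
proof -
  obtain D where D: "\<And>t. t > 0 \<Longrightarrow> (\<phi> has_vector_derivative D t) (at t)" "continuous_on {0<..} D"
    using assms by (auto simp: C1_differentiable_on_def)
  then have D': "(\<phi> has_real_derivative D t) (at t)" if "t > 0" for t
    using that by (simp add: has_real_derivative_iff_has_vector_derivative)
  then have eq: "deriv \<phi> t = D t" if "t > 0" for t
    using that by (intro DERIV_imp_deriv)
  show "(\<phi> has_real_derivative deriv \<phi> t) (at t)" if "t > 0" for t
    using D'[OF that] eq[OF that] by simp
  show "continuous_on {0<..} (deriv \<phi>)"
    using D(2) by (rule continuous_on_eq) (simp add: eq)
qed

text \<open>
  Used with \<open>r = h2 u / h1 u\<close> and \<open>y = h1 u / h u\<close>, where \<open>h\<close> solves the equation. The perturbation term
  is positive, so \<open>\<phi>1 y < 1\<close>, and the perturbation term is then bounded by its value at \<open>y = 1\<close> for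
  increasing as well as for decreasing functions.
\<close>

lemma class_ID_shift:
  assumes \<phi>: "(\<phi>1 \<in> class_I \<and> \<phi>2 \<in> class_I) \<or> (\<phi>1 \<in> class_D \<and> \<phi>2 \<in> class_D)"
    and "y > 0" "\<phi>1 y < 1" "r > 0"
  shows "\<phi>2 (r * y) \<le> \<phi>2 r"
  using \<phi>
proof
  assume I: "\<phi>1 \<in> class_I \<and> \<phi>2 \<in> class_I"
  then have "y < 1" using assms class_I_less_iff[of \<phi>1 y 1] by (auto simp: class_I_def)
  then show ?thesis using assms I class_I_less_iff[of \<phi>2 "r * y" r] by (simp add: less_imp_le)
next
  assume D: "\<phi>1 \<in> class_D \<and> \<phi>2 \<in> class_D"
  then have "1 < y" using assms class_D_less_iff[of \<phi>1 y 1] by (auto simp: class_D_def)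
  then show ?thesis using assms D class_D_less_iff[of \<phi>2 "r * y" r] by (simp add: less_imp_le)
qed

lemma class_ID_near_1:
  fixes \<phi> :: "real \<Rightarrow> real"
  assumes \<phi>: "\<phi> \<in> class_I \<or> \<phi> \<in> class_D" and \<eta>: "0 < \<eta>" "\<eta> < 1"
  obtains d where "d > 0" "\<And>y. y > 0 \<Longrightarrow> 1 - d < \<phi> y \<Longrightarrow> \<phi> y < 1 \<Longrightarrow> \<bar>y - 1\<bar> < \<eta>"
  using \<phi>
proof
  assume I: "\<phi> \<in> class_I"
  then have one: "\<phi> 1 = 1" by (simp add: class_I_def)
  show ?thesis
  proof (rule that)
    show "1 - \<phi> (1 - \<eta>) > 0" using class_I_less_iff[OF I, of "1 - \<eta>" 1] \<eta> one by simp
    fix y :: real assume "y > 0" "1 - (1 - \<phi> (1 - \<eta>)) < \<phi> y" "\<phi> y < 1"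
    then show "\<bar>y - 1\<bar> < \<eta>"
      using class_I_less_iff[OF I, of "1 - \<eta>" y] class_I_less_iff[OF I, of y 1] \<eta> one by simp
  qed
next
  assume D: "\<phi> \<in> class_D"
  then have one: "\<phi> 1 = 1" by (simp add: class_D_def)
  show ?thesis
  proof (rule that)
    show "1 - \<phi> (1 + \<eta>) > 0" using class_D_less_iff[OF D, of "1 + \<eta>" 1] \<eta> one by simp
    fix y :: real assume "y > 0" "1 - (1 - \<phi> (1 + \<eta>)) < \<phi> y" "\<phi> y < 1"
    then show "\<bar>y - 1\<bar> < \<eta>"
      using class_D_less_iff[OF D, of "1 + \<eta>" y] class_D_less_iff[OF D, of y 1] \<eta> one by simp
  qed
qed

text \<open>
  The mean value theorem for \<open>\<phi>1\<close> between \<open>1\<close> and \<open>h1 u / h u\<close>, applied to the equation for \<open>h\<close>.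
\<close>

lemma orlicz_perturbation_quotient:
  fixes \<Omega> :: "'a::euclidean_space set"
  assumes \<phi>: "(\<phi>1 \<in> class_I \<and> \<phi>2 \<in> class_I) \<or> (\<phi>1 \<in> class_D \<and> \<phi>2 \<in> class_D)"
    and "\<phi>1 C1_differentiable_on {0<..}" and nz: "\<And>t. t > 0 \<Longrightarrow> deriv \<phi>1 t \<noteq> 0"
    and "\<epsilon> > 0" and P: "orlicz_perturbation \<Omega> \<phi>1 \<phi>2 h1 h2 \<epsilon> h"
    and u: "u \<in> \<Omega>" and pos: "h1 u > 0" "h2 u > 0"
  obtains \<xi> where "\<bar>\<xi> - 1\<bar> \<le> \<bar>h1 u / h u - 1\<bar>" "\<xi> > 0"
    "(1 - h1 u / h u) / \<epsilon> = \<phi>2 (h2 u / h1 u * (h1 u / h u)) / deriv \<phi>1 \<xi>"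
    "\<phi>1 (h1 u / h u) = 1 - \<epsilon> * \<phi>2 (h2 u / h1 u * (h1 u / h u))"
proof -
  define y where "y = h1 u / h u"
  have hu: "h u > 0" using P u by (auto simp: orlicz_perturbation_def pos_continuous_def)
  have y: "y > 0" using hu pos by (simp add: y_def)
  have eq: "h2 u / h1 u * y = h2 u / h u" using pos by (simp add: y_def)
  have \<phi>y: "\<phi>1 y = 1 - \<epsilon> * \<phi>2 (h2 u / h1 u * y)"
    using P u unfolding eq by (auto simp: orlicz_perturbation_def y_def algebra_simps)
  have \<phi>1_1: "\<phi>1 1 = 1" using \<phi> by (auto simp: class_I_def class_D_def)
  have "\<phi>2 \<in> class_I \<or> \<phi>2 \<in> class_D" using \<phi> by auto
  then have "\<phi>2 (h2 u / h1 u * y) > 0" using pos y by (simp add: class_ID_pos)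
  then have "y \<noteq> 1" using \<phi>y \<phi>1_1 \<open>\<epsilon> > 0\<close> by auto
  have "\<exists>\<xi>. \<bar>\<xi> - 1\<bar> \<le> \<bar>y - 1\<bar> \<and> \<xi> > 0 \<and> 1 - \<phi>1 y = (1 - y) * deriv \<phi>1 \<xi>"
  proof (cases "y < 1")
    case True
    then obtain z where "y < z" "z < 1" "\<phi>1 1 - \<phi>1 y = (1 - y) * deriv \<phi>1 z"
      using MVT2[of y 1 \<phi>1 "deriv \<phi>1"] deriv_C1(1)[OF assms(2)] y by auto
    then show ?thesis using y \<phi>1_1 by (intro exI[of _ z]) auto
  next
    case False
    then have "1 < y" using \<open>y \<noteq> 1\<close> by simp
    then obtain z where "1 < z" "z < y" "\<phi>1 y - \<phi>1 1 = (y - 1) * deriv \<phi>1 z"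
      using MVT2[of 1 y \<phi>1 "deriv \<phi>1"] deriv_C1(1)[OF assms(2)] y by auto
    then show ?thesis using y \<phi>1_1 by (intro exI[of _ z]) (auto simp: algebra_simps)
  qed
  then obtain \<xi> where \<xi>: "\<bar>\<xi> - 1\<bar> \<le> \<bar>y - 1\<bar>" "\<xi> > 0" "1 - \<phi>1 y = (1 - y) * deriv \<phi>1 \<xi>" by blast
  then have "(1 - y) * deriv \<phi>1 \<xi> = \<epsilon> * \<phi>2 (h2 u / h1 u * y)" using \<phi>y by simp
  then have "(1 - y) / \<epsilon> = \<phi>2 (h2 u / h1 u * y) / deriv \<phi>1 \<xi>"
    using nz[OF \<xi>(2)] \<open>\<epsilon> > 0\<close> by (simp add: field_simps)
  with \<xi> \<phi>y show ?thesis by (intro that[of \<xi>]) (simp_all add: y_def)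
qed

text \<open>
  With \<open>y = h1 u / h_eps \<epsilon> u\<close> and \<open>r = h2 u / h1 u\<close>, the previous lemma writes the quotient as
  \<open>\<phi>2 (r * y) / deriv \<phi>1 \<xi>\<close>. Since \<open>1 - \<phi>1 y\<close> is at most a constant times \<open>\<epsilon>\<close>, the numbers \<open>y\<close> and
  \<open>\<xi>\<close> tend to \<open>1\<close> uniformly in \<open>u\<close>, and uniform continuity on a compact set gives the limit. It is the
  reciprocal of \<open>h_eps \<epsilon> u\<close>, not \<open>h_eps \<epsilon> u\<close> itself, that enters the gauge function.
\<close>

lemma orlicz_perturbation_asymptotics:
  fixes \<Omega> :: "'a::euclidean_space set" and h_eps :: "real \<Rightarrow> 'a \<Rightarrow> real"
  assumes \<Omega>: "compact \<Omega>" and h: "h1 \<in> pos_continuous \<Omega>" "h2 \<in> pos_continuous \<Omega>"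
    and \<phi>: "(\<phi>1 \<in> class_I \<and> \<phi>2 \<in> class_I) \<or> (\<phi>1 \<in> class_D \<and> \<phi>2 \<in> class_D)"
    and C1: "\<phi>1 C1_differentiable_on {0<..}" and nz: "\<And>t. t > 0 \<Longrightarrow> deriv \<phi>1 t \<noteq> 0"
    and P: "\<And>\<epsilon>. \<epsilon> > 0 \<Longrightarrow> orlicz_perturbation \<Omega> \<phi>1 \<phi>2 h1 h2 \<epsilon> (h_eps \<epsilon>)"
    and e: "e > 0"
  obtains \<delta> where "\<delta> > 0" "\<And>\<epsilon> u. 0 < \<epsilon> \<Longrightarrow> \<epsilon> < \<delta> \<Longrightarrow> u \<in> \<Omega> \<Longrightarrow>
    \<bar>(1 - h1 u / h_eps \<epsilon> u) / \<epsilon> - \<phi>2 (h2 u / h1 u) / deriv \<phi>1 1\<bar> < e"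
proof -
  define r where "r = (\<lambda>u. h2 u / h1 u)"
  have pos: "h1 u > 0" "h2 u > 0" if "u \<in> \<Omega>" for u using h that by (auto simp: pos_continuous_def)
  then have r_pos: "r u > 0" if "u \<in> \<Omega>" for u using that by (simp add: r_def)
  have cont_r: "continuous_on \<Omega> r"
    unfolding r_def using h by (intro continuous_intros) (force simp: pos_continuous_def)+
  have cont\<phi>2: "continuous_on {0<..} \<phi>2" using \<phi> by (auto simp: class_I_def class_D_def)
  have ID: "\<phi>1 \<in> class_I \<or> \<phi>1 \<in> class_D" "\<phi>2 \<in> class_I \<or> \<phi>2 \<in> class_D" using \<phi> by auto
  have compact_r: "compact (r ` \<Omega>)" by (rule compact_continuous_image[OF cont_r \<Omega>])
  have "continuous_on \<Omega> (\<lambda>u. \<phi>2 (r u))"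
    by (rule continuous_on_compose2[OF cont\<phi>2 cont_r]) (use r_pos in auto)
  then have "bounded ((\<lambda>u. \<phi>2 (r u)) ` \<Omega>)"
    by (intro compact_imp_bounded compact_continuous_image \<Omega>)
  then obtain M where M: "M > 0" "\<And>u. u \<in> \<Omega> \<Longrightarrow> \<phi>2 (r u) \<le> M"
    unfolding bounded_pos by (force simp: abs_le_iff)
  define Q where "Q = (\<lambda>p. \<phi>2 (fst p * fst (snd p)) / deriv \<phi>1 (snd (snd p)))"
  let ?C = "r ` \<Omega> \<times> {1/2..3/2::real} \<times> {1/2..3/2::real}"
  have "compact ?C" by (intro compact_Times compact_r compact_Icc)
  moreover have "continuous_on ?C Q"
    unfolding Q_def
  proof (intro continuous_on_divide)
    show "continuous_on ?C (\<lambda>p. \<phi>2 (fst p * fst (snd p)))"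
      by (rule continuous_on_compose2[OF cont\<phi>2]) (auto intro!: continuous_intros mult_pos_pos r_pos)
    show "continuous_on ?C (\<lambda>p. deriv \<phi>1 (snd (snd p)))"
      by (rule continuous_on_compose2[OF deriv_C1(2)[OF C1]]) (auto intro!: continuous_intros)
    show "\<forall>p\<in>?C. deriv \<phi>1 (snd (snd p)) \<noteq> 0" using nz by auto
  qed
  ultimately have "uniformly_continuous_on ?C Q"
    by (rule compact_uniformly_continuous[rotated])
  then obtain d where d: "d > 0" "\<And>p q. p \<in> ?C \<Longrightarrow> q \<in> ?C \<Longrightarrow> dist q p < d \<Longrightarrow> dist (Q q) (Q p) < e"
    unfolding uniformly_continuous_on_def using e by metis
  define \<eta> where "\<eta> = min (1/2) (d / 2)"
  have \<eta>: "0 < \<eta>" "\<eta> < 1" "\<eta> \<le> 1/2" "\<eta> \<le> d / 2" using d by (auto simp: \<eta>_def)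
  obtain c where c: "c > 0" "\<And>y. y > 0 \<Longrightarrow> 1 - c < \<phi>1 y \<Longrightarrow> \<phi>1 y < 1 \<Longrightarrow> \<bar>y - 1\<bar> < \<eta>"
    using class_ID_near_1[OF ID(1) \<eta>(1,2)] by blast
  show ?thesis
  proof (rule that)
    show "c / M > 0" using c M by simp
    fix \<epsilon> u assume \<epsilon>: "0 < \<epsilon>" "\<epsilon> < c / M" and u: "u \<in> \<Omega>"
    define y where "y = h1 u / h_eps \<epsilon> u"
    have "h_eps \<epsilon> u > 0" using P[OF \<epsilon>(1)] u by (auto simp: orlicz_perturbation_def pos_continuous_def)
    then have y: "y > 0" using pos[OF u] by (simp add: y_def)
    obtain \<xi> where \<xi>: "\<bar>\<xi> - 1\<bar> \<le> \<bar>y - 1\<bar>" "\<xi> > 0" "(1 - y) / \<epsilon> = \<phi>2 (r u * y) / deriv \<phi>1 \<xi>"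
      "\<phi>1 y = 1 - \<epsilon> * \<phi>2 (r u * y)"
      using orlicz_perturbation_quotient[OF \<phi> C1 nz \<epsilon>(1) P[OF \<epsilon>(1)] u pos[OF u]]
      unfolding y_def r_def by metis
    have "\<phi>2 (r u * y) > 0" using r_pos[OF u] y by (simp add: class_ID_pos[OF ID(2)])
    then have less1: "\<phi>1 y < 1" using \<xi>(4) \<epsilon>(1) by simp
    have "\<phi>2 (r u * y) \<le> M"
      using class_ID_shift[OF \<phi> y less1 r_pos[OF u]] M(2)[OF u] by simp
    then have "\<epsilon> * \<phi>2 (r u * y) \<le> \<epsilon> * M" using \<epsilon>(1) by simp
    also have "\<dots> < c" using \<epsilon>(2) M(1) by (simp add: field_simps)
    finally have "\<bar>y - 1\<bar> < \<eta>" using \<xi>(4) y less1 by (intro c(2)) auto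
    then have near: "\<bar>y - 1\<bar> < \<eta>" "\<bar>\<xi> - 1\<bar> < \<eta>" using \<xi>(1) by auto
    then have "(r u, y, \<xi>) \<in> ?C" "(r u, 1, 1) \<in> ?C"
      using u \<eta>(3) by (auto simp: abs_less_iff)
    moreover have "dist (r u, y, \<xi>) (r u, 1, 1) < d"
    proof -
      have "dist (r u, y, \<xi>) (r u, 1, 1) \<le> \<bar>y - 1\<bar> + \<bar>\<xi> - 1\<bar>"
        by (simp add: dist_Pair_Pair dist_real_def sqrt_sum_squares_le_sum_abs)
      then show ?thesis using near \<eta>(4) by simp
    qed
    ultimately have "dist (Q (r u, y, \<xi>)) (Q (r u, 1, 1)) < e" by (intro d(2))
    then show "\<bar>(1 - h1 u / h_eps \<epsilon> u) / \<epsilon> - \<phi>2 (h2 u / h1 u) / deriv \<phi>1 1\<bar> < e"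
      using \<xi>(3) by (simp add: Q_def dist_real_def y_def r_def)
  qed
qed

section \<open>Dual curvature measures as image measures\<close>

definition sphere_measure :: "'a::euclidean_space measure" where
  "sphere_measure = restrict_space (hausdorff_measure (DIM('a) - 1)) (sphere 0 1)"

lemma borel_sets_hausdorff_measure: "A \<in> sets borel \<Longrightarrow> A \<in> sets (hausdorff_measure m)"
  using sets_borel_subset_hausdorff by blast

lemma sphere_in_sets_hausdorff_measure [simp]:
  "sphere (a::'a::euclidean_space) r \<in> sets (hausdorff_measure m)"
  by (intro borel_sets_hausdorff_measure borel_closed closed_sphere)

lemma space_sphere_measure [simp]: "space sphere_measure = sphere 0 1"
  by (simp add: sphere_measure_def space_restrict_space)

lemma sets_sphere_measure:
  "A \<in> sets (sphere_measure :: 'a::euclidean_space measure) \<longleftrightarrow>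
     A \<subseteq> sphere 0 1 \<and> A \<in> sets (hausdorff_measure (DIM('a) - 1))"
  unfolding sphere_measure_def by (subst sets_restrict_space_iff) auto

lemma emeasure_sphere_measure:
  fixes A :: "'a::euclidean_space set"
  assumes "A \<in> sets sphere_measure"
  shows "emeasure sphere_measure A = hausdorff_outer (DIM('a) - 1) A"
proof -
  have A: "A \<subseteq> sphere 0 1" "A \<in> sets (hausdorff_measure (DIM('a) - 1))"
    using assms by (simp_all only: sets_sphere_measure)
  have "emeasure sphere_measure A = emeasure (hausdorff_measure (DIM('a) - 1)) A"
    unfolding sphere_measure_def by (rule emeasure_restrict_space) (use A in simp_all)
  then show ?thesis using emeasure_hausdorff_measure[OF A(2)] by simp
qed

lemma finite_measure_sphere_measure: "finite_measure (sphere_measure :: 'a::euclidean_space measure)"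
proof (rule finite_measureI)
  have "sphere (0::'a) 1 \<in> sets sphere_measure"
    by (simp add: sets_sphere_measure)
  then show "emeasure sphere_measure (space (sphere_measure :: 'a measure)) \<noteq> \<infinity>"
    using hausdorff_outer_sphere_finite[where 'a = 'a] by (simp add: emeasure_sphere_measure)
qed

text \<open>
  The \<sigma>-algebra of \<^const>\<open>sphere_measure\<close> contains the Borel sets of the sphere, but it is larger.
\<close>

lemma measurable_sphere_measureI:
  fixes f :: "'a::euclidean_space \<Rightarrow> 'b"
  assumes f: "f \<in> measurable (restrict_space borel (sphere 0 1)) M"
  shows "f \<in> measurable sphere_measure M"
proof (rule measurableI)
  show "f x \<in> space M" if "x \<in> space sphere_measure" for x
    using measurable_space[OF f, of x] that by (simp add: space_restrict_space)
  show "f -` A \<inter> space sphere_measure \<in> sets sphere_measure" if "A \<in> sets M" for A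
    using measurable_sets[OF f that]
    by (auto simp: space_restrict_space sets_restrict_space_iff sets_sphere_measure
             intro!: borel_sets_hausdorff_measure)
qed

lemma borel_measurable_sphere_measure_continuous:
  "continuous_on (sphere 0 1) f \<Longrightarrow> f \<in> borel_measurable sphere_measure"
  by (intro measurable_sphere_measureI borel_measurable_continuous_on_restrict)

lemma integrable_sphere_measure_continuous:
  fixes f :: "'a::euclidean_space \<Rightarrow> real"
  assumes "continuous_on (sphere 0 1) f"
  shows "integrable sphere_measure f"
proof -
  interpret finite_measure "sphere_measure :: 'a measure" by (rule finite_measure_sphere_measure)
  have "bounded (f ` sphere 0 1)"
    using assms by (intro compact_imp_bounded compact_continuous_image) auto
  then obtain B where "\<forall>x\<in>sphere 0 1. \<bar>f x\<bar> \<le> B" by (auto simp: bounded_iff)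
  then show ?thesis
    using assms by (intro integrable_const_bound[of _ B] borel_measurable_sphere_measure_continuous) auto
qed

lemma set_integral_sphere_measure:
  fixes f :: "'a::euclidean_space \<Rightarrow> real"
  assumes "A \<subseteq> sphere 0 1"
  shows "(LINT u:A|hausdorff_measure (DIM('a) - 1). f u) = (LINT u|sphere_measure. indicator A u * f u)"
proof -
  have "(LINT u|sphere_measure. indicator A u * f u) =
      (LINT u|hausdorff_measure (DIM('a) - 1). indicator (sphere 0 1) u *\<^sub>R (indicator A u * f u))"
    unfolding sphere_measure_def by (rule integral_restrict_space) simp
  also have "\<dots> = (LINT u:A|hausdorff_measure (DIM('a) - 1). f u)"
    unfolding set_lebesgue_integral_def using assms
    by (intro Bochner_Integration.integral_cong) (auto simp: indicator_def)
  finally show ?thesis by simp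
qed

lemma has_real_derivative_partial_t:
  "(\<lambda>s. G s u) differentiable (at t) \<Longrightarrow> ((\<lambda>s. G s u) has_real_derivative partial_t G t u) (at t)"
  unfolding partial_t_def by (simp add: DERIV_deriv_iff_real_differentiable)

context gauge_body
begin

lemma continuous_on_inverse_N: "continuous_on (sphere 0 1) (\<lambda>u. 1 / N u)"
proof -
  have "N u \<noteq> 0" if "u \<in> sphere 0 1" for u
  proof -
    have "u \<noteq> 0" using that by auto
    from N_pos[OF this] show ?thesis by simp
  qed
  then show ?thesis by (intro continuous_intros continuous_on_N) auto
qed

lemma continuous_on_sphere_compose:
  fixes F :: "real \<Rightarrow> 'a \<Rightarrow> real"
  assumes "continuous_on ({0<..} \<times> sphere 0 1) (\<lambda>(t, u). F t u)"
  shows "continuous_on (sphere 0 1) (\<lambda>u. F (1 / N u) u)"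
proof -
  have "continuous_on (sphere 0 1) (\<lambda>u. (\<lambda>(t, u). F t u) (1 / N u, u))"
    by (rule continuous_on_compose2[OF assms])
       (auto intro!: continuous_on_Pair continuous_on_inverse_N continuous_intros N_pos)
  then show ?thesis by simp
qed

lemma gen_dual_volume_K:
  "gen_dual_volume G K = (LINT u|sphere_measure. G (1 / N u) u)"
  unfolding gen_dual_volume_def set_integral_sphere_measure[OF order_refl]
proof (intro Bochner_Integration.integral_cong refl)
  fix u :: 'a assume "u \<in> space sphere_measure"
  then have "norm u = 1" "u \<noteq> 0" by auto
  then show "indicator (sphere 0 1) u * G (radial_fun K u) u = G (1 / N u) u"
    by (simp add: radial_fun_K)
qed

text \<open>
  The radial Gauss map. On the null set \<open>Z\<close>, where the normal is ambiguous, the identity serves as a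
  measurable default that keeps the map inside the sphere.
\<close>

definition \<alpha> :: "'a \<Rightarrow> 'a" where
  "\<alpha> u = (if u \<in> insert 0 Z then u else sgn (\<omega> u))"

lemma \<alpha>_eq: "norm u = 1 \<Longrightarrow> u \<notin> Z \<Longrightarrow> \<alpha> u = sgn (\<omega> u)"
  by (auto simp: \<alpha>_def)

lemma measurable_\<alpha>: "\<alpha> \<in> measurable sphere_measure (restrict_space borel (sphere 0 1))"
proof -
  have B: "- insert 0 Z \<in> sets borel"
    using borel_Z by (simp add: borel_comp)
  have "continuous_on (- insert 0 Z) (\<lambda>u. sgn (\<omega> u))"
    using \<omega>_nonzero
    by (intro continuous_intros continuous_on_subset[OF continuous_on_\<omega>]) auto
  then have "(\<lambda>u. indicator (- insert 0 Z) u *\<^sub>R sgn (\<omega> u)) \<in> borel_measurable borel"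
    using B by (intro borel_measurable_continuous_on_indicator)
  then have "(\<lambda>u. if u \<in> insert 0 Z then u else indicator (- insert 0 Z) u *\<^sub>R sgn (\<omega> u)) \<in> borel_measurable borel"
    using borel_Z by (intro measurable_If_set) auto
  also have "(\<lambda>u. if u \<in> insert 0 Z then u else indicator (- insert 0 Z) u *\<^sub>R sgn (\<omega> u)) = \<alpha>"
    by (auto simp: \<alpha>_def)
  finally have "\<alpha> \<in> borel_measurable borel" .
  then have "\<alpha> \<in> measurable (restrict_space borel (sphere 0 1)) (restrict_space borel (sphere 0 1))"
    using \<omega>_nonzero
    by (intro measurable_restrict_space2 measurable_restrict_space1)
       (auto simp: space_restrict_space \<alpha>_def norm_sgn)
  then show ?thesis by (rule measurable_sphere_measureI)
qed

lemma hausdorff_outer_Z: "hausdorff_outer (DIM('a) - 1) (sphere 0 1 \<inter> Z) = 0"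
  by (rule hausdorff_outer_null_cone[OF _ negligible_Z]) (auto intro: Z_cone)

lemma AE_not_Z: "AE u in sphere_measure. u \<notin> Z"
proof (rule AE_I')
  have "sphere 0 1 \<inter> Z \<in> null_sets (hausdorff_measure (DIM('a) - 1))"
    by (rule hausdorff_outer_null_sets[OF hausdorff_outer_Z])
  then show "sphere 0 1 \<inter> Z \<in> null_sets sphere_measure"
    using hausdorff_outer_Z by (auto simp: null_sets_def sets_sphere_measure emeasure_sphere_measure simp del: One_nat_def)
qed auto

lemma mem_radial_gauss_image_iff_\<alpha>:
  assumes "norm u = 1" "u \<notin> Z" "E \<subseteq> sphere 0 1"
  shows "u \<in> radial_gauss_image K E \<longleftrightarrow> \<alpha> u \<in> E"
proof -
  have "(\<exists>v\<in>E. (u /\<^sub>R N u) \<bullet> v = support_fun K v) \<longleftrightarrow> (\<exists>v\<in>E. v = sgn (\<omega> u))"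
    using assms normal_iff by (intro bex_cong refl) auto
  then show ?thesis using assms by (simp add: mem_radial_gauss_image_iff \<alpha>_eq)
qed

text \<open>
  Off \<open>Z\<close> the image is the preimage of \<open>E\<close> under the Borel map \<open>\<alpha>\<close>. Its part in \<open>Z\<close> may fail to be Borel
  but is measurable as a null set.
\<close>

lemma sets_radial_gauss_image:
  assumes E: "E \<in> sets (restrict_space borel (sphere 0 1))"
  shows "radial_gauss_image K E \<in> sets sphere_measure"
proof -
  have ES: "E \<subseteq> sphere 0 1" using E by (simp add: sets_restrict_space_iff)
  let ?I = "radial_gauss_image K E"
  have sub: "?I \<subseteq> sphere 0 1" by (rule radial_gauss_image_subset_sphere)
  have "hausdorff_outer (DIM('a) - 1) (?I \<inter> Z) = 0"
    using hausdorff_outer_mono[of "?I \<inter> Z" "sphere 0 1 \<inter> Z" "DIM('a) - 1"] sub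
    by (auto simp: hausdorff_outer_Z simp del: One_nat_def)
  then have null: "?I \<inter> Z \<in> sets sphere_measure"
    using sub hausdorff_outer_null_sets by (auto simp: sets_sphere_measure simp del: One_nat_def)
  have "\<alpha> -` E \<inter> space sphere_measure - Z \<in> sets sphere_measure"
  proof -
    have "sphere 0 1 \<inter> Z \<in> sets sphere_measure"
      by (auto simp: sets_sphere_measure borel_Z intro!: borel_sets_hausdorff_measure)
    then have "\<alpha> -` E \<inter> space sphere_measure - sphere 0 1 \<inter> Z \<in> sets sphere_measure"
      using measurable_sets[OF measurable_\<alpha> E] by (rule sets.Diff[rotated])
    also have "\<alpha> -` E \<inter> space sphere_measure - sphere 0 1 \<inter> Z = \<alpha> -` E \<inter> space sphere_measure - Z"
      by auto
    finally show ?thesis .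
  qed
  then have "(\<alpha> -` E \<inter> space sphere_measure - Z) \<union> (?I \<inter> Z) \<in> sets sphere_measure"
    using null by (rule sets.Un)
  also have "(\<alpha> -` E \<inter> space sphere_measure - Z) \<union> (?I \<inter> Z) = ?I"
    using sub mem_radial_gauss_image_iff_\<alpha>[OF _ _ ES] by auto
  finally show ?thesis .
qed

text \<open>
  The dual curvature measure is the image, under the radial Gauss map, of the measure on the sphere
  with density \<open>\<rho> G\<^sub>t(\<rho>, u) / n\<close>, where \<open>\<rho> = 1 / N u\<close>.
\<close>

lemma signed_set_integral_gen_dual_curvature:
  assumes G: "continuous_on ({0<..} \<times> sphere 0 1) (\<lambda>(t, u). partial_t G t u)"
    and f: "(\<lambda>u. indicator A u * f u) \<in> borel_measurable (restrict_space borel (sphere 0 1))"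
    and bounded: "\<And>u. u \<in> sphere 0 1 \<Longrightarrow> \<bar>indicator A u * f u\<bar> \<le> B"
  shows "real DIM('a) * signed_set_integral (restrict_space borel (sphere 0 1)) (gen_dual_curvature G K) A f =
    (LINT u|sphere_measure. (indicator A (\<alpha> u) * f (\<alpha> u)) * (1 / N u * partial_t G (1 / N u) u))"
proof -
  interpret sm: finite_measure "sphere_measure :: 'a measure" by (rule finite_measure_sphere_measure)
  define w where "w = (\<lambda>u. 1 / real DIM('a) * (1 / N u * partial_t G (1 / N u) u))"
  have cont: "continuous_on (sphere 0 1) w"
    unfolding w_def
    by (intro continuous_on_mult continuous_on_const continuous_on_inverse_N continuous_on_sphere_compose G)
  have w: "integrable sphere_measure w" by (rule integrable_sphere_measure_continuous[OF cont])
  have "signed_set_integral (restrict_space borel (sphere 0 1)) (gen_dual_curvature G K) A f =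
      (LINT u|sphere_measure. (indicator A (\<alpha> u) * f (\<alpha> u)) * w u)"
  proof (rule sm.signed_set_integral_distr[OF measurable_\<alpha> w _ f])
    fix E :: "'a set" assume E: "E \<in> sets (restrict_space borel (sphere 0 1))"
    then have ES: "E \<subseteq> sphere 0 1" by (simp add: sets_restrict_space_iff)
    let ?I = "radial_gauss_image K E"
    have "gen_dual_curvature G K E =
        1 / real DIM('a) * (LINT u|sphere_measure. indicator ?I u * (radial_fun K u * partial_t G (radial_fun K u) u))"
      unfolding gen_dual_curvature_def
      by (subst set_integral_sphere_measure[OF radial_gauss_image_subset_sphere]) simp
    also have "\<dots> = (LINT u|sphere_measure.
        1 / real DIM('a) * (indicator ?I u * (radial_fun K u * partial_t G (radial_fun K u) u)))"
      by (rule integral_mult_right_zero[symmetric])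
    also have "\<dots> = (LINT u|sphere_measure. indicator ?I u * w u)"
    proof (intro Bochner_Integration.integral_cong refl)
      fix u :: 'a assume "u \<in> space sphere_measure"
      then have "radial_fun K u = 1 / N u" by (intro radial_fun_K) auto
      then show "1 / real DIM('a) * (indicator ?I u * (radial_fun K u * partial_t G (radial_fun K u) u)) =
          indicator ?I u * w u"
        by (simp add: w_def)
    qed
    also have "\<dots> = (LINT u|sphere_measure. indicator E (\<alpha> u) * w u)"
    proof (rule integral_cong_AE)
      have [measurable]: "w \<in> borel_measurable sphere_measure" using w by auto
      show "(\<lambda>u. indicator ?I u * w u) \<in> borel_measurable sphere_measure"
        using sets_radial_gauss_image[OF E] by measurable
      have "(\<lambda>u. indicator E (\<alpha> u) :: real) \<in> borel_measurable sphere_measure"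
        by (rule measurable_compose[OF measurable_\<alpha> borel_measurable_indicator[OF E]])
      then show "(\<lambda>u. indicator E (\<alpha> u) * w u) \<in> borel_measurable sphere_measure"
        by measurable
      show "AE u in sphere_measure. indicator ?I u * w u = indicator E (\<alpha> u) * w u"
        using AE_not_Z AE_space
      proof eventually_elim
        case (elim u)
        then show ?case using mem_radial_gauss_image_iff_\<alpha>[OF _ _ ES, of u] by (simp add: indicator_def)
      qed
    qed
    finally show "gen_dual_curvature G K E = (LINT u|sphere_measure. indicator E (\<alpha> u) * w u)" .
  qed (use bounded in \<open>auto simp: space_restrict_space\<close>)
  then have "real DIM('a) * signed_set_integral (restrict_space borel (sphere 0 1)) (gen_dual_curvature G K) A f =
      (LINT u|sphere_measure. real DIM('a) * ((indicator A (\<alpha> u) * f (\<alpha> u)) * w u))"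
    by (simp only: integral_mult_right_zero)
  also have "\<dots> = (LINT u|sphere_measure. (indicator A (\<alpha> u) * f (\<alpha> u)) * (1 / N u * partial_t G (1 / N u) u))"
    by (intro Bochner_Integration.integral_cong refl) (simp add: w_def)
  finally show ?thesis .
qed

end

section \<open>Variation of the dual volume\<close>

text \<open>
  Danskin's theorem for a maximum over a compact set whose integrand is perturbed by factors
  \<open>1 - e n * \<tau> n w\<close>. Comparison of \<open>N n\<close> with the unperturbed maximum, at the maximizer of the one and
  of the other problem, encloses the difference quotient between two expressions. They have the same
  limit because the perturbed maximizers \<open>w n\<close> converge to the only unperturbed one.
\<close>

lemma danskin_quotient:
  fixes W :: "'a::euclidean_space set"
  assumes W: "compact W" "W \<noteq> {}" and x: "x \<notin> multiple_maximizers W"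
    and e: "\<And>n. e n > 0" "e \<longlonglongrightarrow> (0::real)"
    and \<tau>: "uniform_limit W \<tau> \<gamma> sequentially" and \<gamma>: "continuous_on W \<gamma>"
    and bound: "\<And>n w. w \<in> W \<Longrightarrow> \<bar>\<tau> n w\<bar> \<le> C"
    and upper: "\<And>n w. w \<in> W \<Longrightarrow> x \<bullet> w * (1 - e n * \<tau> n w) \<le> N n"
    and attained: "\<And>n. \<exists>w\<in>W. N n = x \<bullet> w * (1 - e n * \<tau> n w)"
  shows "(\<lambda>n. (support_fun W x - N n) / e n) \<longlonglongrightarrow> support_fun W x * \<gamma> (the_maximizer W x)"
proof -
  define N0 where "N0 = support_fun W x"
  define \<omega> where "\<omega> = the_maximizer W x"
  have \<omega>: "\<omega> \<in> W" "x \<bullet> \<omega> = N0"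
    using the_maximizer[OF W, of x] by (simp_all add: \<omega>_def N0_def)
  have le: "x \<bullet> v \<le> N0" if "v \<in> W" for v
    using support_fun_upper[OF W(1) that] by (simp add: N0_def)
  obtain w where w: "\<And>n. w n \<in> W" "\<And>n. N n = x \<bullet> w n * (1 - e n * \<tau> n (w n))"
    using attained by metis
  have "bounded ((\<lambda>v. x \<bullet> v) ` W)"
    by (intro compact_imp_bounded compact_continuous_image W continuous_intros)
  then obtain B where B: "B > 0" "\<And>v. v \<in> W \<Longrightarrow> \<bar>x \<bullet> v\<bar> \<le> B" by (auto simp: bounded_pos)
  have lim_xw: "(\<lambda>n. x \<bullet> w n) \<longlonglongrightarrow> N0"
  proof (rule tendsto_sandwich)
    show "\<forall>\<^sub>F n in sequentially. x \<bullet> w n \<le> N0" using le w(1) by simp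
    show "\<forall>\<^sub>F n in sequentially. N0 - e n * (2 * (B * C)) \<le> x \<bullet> w n"
    proof (rule always_eventually, rule allI)
      fix n
      have prod: "\<bar>x \<bullet> v * \<tau> n v\<bar> \<le> B * C" if "v \<in> W" for v
        unfolding abs_mult using B bound[OF that, of n] that by (intro mult_mono) auto
      have "N0 * (1 - e n * \<tau> n \<omega>) \<le> x \<bullet> w n * (1 - e n * \<tau> n (w n))"
        using upper[OF \<omega>(1), of n] w(2)[of n] by (simp add: \<omega>(2))
      then have "N0 - x \<bullet> w n \<le> e n * (N0 * \<tau> n \<omega> - x \<bullet> w n * \<tau> n (w n))"
        by (simp add: algebra_simps)
      also have "\<dots> \<le> e n * (2 * (B * C))"
        using prod[OF \<omega>(1)] prod[OF w(1), of n] e(1)[of n] by (intro mult_left_mono) (auto simp: \<omega>(2))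
      finally show "N0 - e n * (2 * (B * C)) \<le> x \<bullet> w n" by simp
    qed
    show "(\<lambda>n. N0 - e n * (2 * (B * C))) \<longlonglongrightarrow> N0"
      using e(2) by (auto intro!: tendsto_eq_intros)
  qed auto
  have lim_w: "w \<longlonglongrightarrow> \<omega>"
  proof (rule topological_tendstoI)
    fix U assume U: "open U" "\<omega> \<in> U"
    show "\<forall>\<^sub>F n in sequentially. w n \<in> U"
    proof (cases "W - U = {}")
      case True
      then have "w n \<in> U" for n using w(1) by blast
      then show ?thesis by simp
    next
      case False
      have "compact (W - U)" using W(1) U(1) by (rule compact_diff)
      then obtain v where v: "v \<in> W - U" "\<And>y. y \<in> W - U \<Longrightarrow> x \<bullet> y \<le> x \<bullet> v"
        using continuous_attains_sup[OF _ False, of "\<lambda>v. x \<bullet> v"]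
          continuous_on_inner[OF continuous_on_const continuous_on_id] by blast
      have "x \<bullet> v \<noteq> N0"
      proof
        assume "x \<bullet> v = N0"
        then have "the_maximizer W x = v"
          using v x W by (intro the_maximizer_unique) (auto simp: N0_def)
        with v U show False by (simp add: \<omega>_def)
      qed
      then have "x \<bullet> v < N0" using le[of v] v by simp
      with lim_xw have "\<forall>\<^sub>F n in sequentially. x \<bullet> v < x \<bullet> w n" by (rule order_tendstoD)
      then show ?thesis
      proof eventually_elim
        case (elim n)
        then show ?case using v(2)[of "w n"] w(1)[of n] by force
      qed
    qed
  qed
  have "(\<lambda>n. \<gamma> (w n)) \<longlonglongrightarrow> \<gamma> \<omega>"
    by (rule continuous_on_tendsto_compose[OF \<gamma> lim_w \<omega>(1)]) (simp add: w(1))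
  moreover have "(\<lambda>n. \<tau> n (w n) - \<gamma> (w n)) \<longlonglongrightarrow> 0"
  proof (rule tendstoI)
    fix \<epsilon> :: real assume "\<epsilon> > 0"
    from uniform_limitD[OF \<tau> this] show "\<forall>\<^sub>F n in sequentially. dist (\<tau> n (w n) - \<gamma> (w n)) 0 < \<epsilon>"
      by eventually_elim (use w(1) in \<open>auto simp: dist_norm\<close>)
  qed
  ultimately have "(\<lambda>n. \<gamma> (w n) + (\<tau> n (w n) - \<gamma> (w n))) \<longlonglongrightarrow> \<gamma> \<omega> + 0" by (rule tendsto_add)
  then have lim_\<tau>: "(\<lambda>n. \<tau> n (w n)) \<longlonglongrightarrow> \<gamma> \<omega>" by simp
  show ?thesis
    unfolding N0_def[symmetric] \<omega>_def[symmetric]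
  proof (rule tendsto_sandwich)
    show "\<forall>\<^sub>F n in sequentially. x \<bullet> w n * \<tau> n (w n) \<le> (N0 - N n) / e n"
    proof (rule always_eventually, rule allI)
      fix n
      have "e n * (x \<bullet> w n * \<tau> n (w n)) = x \<bullet> w n - N n" by (simp add: w(2) algebra_simps)
      also have "\<dots> \<le> N0 - N n" using le[OF w(1)] by simp
      finally show "x \<bullet> w n * \<tau> n (w n) \<le> (N0 - N n) / e n" using e(1)[of n] by (simp add: field_simps)
    qed
    show "\<forall>\<^sub>F n in sequentially. (N0 - N n) / e n \<le> N0 * \<tau> n \<omega>"
    proof (rule always_eventually, rule allI)
      fix n
      have "N0 - N n \<le> e n * (N0 * \<tau> n \<omega>)" using upper[OF \<omega>(1), of n] by (simp add: \<omega>(2) algebra_simps)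
      then show "(N0 - N n) / e n \<le> N0 * \<tau> n \<omega>" using e(1)[of n] by (simp add: field_simps)
    qed
    show "(\<lambda>n. x \<bullet> w n * \<tau> n (w n)) \<longlonglongrightarrow> N0 * \<gamma> \<omega>"
      by (intro tendsto_mult lim_xw lim_\<tau>)
    show "(\<lambda>n. N0 * \<tau> n \<omega>) \<longlonglongrightarrow> N0 * \<gamma> \<omega>"
      by (intro tendsto_mult tendsto_const tendsto_uniform_limitI[OF \<tau> \<omega>(1)])
  qed
qed

lemma difference_quotient_compose:
  fixes f :: "real \<Rightarrow> real"
  assumes f: "(f has_real_derivative D) (at r)" and \<rho>: "\<rho> \<longlonglongrightarrow> r"
    and quot: "(\<lambda>n. (\<rho> n - r) / e n) \<longlonglongrightarrow> L"
  shows "(\<lambda>n. (f (\<rho> n) - f r) / e n) \<longlonglongrightarrow> D * L"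
proof -
  obtain g where g: "\<And>z. f z - f r = g z * (z - r)" "isCont g r" "g r = D"
    using f unfolding CARAT_DERIV by blast
  have "(\<lambda>n. g (\<rho> n) * ((\<rho> n - r) / e n)) \<longlonglongrightarrow> D * L"
    using isCont_tendsto_compose[OF g(2) \<rho>] g(3) quot by (intro tendsto_mult) auto
  then show ?thesis by (simp add: g(1))
qed

lemma partial_t_lipschitz:
  fixes G :: "real \<Rightarrow> 'a::euclidean_space \<Rightarrow> real"
  assumes diff: "\<forall>t>0. \<forall>u\<in>sphere 0 1. (\<lambda>s. G s u) differentiable (at t)"
    and cont: "continuous_on ({0<..} \<times> sphere 0 1) (\<lambda>(t, u). partial_t G t u)"
    and r: "0 < r"
  obtains B where "B > 0"
    "\<And>u s t. u \<in> sphere 0 1 \<Longrightarrow> s \<in> {r..R} \<Longrightarrow> t \<in> {r..R} \<Longrightarrow> \<bar>G s u - G t u\<bar> \<le> B * \<bar>s - t\<bar>"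
proof -
  have "compact ({r..R} \<times> sphere (0::'a) 1)" by (intro compact_Times) auto
  moreover have "continuous_on ({r..R} \<times> sphere (0::'a) 1) (\<lambda>(t, u). partial_t G t u)"
    by (rule continuous_on_subset[OF cont]) (use r in auto)
  ultimately have "bounded ((\<lambda>(t, u). partial_t G t u) ` ({r..R} \<times> sphere (0::'a) 1))"
    by (intro compact_imp_bounded compact_continuous_image)
  then obtain B where B: "B > 0" "\<And>t u. t \<in> {r..R} \<Longrightarrow> u \<in> sphere 0 1 \<Longrightarrow> \<bar>partial_t G t u\<bar> \<le> B"
    unfolding bounded_pos by force
  show ?thesis
  proof (rule that[OF B(1)])
    fix u :: 'a and s t assume u: "u \<in> sphere 0 1" and st: "s \<in> {r..R}" "t \<in> {r..R}"
    have "norm (G s u - G t u) \<le> B * norm (s - t)"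
    proof (rule field_differentiable_bound[of "{r..R}" "\<lambda>s. G s u" "\<lambda>s. partial_t G s u"])
      fix z assume z: "z \<in> {r..R}"
      then have "(\<lambda>s. G s u) differentiable (at z)" using diff u r by auto
      then show "((\<lambda>s. G s u) has_real_derivative partial_t G z u) (at z within {r..R})"
        by (rule has_field_derivative_at_within[OF has_real_derivative_partial_t])
      show "norm (partial_t G z u) \<le> B" using B(2)[OF z u] by simp
    qed (use st in auto)
    then show "\<bar>G s u - G t u\<bar> \<le> B * \<bar>s - t\<bar>" by simp
  qed
qed

text \<open>
  The points whose support function is the gauge function of the Aleksandrov body.
\<close>

definition wulff_points :: "'a::euclidean_space set \<Rightarrow> ('a \<Rightarrow> real) \<Rightarrow> 'a set" where
  "wulff_points \<Omega> f = (\<lambda>v. v /\<^sub>R f v) ` \<Omega>"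

lemma gauge_body_wulff_points:
  fixes \<Omega> :: "'a::euclidean_space set"
  assumes \<Omega>: "closed \<Omega>" "\<Omega> \<subseteq> sphere 0 1"
    and hemi: "\<forall>v\<in>sphere 0 1. \<not> \<Omega> \<subseteq> {u \<in> sphere 0 1. u \<bullet> v \<ge> 0}"
    and f: "f \<in> pos_continuous \<Omega>"
  shows "gauge_body (wulff_points \<Omega> f)" and "gauge_body.K (wulff_points \<Omega> f) = aleksandrov_body \<Omega> f"
proof -
  have pos: "f v > 0" if "v \<in> \<Omega>" for v using f that by (auto simp: pos_continuous_def)
  show gb: "gauge_body (wulff_points \<Omega> f)"
  proof
    have "compact (sphere 0 1 \<inter> \<Omega>)"
      by (rule compact_Int_closed[OF compact_sphere \<Omega>(1)])
    then have "compact \<Omega>" using \<Omega>(2) by (simp add: Int_absorb1)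
    moreover have "continuous_on \<Omega> (\<lambda>v. v /\<^sub>R f v)"
      using f by (intro continuous_intros) (force simp: pos_continuous_def)+
    ultimately show "compact (wulff_points \<Omega> f)"
      unfolding wulff_points_def by (rule compact_continuous_image[rotated])
    fix x :: 'a assume "x \<noteq> 0"
    then have "- sgn x \<in> sphere 0 1" by (simp add: norm_sgn)
    then obtain v where v: "v \<in> \<Omega>" "\<not> v \<bullet> (- sgn x) \<ge> 0" using hemi \<Omega>(2) by blast
    then have "v \<bullet> x > 0"
      using \<open>x \<noteq> 0\<close> by (simp add: sgn_div_norm not_le zero_less_mult_iff zero_less_divide_iff)
    then have "x \<bullet> (v /\<^sub>R f v) > 0" using pos[OF v(1)] by (simp add: inner_commute)
    then show "\<exists>w\<in>wulff_points \<Omega> f. x \<bullet> w > 0" using v(1) by (auto simp: wulff_points_def)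
  qed
  then interpret gauge_body "wulff_points \<Omega> f" .
  have "N x \<le> 1 \<longleftrightarrow> (\<forall>v\<in>\<Omega>. x \<bullet> v \<le> f v)" for x
    using pos unfolding support_fun_le_iff[OF compact_W W_nonempty]
    by (auto simp: wulff_points_def field_simps)
  then show "K = aleksandrov_body \<Omega> f"
    unfolding K_def aleksandrov_body_def by auto
qed

text \<open>
  The variational formula for a perturbation of \<open>h\<close> with logarithmic derivative \<open>g\<close>. In the
  direction \<open>u\<close> the radial function \<open>1 / N u\<close> of the body has the logarithmic derivative
  \<open>g (\<alpha> u)\<close> by Danskin's theorem, for almost all \<open>u\<close>. The chain rule and dominated convergence give
  the integral of \<open>\<rho> G\<^sub>t(\<rho>, u) g (\<alpha> u)\<close>, where \<open>\<rho> = 1 / N u\<close>.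
\<close>

lemma gen_dual_volume_variation:
  fixes \<Omega> :: "'a::euclidean_space set"
  assumes \<Omega>: "closed \<Omega>" "\<Omega> \<subseteq> sphere 0 1"
    and hemi: "\<forall>v\<in>sphere 0 1. \<not> \<Omega> \<subseteq> {u \<in> sphere 0 1. u \<bullet> v \<ge> 0}"
    and h: "h \<in> pos_continuous \<Omega>" and hn: "\<And>n. hn n \<in> pos_continuous \<Omega>"
    and e: "\<And>n. e n > 0" "e \<longlonglongrightarrow> 0"
    and g: "continuous_on \<Omega> g"
    and lim: "uniform_limit \<Omega> (\<lambda>n v. (1 - h v / hn n v) / e n) g sequentially"
    and contG: "continuous_on ({0<..} \<times> sphere 0 1) (\<lambda>(t, u). G t u)"
    and diffG: "\<forall>t>0. \<forall>u\<in>sphere 0 1. (\<lambda>s. G s u) differentiable (at t)"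
    and contG': "continuous_on ({0<..} \<times> sphere 0 1) (\<lambda>(t, u). partial_t G t u)"
  defines "W \<equiv> wulff_points \<Omega> h"
  shows "(\<lambda>n. (gen_dual_volume G (aleksandrov_body \<Omega> (hn n)) - gen_dual_volume G (aleksandrov_body \<Omega> h)) / e n)
    \<longlonglongrightarrow> (LINT u|sphere_measure. (indicator \<Omega> (gauge_body.\<alpha> W u) * g (gauge_body.\<alpha> W u)) *
          (1 / support_fun W u * partial_t G (1 / support_fun W u) u))"
proof -
  interpret gauge_body W unfolding W_def by (rule gauge_body_wulff_points[OF \<Omega> hemi h])
  have K: "K = aleksandrov_body \<Omega> h" unfolding W_def by (rule gauge_body_wulff_points[OF \<Omega> hemi h])
  define W' where "W' = (\<lambda>n. wulff_points \<Omega> (hn n))"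
  have gb: "gauge_body (W' n)" and K': "gauge_body.K (W' n) = aleksandrov_body \<Omega> (hn n)" for n
    unfolding W'_def by (rule gauge_body_wulff_points[OF \<Omega> hemi hn])+
  define M where "M = (\<lambda>n. support_fun (W' n))"
  define q where "q = (\<lambda>n v. (1 - h v / hn n v) / e n)"
  define \<tau> where "\<tau> = (\<lambda>n w. q n (sgn w))"
  have h_pos: "h v > 0" and hn_pos: "hn n v > 0" if "v \<in> \<Omega>" for n v
    using h hn that by (auto simp: pos_continuous_def)
  have sgn_w: "sgn (v /\<^sub>R h v) = v" if "v \<in> \<Omega>" for v
    using that \<Omega>(2) h_pos[OF that] by (auto simp: sgn_div_norm)
  have sgn_W: "sgn w \<in> \<Omega>" if "w \<in> W" for w
    using that sgn_w by (auto simp: W_def wulff_points_def)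
  have point: "x \<bullet> (v /\<^sub>R hn n v) = x \<bullet> (v /\<^sub>R h v) * (1 - e n * \<tau> n (v /\<^sub>R h v))" if "v \<in> \<Omega>" for x n v
  proof -
    have ratio: "1 - e n * \<tau> n (v /\<^sub>R h v) = h v / hn n v"
      unfolding \<tau>_def sgn_w[OF that] q_def using e(1)[of n] by simp
    show ?thesis
      unfolding ratio using h_pos[OF that] hn_pos[OF that, of n] by (simp add: field_simps)
  qed
  have upper: "x \<bullet> w * (1 - e n * \<tau> n w) \<le> M n x" if w: "w \<in> W" for x n w
  proof -
    obtain v where v: "v \<in> \<Omega>" "w = v /\<^sub>R h v" using w by (auto simp: W_def wulff_points_def)
    have "x \<bullet> (v /\<^sub>R hn n v) \<le> M n x"
      unfolding M_def using v by (intro support_fun_upper gauge_body.compact_W[OF gb]) (auto simp: W'_def wulff_points_def)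
    then show ?thesis unfolding point[OF v(1)] v(2) .
  qed
  have attained: "\<exists>w\<in>W. M n x = x \<bullet> w * (1 - e n * \<tau> n w)" for n x
  proof -
    obtain w' where w': "w' \<in> W' n" "x \<bullet> w' = M n x"
      unfolding M_def using support_fun_attained[OF gauge_body.compact_W[OF gb] gauge_body.W_nonempty[OF gb]] by metis
    then obtain v where v: "v \<in> \<Omega>" "w' = v /\<^sub>R hn n v" by (auto simp: W'_def wulff_points_def)
    have "M n x = x \<bullet> (v /\<^sub>R h v) * (1 - e n * \<tau> n (v /\<^sub>R h v))"
      unfolding point[OF v(1), symmetric] v(2)[symmetric] using w'(2) by simp
    moreover have "v /\<^sub>R h v \<in> W" using v(1) by (simp add: W_def wulff_points_def)
    ultimately show ?thesis by blast
  qed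
  have compact_\<Omega>: "compact \<Omega>"
    using compact_Int_closed[OF compact_sphere \<Omega>(1), of 0 1] \<Omega>(2) by (simp add: Int_absorb1)
  have \<tau>_lim: "uniform_limit W \<tau> (\<lambda>w. g (sgn w)) sequentially"
  proof (rule uniform_limitI)
    fix \<epsilon> :: real assume "\<epsilon> > 0"
    from uniform_limitD[OF lim this] show "\<forall>\<^sub>F n in sequentially. \<forall>w\<in>W. dist (\<tau> n w) (g (sgn w)) < \<epsilon>"
      by eventually_elim (use sgn_W in \<open>auto simp: \<tau>_def q_def\<close>)
  qed
  have cont_\<gamma>: "continuous_on W (\<lambda>w. g (sgn w))"
  proof (rule continuous_on_compose2[OF g])
    show "continuous_on W sgn"
      using sgn_W \<Omega>(2) by (intro continuous_intros) force
  qed (use sgn_W in auto)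
  have "bounded (g ` \<Omega>)" by (intro compact_imp_bounded compact_continuous_image g compact_\<Omega>)
  then obtain Cg where Cg: "Cg > 0" "\<And>v. v \<in> \<Omega> \<Longrightarrow> \<bar>g v\<bar> \<le> Cg" unfolding bounded_pos by auto
  define C where "C = Cg + 1"
  have C: "C > 0" using Cg by (simp add: C_def)
  obtain c L where cL: "0 < c" "0 < L" "\<And>x. c * norm x \<le> N x" "\<And>x. N x \<le> L * norm x" using N_bounds by metis
  \<comment> \<open>bounds for all radial functions involved once \<open>M n u\<close> differs from \<open>N u\<close> by at most half of \<open>N u\<close>\<close>
  define r R where "r = 2 / (3 * L)" and "R = 2 / c"
  have r: "r > 0" using cL by (simp add: r_def)
  obtain B where B: "B > 0"
    "\<And>u s t. u \<in> sphere 0 1 \<Longrightarrow> s \<in> {r..R} \<Longrightarrow> t \<in> {r..R} \<Longrightarrow> \<bar>G s u - G t u\<bar> \<le> B * \<bar>s - t\<bar>"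
    using partial_t_lipschitz[OF diffG contG' r, of R] by blast
  define s where "s = (\<lambda>n u. (G (1 / M n u) u - G (1 / N u) u) / e n)"
  have "\<forall>\<^sub>F n in sequentially. (\<forall>w\<in>W. \<bar>\<tau> n w\<bar> \<le> C) \<and> e n * C \<le> 1 / 2"
  proof -
    have "\<forall>\<^sub>F n in sequentially. \<forall>w\<in>W. \<bar>\<tau> n w\<bar> \<le> C"
      using uniform_limitD[OF \<tau>_lim zero_less_one]
    proof eventually_elim
      case (elim n)
      show ?case
      proof
        fix w assume w: "w \<in> W"
        then have "\<bar>\<tau> n w - g (sgn w)\<bar> < 1" using elim by (simp add: dist_real_def)
        then show "\<bar>\<tau> n w\<bar> \<le> C" using Cg(2)[OF sgn_W[OF w]] by (simp add: C_def)
      qed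
    qed
    moreover have "(\<lambda>n. e n * C) \<longlonglongrightarrow> 0" using e(2) by (auto intro!: tendsto_eq_intros)
    then have "\<forall>\<^sub>F n in sequentially. e n * C < 1 / 2" by (rule order_tendstoD) simp
    ultimately show ?thesis by eventually_elim auto
  qed
  \<comment> \<open>the domination holds from \<open>n0\<close> on only, so the limit is taken along the shifted sequence\<close>
  then obtain n0 where n0: "\<And>n. n \<ge> n0 \<Longrightarrow> (\<forall>w\<in>W. \<bar>\<tau> n w\<bar> \<le> C) \<and> e n * C \<le> 1 / 2"
    by (auto simp: eventually_sequentially)
  have close: "\<bar>N u - M n u\<bar> \<le> e n * C * N u" if n: "n \<ge> n0" and u: "u \<in> sphere 0 1" for n u
  proof -
    have Nu: "N u > 0" using u by (intro N_pos) auto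
    have \<tau>: "\<bar>e n * \<tau> n w\<bar> \<le> e n * C" "\<bar>e n * \<tau> n w\<bar> \<le> 1/2" if "w \<in> W" for w
    proof -
      have "e n * \<bar>\<tau> n w\<bar> \<le> e n * C" using n0[OF n] that e(1)[of n] by (intro mult_left_mono) auto
      moreover have "\<bar>e n * \<tau> n w\<bar> = e n * \<bar>\<tau> n w\<bar>" using e(1)[of n] by (simp add: abs_mult)
      moreover have "e n * C \<le> 1/2" using n0[OF n] by simp
      ultimately show "\<bar>e n * \<tau> n w\<bar> \<le> e n * C" "\<bar>e n * \<tau> n w\<bar> \<le> 1/2" by linarith+
    qed
    obtain w where w: "w \<in> W" "u \<bullet> w = N u" using support_fun_attained[OF compact_W W_nonempty, of u] by metis
    have "N u * (1 - e n * C) \<le> N u * (1 - e n * \<tau> n w)"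
      using \<tau>[OF w(1)] Nu by (intro mult_left_mono) auto
    also have "\<dots> \<le> M n u" using upper[OF w(1), of u n] w(2) by simp
    finally have lo: "N u - M n u \<le> e n * C * N u" by (simp add: algebra_simps)
    obtain w' where w': "w' \<in> W" "M n u = u \<bullet> w' * (1 - e n * \<tau> n w')" using attained by blast
    have "0 \<le> 1 - e n * \<tau> n w'" using \<tau>[OF w'(1)] by (simp add: abs_le_iff)
    then have "M n u \<le> N u * (1 - e n * \<tau> n w')"
      unfolding w'(2) by (intro mult_right_mono support_fun_upper[OF compact_W w'(1)])
    also have "\<dots> \<le> N u * (1 + e n * C)"
      using \<tau>[OF w'(1)] Nu by (intro mult_left_mono) (auto simp: abs_le_iff)
    finally have "M n u - N u \<le> e n * C * N u" by (simp add: algebra_simps)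
    with lo show ?thesis by (simp add: abs_le_iff)
  qed
  have range: "1 / N u \<in> {r..R}" "1 / M n u \<in> {r..R}" "M n u \<ge> N u / 2" "c \<le> N u"
    if n: "n \<ge> n0" and u: "u \<in> sphere 0 1" for n u
  proof -
    have Nu: "c \<le> N u" "N u \<le> L" using cL(3)[of u] cL(4)[of u] u by auto
    have "e n * C * N u \<le> 1 / 2 * N u" using n0[OF n] Nu cL(1) by (intro mult_right_mono) auto
    then have M: "N u / 2 \<le> M n u" "M n u \<le> 3 / 2 * N u"
      using close[OF n u] by (auto simp: abs_le_iff)
    have *: "1 / y \<in> {r..R}" if "c / 2 \<le> y" "y \<le> 3 / 2 * L" for y
      using that cL(1,2) by (auto simp: r_def R_def field_simps)
    show "1 / N u \<in> {r..R}" using Nu cL by (intro *) auto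
    show "1 / M n u \<in> {r..R}" using Nu M by (intro *) auto
    show "M n u \<ge> N u / 2" "c \<le> N u" using M Nu by auto
  qed
  have s_bound: "\<bar>s n u\<bar> \<le> B * (2 * C / c)" if n: "n \<ge> n0" and u: "u \<in> sphere 0 1" for n u
  proof -
    note rg = range[OF n u]
    have Nu: "N u > 0" and Mu: "M n u > 0" using rg(3,4) cL(1) by auto
    have "1 / M n u - 1 / N u = (N u - M n u) / (N u * M n u)"
      using Nu Mu by (simp add: diff_frac_eq mult.commute)
    then have "\<bar>1 / M n u - 1 / N u\<bar> = \<bar>N u - M n u\<bar> / (N u * M n u)"
      using Nu Mu by (simp only: abs_divide abs_mult abs_of_pos)
    also have "\<dots> \<le> e n * C * N u / (N u * (N u / 2))"
      using close[OF n u] rg(3) Nu Mu by (intro frac_le mult_left_mono mult_pos_pos) auto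
    also have "\<dots> = e n * (2 * C / N u)" using Nu by simp
    also have "\<dots> \<le> e n * (2 * C / c)"
      using rg(4) cL(1) C e(1)[of n] by (intro mult_left_mono divide_left_mono) auto
    finally have "B * \<bar>1 / M n u - 1 / N u\<bar> \<le> B * (e n * (2 * C / c))"
      using B(1) by (intro mult_left_mono) auto
    then have "\<bar>G (1 / M n u) u - G (1 / N u) u\<bar> \<le> B * (e n * (2 * C / c))"
      using B(2)[OF u rg(2,1)] by simp
    then show ?thesis using e(1)[of n] by (simp add: s_def field_simps)
  qed
  have contM: "continuous_on (sphere 0 1) (\<lambda>u. G (1 / M n u) u)" for n
    unfolding M_def by (rule gauge_body.continuous_on_sphere_compose[OF gb contG])
  have contN: "continuous_on (sphere 0 1) (\<lambda>u. G (1 / N u) u)"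
    by (rule continuous_on_sphere_compose[OF contG])
  have meas_s: "s n \<in> borel_measurable sphere_measure" for n
    unfolding s_def using e(1)[of n]
    by (intro borel_measurable_sphere_measure_continuous continuous_on_divide continuous_on_diff contM contN continuous_on_const) auto
  let ?F = "\<lambda>u. (indicator \<Omega> (\<alpha> u) * g (\<alpha> u)) * (1 / N u * partial_t G (1 / N u) u)"
  have meas_F: "?F \<in> borel_measurable sphere_measure"
  proof (rule borel_measurable_times)
    have "(\<lambda>v. indicator \<Omega> v *\<^sub>R g v) \<in> borel_measurable borel"
      using \<Omega>(1) g by (intro borel_measurable_continuous_on_indicator) auto
    then have "(\<lambda>v. indicator \<Omega> v * g v) \<in> borel_measurable (restrict_space borel (sphere 0 1))"
      by (intro measurable_restrict_space1) simp
    then show "(\<lambda>u. indicator \<Omega> (\<alpha> u) * g (\<alpha> u)) \<in> borel_measurable sphere_measure"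
      by (rule measurable_compose[OF measurable_\<alpha>])
    show "(\<lambda>u. 1 / N u * partial_t G (1 / N u) u) \<in> borel_measurable sphere_measure"
      by (intro borel_measurable_sphere_measure_continuous continuous_on_mult continuous_on_inverse_N
          continuous_on_sphere_compose contG')
  qed
  have pointwise: "(\<lambda>n. s (n + n0) u) \<longlonglongrightarrow> ?F u" if u: "u \<in> sphere 0 1" "u \<notin> Z" for u
  proof -
    have Nu: "N u > 0" using u by (intro N_pos) auto
    have mm: "u \<notin> multiple_maximizers W"
      using u(2) W_subset_hull unfolding Z_def multiple_maximizers_def support_fun_W_hull by blast
    have \<omega>W: "the_maximizer W u = \<omega> u"
      by (rule the_maximizer_unique[OF compact_W \<omega>_in_W[OF u(2)] inner_\<omega> mm])
    have \<alpha>u: "\<alpha> u = sgn (\<omega> u)" using u by (intro \<alpha>_eq) auto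
    have \<alpha>\<Omega>: "\<alpha> u \<in> \<Omega>" unfolding \<alpha>u by (rule sgn_W[OF \<omega>_in_W[OF u(2)]])
    have e': "(\<lambda>n. e (n + n0)) \<longlonglongrightarrow> 0" using e(2) by (rule LIMSEQ_ignore_initial_segment)
    have "(\<lambda>n. (N u - M (n + n0) u) / e (n + n0)) \<longlonglongrightarrow> N u * g (sgn (the_maximizer W u))"
    proof (rule danskin_quotient[OF compact_W W_nonempty mm _ e' _ cont_\<gamma>, where \<tau> = "\<lambda>n. \<tau> (n + n0)" and C = C])
      show "uniform_limit W (\<lambda>n. \<tau> (n + n0)) (\<lambda>w. g (sgn w)) sequentially"
        using filterlim_compose[OF \<tau>_lim filterlim_add_const_nat_at_top[of n0]] by simp
    qed (use e(1) n0 upper attained in auto)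
    then have quotN: "(\<lambda>n. (N u - M (n + n0) u) / e (n + n0)) \<longlonglongrightarrow> N u * g (\<alpha> u)"
      by (simp add: \<omega>W \<alpha>u)
    from tendsto_mult[OF this e'] have "(\<lambda>n. N u - M (n + n0) u) \<longlonglongrightarrow> 0"
      using e(1) by (simp add: less_imp_neq[symmetric])
    from tendsto_diff[OF tendsto_const this, of "N u"] have M_lim: "(\<lambda>n. M (n + n0) u) \<longlonglongrightarrow> N u" by simp
    have M_pos: "M (n + n0) u > 0" for n using range(3)[of "n + n0" u] u Nu by simp
    have quot: "(\<lambda>n. (1 / M (n + n0) u - 1 / N u) / e (n + n0)) \<longlonglongrightarrow> g (\<alpha> u) / N u"
    proof -
      have "(\<lambda>n. (N u - M (n + n0) u) / e (n + n0) * (1 / (N u * M (n + n0) u))) \<longlonglongrightarrow>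
          N u * g (\<alpha> u) * (1 / (N u * N u))"
        using Nu by (intro tendsto_intros quotN M_lim) auto
      moreover have "(N u - M (n + n0) u) / e (n + n0) * (1 / (N u * M (n + n0) u)) =
          (1 / M (n + n0) u - 1 / N u) / e (n + n0)" for n
        using Nu M_pos[of n] e(1)[of "n + n0"] by (simp add: field_simps)
      ultimately show ?thesis using Nu by simp
    qed
    have "(\<lambda>n. 1 / M (n + n0) u) \<longlonglongrightarrow> 1 / N u" using Nu by (intro tendsto_intros M_lim) auto
    moreover have "((\<lambda>s. G s u) has_real_derivative partial_t G (1 / N u) u) (at (1 / N u))"
      using diffG u(1) Nu by (intro has_real_derivative_partial_t) auto
    ultimately have "(\<lambda>n. s (n + n0) u) \<longlonglongrightarrow> partial_t G (1 / N u) u * (g (\<alpha> u) / N u)"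
      unfolding s_def using quot by (intro difference_quotient_compose)
    then show ?thesis using \<alpha>\<Omega> by (simp add: mult.commute)
  qed
  interpret sm: finite_measure "sphere_measure :: 'a measure" by (rule finite_measure_sphere_measure)
  have int_lim: "(\<lambda>n. LINT u|sphere_measure. s (n + n0) u) \<longlonglongrightarrow> (LINT u|sphere_measure. ?F u)"
  proof (rule integral_dominated_convergence[OF meas_F meas_s])
    show "integrable sphere_measure (\<lambda>u::'a. B * (2 * C / c))" by simp
    show "AE u in sphere_measure. (\<lambda>n. s (n + n0) u) \<longlonglongrightarrow> ?F u"
      using AE_not_Z AE_space by eventually_elim (use pointwise in auto)
    show "AE u in sphere_measure. norm (s (n + n0) u) \<le> B * (2 * C / c)" for n
      using s_bound[of "n + n0"] by (intro AE_I2) auto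
  qed
  have vol: "(gen_dual_volume G (aleksandrov_body \<Omega> (hn n)) - gen_dual_volume G (aleksandrov_body \<Omega> h)) / e n =
      (LINT u|sphere_measure. s n u)" for n
  proof -
    have "gen_dual_volume G (aleksandrov_body \<Omega> (hn n)) = (LINT u|sphere_measure. G (1 / M n u) u)"
      unfolding K'[symmetric] M_def by (rule gauge_body.gen_dual_volume_K[OF gb])
    moreover have "gen_dual_volume G (aleksandrov_body \<Omega> h) = (LINT u|sphere_measure. G (1 / N u) u)"
      unfolding K[symmetric] by (rule gen_dual_volume_K)
    ultimately show ?thesis
      unfolding s_def
      using integrable_sphere_measure_continuous[OF contM[of n]] integrable_sphere_measure_continuous[OF contN]
      by (simp add: Bochner_Integration.integral_diff)
  qed
  show ?thesis
    unfolding vol by (rule LIMSEQ_offset[OF int_lim])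
qed

section \<open>The variational formula\<close>

theorem theorem5p6:
  fixes \<Omega> :: "'a::euclidean_space set"
    and h1 h2 :: "'a \<Rightarrow> real"
    and \<phi>1 \<phi>2 :: "real \<Rightarrow> real"
    and G :: "real \<Rightarrow> 'a \<Rightarrow> real"
  assumes "closed \<Omega>" and "\<Omega> \<subseteq> sphere 0 1"
    and "\<forall>v\<in>sphere 0 1. \<not> \<Omega> \<subseteq> {u \<in> sphere 0 1. u \<bullet> v \<ge> 0}"
    and "h1 \<in> pos_continuous \<Omega>" and "h2 \<in> pos_continuous \<Omega>"
    and "(\<phi>1 \<in> class_I \<and> \<phi>2 \<in> class_I) \<or> (\<phi>1 \<in> class_D \<and> \<phi>2 \<in> class_D)"
    and "\<phi>1 C1_differentiable_on {0<..}" and "\<forall>t>0. deriv \<phi>1 t \<noteq> 0"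
    and "\<phi>2 C1_differentiable_on {0<..}" and "\<forall>t>0. deriv \<phi>2 t \<noteq> 0"
    and "\<forall>t>0. \<forall>u\<in>sphere 0 1. G t u > 0"
    and "continuous_on ({0<..} \<times> sphere 0 1) (\<lambda>(t, u). G t u)"
    and "\<forall>t>0. \<forall>u\<in>sphere 0 1. (\<lambda>s. G s u) differentiable (at t)"
    and "continuous_on ({0<..} \<times> sphere 0 1) (\<lambda>(t, u). partial_t G t u)"
  shows
    "(\<forall>\<epsilon>>0. \<exists>h. orlicz_perturbation \<Omega> \<phi>1 \<phi>2 h1 h2 \<epsilon> h \<and>
        (\<forall>k. orlicz_perturbation \<Omega> \<phi>1 \<phi>2 h1 h2 \<epsilon> k \<longrightarrow> (\<forall>u\<in>\<Omega>. k u = h u))) \<and>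
     (\<forall>h_eps :: real \<Rightarrow> 'a \<Rightarrow> real.
        (\<forall>\<epsilon>>0. orlicz_perturbation \<Omega> \<phi>1 \<phi>2 h1 h2 \<epsilon> (h_eps \<epsilon>)) \<longrightarrow>
        ((\<lambda>\<epsilon>. (gen_dual_volume G (aleksandrov_body \<Omega> (h_eps \<epsilon>))
               - gen_dual_volume G (aleksandrov_body \<Omega> h1)) / \<epsilon>)
         \<longlongrightarrow> real DIM('a) / deriv \<phi>1 1 *
             signed_set_integral (restrict_space borel (sphere 0 1))
               (gen_dual_curvature G (aleksandrov_body \<Omega> h1)) \<Omega>
               (\<lambda>u. \<phi>2 (h2 u / h1 u)))
        (at_right 0))"
proof (intro conjI allI impI)
  show "\<exists>h. orlicz_perturbation \<Omega> \<phi>1 \<phi>2 h1 h2 \<epsilon> h \<and>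
      (\<forall>k. orlicz_perturbation \<Omega> \<phi>1 \<phi>2 h1 h2 \<epsilon> k \<longrightarrow> (\<forall>u\<in>\<Omega>. k u = h u))" if "\<epsilon> > 0" for \<epsilon>
    by (rule ex1_orlicz_perturbation[OF assms(6,4,5) that])
next
  fix h_eps :: "real \<Rightarrow> 'a \<Rightarrow> real"
  assume "\<forall>\<epsilon>>0. orlicz_perturbation \<Omega> \<phi>1 \<phi>2 h1 h2 \<epsilon> (h_eps \<epsilon>)"
  then have P: "orlicz_perturbation \<Omega> \<phi>1 \<phi>2 h1 h2 \<epsilon> (h_eps \<epsilon>)" if "\<epsilon> > 0" for \<epsilon>
    using that by blast
  define f where "f = (\<lambda>u. \<phi>2 (h2 u / h1 u))"
  define g where "g = (\<lambda>u. f u / deriv \<phi>1 1)"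
  define W where "W = wulff_points \<Omega> h1"
  interpret gauge_body W
    unfolding W_def by (rule gauge_body_wulff_points[OF assms(1-4)])
  have K: "K = aleksandrov_body \<Omega> h1"
    unfolding W_def by (rule gauge_body_wulff_points[OF assms(1-4)])
  have compact_\<Omega>: "compact \<Omega>"
    using compact_Int_closed[OF compact_sphere assms(1), of 0 1] assms(2) by (simp add: Int_absorb1)
  have pos: "h1 u > 0" "h2 u > 0" if "u \<in> \<Omega>" for u
    using assms(4,5) that by (auto simp: pos_continuous_def)
  have cont_f: "continuous_on \<Omega> f"
  proof -
    have "continuous_on {0<..} \<phi>2" using assms(6) by (auto simp: class_I_def class_D_def)
    moreover have "continuous_on \<Omega> (\<lambda>u. h2 u / h1 u)"
      using assms(4,5) by (intro continuous_intros) (force simp: pos_continuous_def)+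
    ultimately show ?thesis
      unfolding f_def by (rule continuous_on_compose2) (use pos in auto)
  qed
  have nz: "deriv \<phi>1 t \<noteq> 0" if "t > 0" for t
    using assms(8) that by simp
  then have cont_g: "continuous_on \<Omega> g"
    unfolding g_def by (intro continuous_intros cont_f) auto
  let ?w = "\<lambda>u. 1 / N u * partial_t G (1 / N u) u"
  let ?L = "LINT u|sphere_measure. (indicator \<Omega> (\<alpha> u) * g (\<alpha> u)) * ?w u"
  have "((\<lambda>\<epsilon>. (gen_dual_volume G (aleksandrov_body \<Omega> (h_eps \<epsilon>))
      - gen_dual_volume G (aleksandrov_body \<Omega> h1)) / \<epsilon>) \<longlongrightarrow> ?L) (at_right 0)"
  proof (rule tendsto_at_right_sequentially[OF zero_less_one])
    fix e :: "nat \<Rightarrow> real" assume e: "\<And>n. 0 < e n" "e \<longlonglongrightarrow> 0"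
    have "uniform_limit \<Omega> (\<lambda>n v. (1 - h1 v / h_eps (e n) v) / e n) g sequentially"
    proof (rule uniform_limitI)
      fix r :: real assume "r > 0"
      obtain \<delta> where \<delta>: "\<delta> > 0" "\<And>\<epsilon> u. 0 < \<epsilon> \<Longrightarrow> \<epsilon> < \<delta> \<Longrightarrow> u \<in> \<Omega> \<Longrightarrow>
          \<bar>(1 - h1 u / h_eps \<epsilon> u) / \<epsilon> - \<phi>2 (h2 u / h1 u) / deriv \<phi>1 1\<bar> < r"
        using orlicz_perturbation_asymptotics[OF compact_\<Omega> assms(4-7) nz P \<open>r > 0\<close>] by blast
      have "\<forall>\<^sub>F n in sequentially. e n < \<delta>"
        using e(2) \<delta>(1) by (rule order_tendstoD)
      then show "\<forall>\<^sub>F n in sequentially. \<forall>v\<in>\<Omega>. dist ((1 - h1 v / h_eps (e n) v) / e n) (g v) < r"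
        by eventually_elim (use \<delta>(2) e(1) in \<open>simp add: dist_real_def g_def f_def\<close>)
    qed
    moreover have "h_eps (e n) \<in> pos_continuous \<Omega>" for n
      using P[OF e(1)] by (simp add: orlicz_perturbation_def)
    ultimately show "(\<lambda>n. (gen_dual_volume G (aleksandrov_body \<Omega> (h_eps (e n)))
        - gen_dual_volume G (aleksandrov_body \<Omega> h1)) / e n) \<longlonglongrightarrow> ?L"
      unfolding W_def
      by (intro gen_dual_volume_variation[where hn = "\<lambda>n. h_eps (e n)"] assms(1-4) e cont_g assms(12-14))
  qed
  moreover have "?L = real DIM('a) / deriv \<phi>1 1 *
      signed_set_integral (restrict_space borel (sphere 0 1)) (gen_dual_curvature G K) \<Omega> f"
  proof -
    have "bounded (f ` \<Omega>)"
      by (intro compact_imp_bounded compact_continuous_image cont_f compact_\<Omega>)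
    then obtain B where B: "B > 0" "\<And>u. u \<in> \<Omega> \<Longrightarrow> \<bar>f u\<bar> \<le> B" unfolding bounded_pos by auto
    have "(\<lambda>u. indicator \<Omega> u *\<^sub>R f u) \<in> borel_measurable borel"
      using assms(1) cont_f by (intro borel_measurable_continuous_on_indicator) auto
    then have meas: "(\<lambda>u. indicator \<Omega> u * f u) \<in> borel_measurable (restrict_space borel (sphere 0 1))"
      by (intro measurable_restrict_space1) simp
    have "?L = (LINT u|sphere_measure. 1 / deriv \<phi>1 1 * ((indicator \<Omega> (\<alpha> u) * f (\<alpha> u)) * ?w u))"
      by (intro Bochner_Integration.integral_cong refl) (simp add: g_def)
    also have "\<dots> = 1 / deriv \<phi>1 1 * (LINT u|sphere_measure. (indicator \<Omega> (\<alpha> u) * f (\<alpha> u)) * ?w u)"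
      by (rule integral_mult_right_zero)
    also have "\<dots> = 1 / deriv \<phi>1 1 * (real DIM('a) *
        signed_set_integral (restrict_space borel (sphere 0 1)) (gen_dual_curvature G K) \<Omega> f)"
      using B by (subst signed_set_integral_gen_dual_curvature[OF assms(14) meas, of B]) (auto simp: indicator_def)
    finally show ?thesis by simp
  qed
  ultimately show "((\<lambda>\<epsilon>. (gen_dual_volume G (aleksandrov_body \<Omega> (h_eps \<epsilon>))
      - gen_dual_volume G (aleksandrov_body \<Omega> h1)) / \<epsilon>)
      \<longlongrightarrow> real DIM('a) / deriv \<phi>1 1 *
        signed_set_integral (restrict_space borel (sphere 0 1))
          (gen_dual_curvature G (aleksandrov_body \<Omega> h1)) \<Omega> (\<lambda>u. \<phi>2 (h2 u / h1 u))) (at_right 0)"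
    unfolding K f_def by simp
qed

end
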